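(* Let $X$ be a finite directed graph carrying a logic circuit, with switching sheaf $\mathcal{S}$. Let $W\subset X$ be an open connected subinterval of the interior of an internal edge (a wire), and let $A=X\setminus K$, where $K\subset W$ is a closed subinterval with $W\setminus K$ having two components; thus $X=A\cup W$ and $A\cap W$ is a disjoint union of two open intervals. Let $k=\dim H^0(A;\mathcal{S})$, and let $P,Q:H^0(A;\mathcal{S})\to\mathbb{F}_2^2$ be the restrictions of sections over $A$ to, respectively, the component of $A\cap W$ at the gate input of $A$ where $W$ attaches (the output end of the wire) and the component at the gate output of $A$ where $W$ attaches. Let $\Delta:H^0(A;\mathcal{S})\oplus\mathbb{F}_2^2\to\mathbb{F}_2^4$ be the difference map of the Mayer-Vietoris sequence for $X=A\cup W$, whose matrix (over $\mathbb{F}_2$) is $$\Delta=\begin{pmatrix}P & I\\ Q& I\end{pmatrix},$$ with $P,Q$ written as $2\times k$ matrices and $I$ the $2\times 2$ identity. Then $\operatorname{rank}\Delta\in\{2,3,4\}$, with $\operatorname{rank}\Delta=2$ exactly when $P=Q$, and $$\dim H^0(X;\mathcal{S})=\dim H^0(A;\mathcal{S})-\begin{cases}0&\text{if }\operatorname{rank}\Delta=2\text{ (complete feedback)}\\1&\text{if }\operatorname{rank}\Delta=3\text{ (partial feedback)}\\2&\text{if }\operatorname{rank}\Delta=4\text{ (no feedback)}\end{cases}$$ and $$\dim H^1(X;\mathcal{S})=\dim H^1(A;\mathcal{S})+\begin{cases}2&\text{if }\operatorname{rank}\Delta=2\\1&\text{if }\operatorname{rank}\Delta=3\\0&\text{if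 }\operatorname{rank}\Delta=4.\end{cases}$$
   Context: Graphs: $X$ is a finite directed graph, not necessarily connected, with its usual topology. Self-loops are allowed, and so are external edges, i.e. edges with a vertex at only one end, the other end being open (external inputs and outputs). Edges that are not external are called internal. Logic circuit: an assignment to each vertex $v$ of a function $f_v:\mathbb{F}_2^{m(v)}\to\mathbb{F}_2^{n(v)}$ (the logic gate at $v$), where $m(v)$ and $n(v)$ are the in-degree and out-degree of $v$; the incoming edges and outgoing edges at $v$ are ordered. One-hot encoding: $T:\mathbb{F}_2\to\mathbb{F}_2^2$ with $T(0)=\begin{pmatrix}1\\0\end{pmatrix}$, $T(1)=\begin{pmatrix}0\\1\end{pmatrix}$. For the $j$-th component $f_{v,j}$ of $f_v$, let $\phi_{v,j}:(\mathbb{F}_2^2)^{\otimes m(v)}\to\mathbb{F}_2^2$ be the $\mathbb{F}_2$-linear map determined by $\phi_{v,j}(Ta_1\otimes\cdots\otimes Ta_{m(v)})=T(f_{v,j}(a_1,\dots,a_{m(v)}))$ for $a_i\in\mathbb{F}_2$. An empty tensor product is $\mathbb{F}_2$. Contraction onto the $i$-th factor is the linear map $(\mathbb{F}_2^2)^{\otimes m(v)}\to\mathbb{F}_2^2$ sending $Ta_1\otimes\cdots\otimes Ta_{m(v)}$ to $Ta_i$. Switching sheaf $\mathcal{S}$: the sheafification of the presheaf $S$ of $\mathbb{F}_2$-vector spaces defined on a base of the topology consisting of contractible open sets $U$ containing exactly one vertex (small neighborhoods of that vertex) and connected open sets $V$ contained in the interior of a single edge. If $U$ contains $v$, then $S(U)=(\mathbb{F}_2^2)^{\otimes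 m(v)}$, one factor for each incoming edge of $v$; and $S(V)=\mathbb{F}_2^2$. For $V\subset U$ with $V$ in the part of $U$ lying on the $i$-th incoming edge of $v$, the restriction is the contraction onto the $i$-th factor; for $V$ in the part of $U$ lying on the $j$-th outgoing edge of $v$, the restriction is $\phi_{v,j}$. Restrictions between basic sets of the same type (same vertex, or same edge) are identities. $H^k(X;\mathcal{S})$ denotes sheaf cohomology; for open $A\subset X$, $H^k(A;\mathcal{S})$ is the cohomology of the restriction of $\mathcal{S}$ to $A$. All dimensions and ranks are over $\mathbb{F}_2$. The wire $W$ has $H^0(W;\mathcal{S})=\mathbb{F}_2^2$ and $H^0(A\cap W;\mathcal{S})=\mathbb{F}_2^4$. The edge containing $W$ is directed from a gate output to a gate input, and in $A$ it is cut into an external output edge and an external input edge. *)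

theory Defs
  imports
    "HOL-Algebra.AbelCoset"
    "HOL-Algebra.Module"
    "HOL-Analysis.Homotopy"
    "HOL-Library.Z2"
begin

section \<open>Vector spaces over the field with two elements\<close>

text \<open>
  The field is the type \<open>bit\<close>. Vector spaces are carried by the HOL-Algebra record
  \<^typ>\<open>(bit, 'b) module\<close>; its ring multiplication and unit play no role for a module and are
  left undefined.
\<close>

definition mk_module ::
    "'b set \<Rightarrow> 'b \<Rightarrow> ('b \<Rightarrow> 'b \<Rightarrow> 'b) \<Rightarrow> (bit \<Rightarrow> 'b \<Rightarrow> 'b) \<Rightarrow> (bit, 'b) module" where
  "mk_module C z p m =
     \<lparr>carrier = C, mult = undefined, one = undefined, zero = z, add = p, smult = m\<rparr>"

definition vbasis :: "(bit, 'b) module \<Rightarrow> 'b set \<Rightarrow> bool" where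
  "vbasis M B \<longleftrightarrow> finite B \<and> B \<subseteq> carrier M \<and>
     (\<forall>x\<in>carrier M. \<exists>!c. c \<in> B \<rightarrow>\<^sub>E (UNIV :: bit set) \<and>
        x = finsum M (\<lambda>b. c b \<odot>\<^bsub>M\<^esub> b) B)"

definition fin_dim :: "(bit, 'b) module \<Rightarrow> bool" where
  "fin_dim M \<longleftrightarrow> (\<exists>B. vbasis M B)"

text \<open>Only meaningful when \<open>fin_dim M\<close> holds.\<close>

definition vdim :: "(bit, 'b) module \<Rightarrow> nat" where
  "vdim M = (THE n. \<exists>B. vbasis M B \<and> card B = n)"

definition lin_rank :: "(bit, 'b) module \<Rightarrow> (bit, 'c) module \<Rightarrow> ('b \<Rightarrow> 'c) \<Rightarrow> nat" where
  "lin_rank M N f = vdim (N\<lparr>carrier := f ` carrier M\<rparr>)"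

definition dir_sum ::
    "(bit, 'b) module \<Rightarrow> (bit, 'c) module \<Rightarrow> (bit, 'b \<times> 'c) module" where
  "dir_sum M N = mk_module (carrier M \<times> carrier N) (\<zero>\<^bsub>M\<^esub>, \<zero>\<^bsub>N\<^esub>)
     (\<lambda>(x, y) (x', y'). (x \<oplus>\<^bsub>M\<^esub> x', y \<oplus>\<^bsub>N\<^esub> y'))
     (\<lambda>r (x, y). (r \<odot>\<^bsub>M\<^esub> x, r \<odot>\<^bsub>N\<^esub> y))"

definition prod_module :: "'i set \<Rightarrow> ('i \<Rightarrow> (bit, 'b) module) \<Rightarrow> (bit, 'i \<Rightarrow> 'b) module" where
  "prod_module I M = mk_module (\<Pi>\<^sub>E i\<in>I. carrier (M i)) (\<lambda>i\<in>I. \<zero>\<^bsub>M i\<^esub>)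
     (\<lambda>s t. \<lambda>i\<in>I. s i \<oplus>\<^bsub>M i\<^esub> t i)
     (\<lambda>r s. \<lambda>i\<in>I. r \<odot>\<^bsub>M i\<^esub> s i)"

definition quot_module :: "(bit, 'b) module \<Rightarrow> 'b set \<Rightarrow> (bit, 'b set) module" where
  "quot_module M N = mk_module (a_rcosets\<^bsub>M\<^esub> N) N (set_add M)
     (\<lambda>r C. \<Union>x\<in>C. N +>\<^bsub>M\<^esub> (r \<odot>\<^bsub>M\<^esub> x))"


section \<open>Presheaves on a base, sheafification, sheaf cohomology\<close>

text \<open>
  \<open>opens F\<close> is the family of open sets on which \<open>F\<close> is given: a base of the topology, or (for a
  sheaf on a space \<open>Y\<close>) all open sets of \<open>Y\<close>, in which case \<open>Y = \<Union>(opens F)\<close>.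
  \<open>restr F U V\<close> is the restriction from \<open>U\<close> to \<open>V \<subseteq> U\<close>.
\<close>

record ('x, 's) presheaf =
  opens :: "'x set set"
  sections :: "'x set \<Rightarrow> (bit, 's) module"
  restr :: "'x set \<Rightarrow> 'x set \<Rightarrow> 's \<Rightarrow> 's"

definition germ ::
    "('x, 's) presheaf \<Rightarrow> 'x \<Rightarrow> 'x set \<Rightarrow> 's \<Rightarrow> ('x set \<times> 's) set" where
  "germ F x U a = {(V, b). V \<in> opens F \<and> x \<in> V \<and> b \<in> carrier (sections F V) \<and>
     (\<exists>N\<in>opens F. x \<in> N \<and> N \<subseteq> U \<inter> V \<and> restr F U N a = restr F V N b)}"

definition stalk :: "('x, 's) presheaf \<Rightarrow> 'x \<Rightarrow> (bit, ('x set \<times> 's) set) module" where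
  "stalk F x = mk_module
     {germ F x U a | U a. U \<in> opens F \<and> x \<in> U \<and> a \<in> carrier (sections F U)}
     (THE k. \<exists>U\<in>opens F. x \<in> U \<and> k = germ F x U \<zero>\<^bsub>sections F U\<^esub>)
     (\<lambda>g h. THE k. \<exists>U\<in>opens F. x \<in> U \<and> (\<exists>a\<in>carrier (sections F U). \<exists>b\<in>carrier (sections F U).
        g = germ F x U a \<and> h = germ F x U b \<and> k = germ F x U (a \<oplus>\<^bsub>sections F U\<^esub> b)))
     (\<lambda>r g. THE k. \<exists>U\<in>opens F. x \<in> U \<and> (\<exists>a\<in>carrier (sections F U).
        g = germ F x U a \<and> k = germ F x U (r \<odot>\<^bsub>sections F U\<^esub> a)))"

definition germs_of :: "('x, 's) presheaf \<Rightarrow> 'x set \<Rightarrow> 's \<Rightarrow> 'x \<Rightarrow> ('x set \<times> 's) set" where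
  "germs_of F U a = (\<lambda>x\<in>U. germ F x U a)"

text \<open>
  Sheafification by the etale space: a section over \<open>U\<close> is a family of germs that is locally the
  family of germs of one section of \<open>F\<close>. \<open>\<O>\<close> is the family of all open sets.
\<close>

definition sheafify ::
    "'x set set \<Rightarrow> ('x, 's) presheaf \<Rightarrow> ('x, 'x \<Rightarrow> ('x set \<times> 's) set) presheaf" where
  "sheafify \<O> F = \<lparr>
     opens = \<O>,
     sections = (\<lambda>U. (prod_module U (stalk F))\<lparr>carrier :=
        {s \<in> carrier (prod_module U (stalk F)).
           \<forall>x\<in>U. \<exists>N\<in>opens F. x \<in> N \<and> N \<subseteq> U \<and>
             (\<exists>a\<in>carrier (sections F N). \<forall>y\<in>N. s y = germ F y N a)}\<rparr>),
     restr = (\<lambda>U V s. restrict s V)\<rparr>"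

definition restrict_sheaf :: "('x, 's) presheaf \<Rightarrow> 'x set \<Rightarrow> ('x, 's) presheaf" where
  "restrict_sheaf F A = F\<lparr>opens := {U \<in> opens F. U \<subseteq> A}\<rparr>"

text \<open>
  Sheaf cohomology is computed from the Godement resolution. For a sheaf \<open>F\<close> put
  \<open>C\<^sup>0F(U) = (\<Prod>x\<in>U. F\<^sub>x)\<close> and let \<open>Z\<^sup>1F\<close> be the quotient sheaf \<open>C\<^sup>0F / F\<close>, i.e. the
  sheafification of \<open>U \<mapsto> C\<^sup>0F(U) / F(U)\<close>. The resolution continues with \<open>C\<^sup>1F = C\<^sup>0(Z\<^sup>1F)\<close>,
  \<open>C\<^sup>2F = C\<^sup>0(C\<^sup>1F / Z\<^sup>1F)\<close>; the kernel of \<open>C\<^sup>1F \<rightarrow> C\<^sup>2F\<close> is \<open>Z\<^sup>1F\<close>, so that on global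
  sections \<open>H\<^sup>1\<close> is \<open>Z\<^sup>1F(Y)\<close> modulo the image of \<open>C\<^sup>0F(Y)\<close>, while \<open>H\<^sup>0\<close> is \<open>F(Y)\<close>.
\<close>

definition godement_quot ::
    "('x, 's) presheaf \<Rightarrow> ('x, ('x \<Rightarrow> ('x set \<times> 's) set) set) presheaf" where
  "godement_quot F = \<lparr>
     opens = opens F,
     sections = (\<lambda>U. quot_module (prod_module U (stalk F))
        (germs_of F U ` carrier (sections F U))),
     restr = (\<lambda>U V C. \<Union>s\<in>C.
        (germs_of F V ` carrier (sections F V)) +>\<^bsub>prod_module V (stalk F)\<^esub> restrict s V)\<rparr>"

definition godement_cocycles ::
    "('x, 's) presheaf \<Rightarrow>
     ('x, 'x \<Rightarrow> ('x set \<times> ('x \<Rightarrow> ('x set \<times> 's) set) set) set) presheaf" where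
  "godement_cocycles F = sheafify (opens F) (godement_quot F)"

definition godement_d ::
    "('x, 's) presheaf \<Rightarrow> 'x set \<Rightarrow> ('x \<Rightarrow> ('x set \<times> 's) set) \<Rightarrow>
     ('x \<Rightarrow> ('x set \<times> ('x \<Rightarrow> ('x set \<times> 's) set) set) set)" where
  "godement_d F U s = germs_of (godement_quot F) U
     ((germs_of F U ` carrier (sections F U)) +>\<^bsub>prod_module U (stalk F)\<^esub> s)"

definition H0 :: "('x, 's) presheaf \<Rightarrow> (bit, 's) module" where
  "H0 F = sections F (\<Union>(opens F))"

definition H1 ::
    "('x, 's) presheaf \<Rightarrow>
     (bit, ('x \<Rightarrow> ('x set \<times> ('x \<Rightarrow> ('x set \<times> 's) set) set) set) set) module" where
  "H1 F = (let Y = \<Union>(opens F) in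
     quot_module (sections (godement_cocycles F) Y)
       (godement_d F Y ` carrier (prod_module Y (stalk F))))"


section \<open>One-hot encoding and tensor powers\<close>

text \<open>
  \<open>(F\<^sub>2\<^sup>2)\<^sup>\<otimes>\<^sup>m\<close> is the space of coordinate arrays indexed by words of length \<open>m\<close> over \<open>{0, 1}\<close>
  (extended by zero to other words); the coordinate at a word \<open>[a\<^sub>1, \<dots>, a\<^sub>m]\<close> is that of the
  basis tensor \<open>T a\<^sub>1 \<otimes> \<dots> \<otimes> T a\<^sub>m\<close>. The plane \<open>F\<^sub>2\<^sup>2\<close> is the case \<open>m = 1\<close>, its first and
  second coordinates being those at \<open>[0]\<close> and \<open>[1]\<close>; the case \<open>m = 0\<close> is one-dimensional.
\<close>

type_synonym tensor = "bit list \<Rightarrow> bit"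

definition tens :: "nat \<Rightarrow> (bit, tensor) module" where
  "tens m = mk_module {x. \<forall>w. length w \<noteq> m \<longrightarrow> x w = 0} (\<lambda>w. 0)
     (\<lambda>x y w. x w + y w) (\<lambda>r x w. r * x w)"

abbreviation plane :: "(bit, tensor) module" where
  "plane \<equiv> tens 1"

definition T :: "bit \<Rightarrow> tensor" where
  "T a = (\<lambda>w. if w = [a] then 1 else 0)"

definition pure_tensor :: "tensor list \<Rightarrow> tensor" where
  "pure_tensor xs = (\<lambda>w. if length w = length xs then \<Prod>i<length xs. (xs ! i) [w ! i] else 0)"

text \<open>The linear map on \<open>(F\<^sub>2\<^sup>2)\<^sup>\<otimes>\<^sup>m\<close> sending \<open>T a\<^sub>1 \<otimes> \<dots> \<otimes> T a\<^sub>m\<close> to \<open>T (g [a\<^sub>1, \<dots>, a\<^sub>m])\<close>.\<close>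

definition lin_ext :: "nat \<Rightarrow> (bit list \<Rightarrow> bit) \<Rightarrow> tensor \<Rightarrow> tensor" where
  "lin_ext m g x = (\<lambda>w. \<Sum>u\<in>{u. length u = m}. x u * T (g u) w)"

definition contraction :: "nat \<Rightarrow> nat \<Rightarrow> tensor \<Rightarrow> tensor" where
  "contraction m i = lin_ext m (\<lambda>u. u ! i)"

lemma pure_tensor_T:
  "pure_tensor (map T u) = (\<lambda>w. if w = u then 1 else 0)"
proof
  fix w
  show "pure_tensor (map T u) w = (if w = u then 1 else 0)"
  proof (cases "length w = length u")
    case True
    have "(\<Prod>i<length u. T (u ! i) [w ! i]) = (\<Prod>i<length u. if w ! i = u ! i then 1 else 0)"
      by (intro prod.cong) (auto simp: T_def)
    also have "\<dots> = (if \<forall>i<length u. w ! i = u ! i then 1 else 0)"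
      by (auto intro!: prod.neutral)
    also have "\<dots> = (if w = u then 1 else 0)"
      using True by (auto simp: list_eq_iff_nth_eq)
    finally show ?thesis
      using True by (simp add: pure_tensor_def)
  qed (auto simp: pure_tensor_def)
qed

lemma finite_words: "finite {u :: bit list. length u = m}"
proof -
  have "(UNIV :: bit set) = {0, 1}"
    using bit_not_zero_iff by auto
  then have "finite (UNIV :: bit set)"
    by (metis finite.emptyI finite.insertI)
  then show ?thesis
    using finite_lists_length_eq[of "UNIV :: bit set" m] by simp
qed

lemma lin_ext_pure_tensor:
  assumes "length u = m"
  shows "lin_ext m g (pure_tensor (map T u)) = T (g u)"
proof
  fix w
  have "lin_ext m g (pure_tensor (map T u)) w
      = (\<Sum>u'\<in>{u'. length u' = m}. if u' = u then T (g u) w else 0)"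
    unfolding lin_ext_def pure_tensor_T by (intro sum.cong) auto
  also have "\<dots> = T (g u) w"
    using assms finite_words[of m] by simp
  finally show "lin_ext m g (pure_tensor (map T u)) w = T (g u) w" .
qed


section \<open>Directed graphs with external edges and logic circuits\<close>

text \<open>
  \<open>src\<close> or \<open>tgt\<close> is \<^const>\<open>None\<close> at the open end of an external edge. The lists \<open>ins v\<close> and
  \<open>outs v\<close> are the ordered incoming and outgoing edges of \<open>v\<close>; a self-loop occurs in both.
\<close>

record ('v, 'e) circuit =
  verts :: "'v set"
  edges :: "'e set"
  src :: "'e \<Rightarrow> 'v option"
  tgt :: "'e \<Rightarrow> 'v option"
  ins :: "'v \<Rightarrow> 'e list"
  outs :: "'v \<Rightarrow> 'e list"
  gate :: "'v \<Rightarrow> bit list \<Rightarrow> bit list"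

definition logic_circuit :: "('v, 'e) circuit \<Rightarrow> bool" where
  "logic_circuit G \<longleftrightarrow>
     finite (verts G) \<and> finite (edges G) \<and>
     (\<forall>e\<in>edges G. set_option (src G e) \<subseteq> verts G \<and> set_option (tgt G e) \<subseteq> verts G \<and>
        \<not> (src G e = None \<and> tgt G e = None)) \<and>
     (\<forall>v\<in>verts G.
        distinct (ins G v) \<and> set (ins G v) = {e \<in> edges G. tgt G e = Some v} \<and>
        distinct (outs G v) \<and> set (outs G v) = {e \<in> edges G. src G e = Some v} \<and>
        (\<forall>u. length u = length (ins G v) \<longrightarrow> length (gate G v u) = length (outs G v)))"

definition internal_edge :: "('v, 'e) circuit \<Rightarrow> 'e \<Rightarrow> bool" where
  "internal_edge G e \<longleftrightarrow> e \<in> edges G \<and> src G e \<noteq> None \<and> tgt G e \<noteq> None"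

text \<open>\<open>Edg e t\<close>, for \<open>0 < t < 1\<close>, is an interior point of \<open>e\<close>; \<open>t\<close> grows in the direction of \<open>e\<close>.\<close>

datatype ('v, 'e) point = Vtx 'v | Edg 'e real

definition edge_seg :: "'e \<Rightarrow> real \<Rightarrow> real \<Rightarrow> ('v, 'e) point set" where
  "edge_seg e a b = Edg e ` {a<..<b}"

definition graph_points :: "('v, 'e) circuit \<Rightarrow> ('v, 'e) point set" where
  "graph_points G = Vtx ` verts G \<union> (\<Union>e\<in>edges G. edge_seg e 0 1)"

definition edge_dom :: "('v, 'e) circuit \<Rightarrow> 'e \<Rightarrow> real set" where
  "edge_dom G e = {0<..<1} \<union> (if src G e = None then {} else {0}) \<union>
     (if tgt G e = None then {} else {1})"

definition edge_map :: "('v, 'e) circuit \<Rightarrow> 'e \<Rightarrow> real \<Rightarrow> ('v, 'e) point" where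
  "edge_map G e t = (if t = 0 then Vtx (the (src G e))
     else if t = 1 then Vtx (the (tgt G e)) else Edg e t)"

text \<open>The quotient topology of the vertices together with one interval \<open>edge_dom G e\<close> per edge.\<close>

definition graph_open :: "('v, 'e) circuit \<Rightarrow> ('v, 'e) point set \<Rightarrow> bool" where
  "graph_open G U \<longleftrightarrow> U \<subseteq> graph_points G \<and>
     (\<forall>e\<in>edges G. openin (top_of_set (edge_dom G e)) {t \<in> edge_dom G e. edge_map G e t \<in> U})"

definition graph_top :: "('v, 'e) circuit \<Rightarrow> ('v, 'e) point topology" where
  "graph_top G = topology (graph_open G)"

lemma istopology_graph_open: "istopology (graph_open G)"
  unfolding istopology_def
proof (intro conjI allI impI)
  fix U V assume "graph_open G U" "graph_open G V"
  moreover have "{t \<in> edge_dom G e. edge_map G e t \<in> U \<inter> V} =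
      {t \<in> edge_dom G e. edge_map G e t \<in> U} \<inter> {t \<in> edge_dom G e. edge_map G e t \<in> V}" for e
    by auto
  ultimately show "graph_open G (U \<inter> V)"
    unfolding graph_open_def by (auto intro!: openin_Int)
next
  fix \<U> assume "\<forall>U\<in>\<U>. graph_open G U"
  moreover have "{t \<in> edge_dom G e. edge_map G e t \<in> \<Union>\<U>} =
      (\<Union>U\<in>\<U>. {t \<in> edge_dom G e. edge_map G e t \<in> U})" for e
    by auto
  ultimately show "graph_open G (\<Union>\<U>)"
    unfolding graph_open_def by (auto intro!: openin_Union)
qed

lemma openin_graph_top: "openin (graph_top G) U \<longleftrightarrow> graph_open G U"
  by (simp add: graph_top_def istopology_graph_open topology_inverse')


section \<open>The switching sheaf\<close>

definition star_base :: "('v, 'e) circuit \<Rightarrow> ('v, 'e) point set set" where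
  "star_base G = {U. openin (graph_top G) U \<and> contractible_space (subtopology (graph_top G) U) \<and>
     (\<exists>!v. v \<in> verts G \<and> Vtx v \<in> U)}"

definition edge_base :: "('v, 'e) circuit \<Rightarrow> ('v, 'e) point set set" where
  "edge_base G = {V. openin (graph_top G) V \<and> connectedin (graph_top G) V \<and> V \<noteq> {} \<and>
     (\<exists>e\<in>edges G. V \<subseteq> edge_seg e 0 1)}"

definition star_vertex :: "('v, 'e) circuit \<Rightarrow> ('v, 'e) point set \<Rightarrow> 'v" where
  "star_vertex G U = (THE v. v \<in> verts G \<and> Vtx v \<in> U)"

text \<open>
  The parts of a neighbourhood \<open>U\<close> of \<open>v\<close> lying on an incoming edge \<open>e\<close> of \<open>v\<close>, respectively on
  an outgoing edge: the points joined to \<open>v\<close> within \<open>U\<close> along the target end, respectively along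
  the source end, of \<open>e\<close>. On a self-loop these are the two different components of \<open>U\<close> minus \<open>v\<close>
  on that edge.
\<close>

definition in_part :: "('v, 'e) point set \<Rightarrow> 'e \<Rightarrow> ('v, 'e) point set" where
  "in_part U e = {Edg e t | t. 0 < t \<and> t < 1 \<and> (\<forall>t'. t \<le> t' \<and> t' < 1 \<longrightarrow> Edg e t' \<in> U)}"

definition out_part :: "('v, 'e) point set \<Rightarrow> 'e \<Rightarrow> ('v, 'e) point set" where
  "out_part U e = {Edg e t | t. 0 < t \<and> t < 1 \<and> (\<forall>t'. 0 < t' \<and> t' \<le> t \<longrightarrow> Edg e t' \<in> U)}"

definition gate_map :: "('v, 'e) circuit \<Rightarrow> 'v \<Rightarrow> nat \<Rightarrow> tensor \<Rightarrow> tensor" where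
  "gate_map G v j = lin_ext (length (ins G v)) (\<lambda>u. gate G v u ! j)"

definition switching_restr ::
    "('v, 'e) circuit \<Rightarrow> ('v, 'e) point set \<Rightarrow> ('v, 'e) point set \<Rightarrow> tensor \<Rightarrow> tensor" where
  "switching_restr G U V x =
     (if U \<in> star_base G \<and> V \<in> edge_base G then
        let v = star_vertex G U in
        if \<exists>i<length (ins G v). V \<subseteq> in_part U (ins G v ! i)
        then contraction (length (ins G v))
               (THE i. i < length (ins G v) \<and> V \<subseteq> in_part U (ins G v ! i)) x
        else gate_map G v (THE j. j < length (outs G v) \<and> V \<subseteq> out_part U (outs G v ! j)) x
      else x)"

definition switching_presheaf :: "('v, 'e) circuit \<Rightarrow> (('v, 'e) point, tensor) presheaf" where
  "switching_presheaf G = \<lparr>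
     opens = star_base G \<union> edge_base G,
     sections = (\<lambda>U. if U \<in> star_base G then tens (length (ins G (star_vertex G U))) else plane),
     restr = switching_restr G\<rparr>"

definition switching_sheaf ::
    "('v, 'e) circuit \<Rightarrow>
     (('v, 'e) point, ('v, 'e) point \<Rightarrow> (('v, 'e) point set \<times> tensor) set) presheaf" where
  "switching_sheaf G = sheafify {U. openin (graph_top G) U} (switching_presheaf G)"

text \<open>
  For an open interval \<open>V\<close> in an edge, the canonical map \<open>F\<^sub>2\<^sup>2 = S(V) \<rightarrow> \<S>(V)\<close> into the
  sheafification and its inverse.
\<close>

definition wire_section ::
    "('v, 'e) circuit \<Rightarrow> ('v, 'e) point set \<Rightarrow> tensor \<Rightarrow>
     ('v, 'e) point \<Rightarrow> (('v, 'e) point set \<times> tensor) set" where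
  "wire_section G V = germs_of (switching_presheaf G) V"

definition wire_value ::
    "('v, 'e) circuit \<Rightarrow> ('v, 'e) point set \<Rightarrow>
     (('v, 'e) point \<Rightarrow> (('v, 'e) point set \<times> tensor) set) \<Rightarrow> tensor" where
  "wire_value G V = the_inv_into (carrier plane) (wire_section G V)"

text \<open>
  The difference map \<open>H\<^sup>0(A) \<oplus> H\<^sup>0(W) \<rightarrow> H\<^sup>0(A \<inter> W)\<close>, \<open>(s, w) \<mapsto> s|(A \<inter> W) - w|(A \<inter> W)\<close>, with
  \<open>H\<^sup>0(W)\<close> identified with \<open>F\<^sub>2\<^sup>2\<close> and \<open>H\<^sup>0(A \<inter> W)\<close> with \<open>F\<^sub>2\<^sup>2 \<oplus> F\<^sub>2\<^sup>2\<close> through the two components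
  \<open>I\<close> and \<open>J\<close> of \<open>A \<inter> W\<close>.
\<close>

definition mv_difference ::
    "('v, 'e) circuit \<Rightarrow> ('v, 'e) point set \<Rightarrow> ('v, 'e) point set \<Rightarrow>
     ('v, 'e) point set \<Rightarrow> ('v, 'e) point set \<Rightarrow>
     (('v, 'e) point \<Rightarrow> (('v, 'e) point set \<times> tensor) set) \<times> tensor \<Rightarrow> tensor \<times> tensor" where
  "mv_difference G A W I J = (\<lambda>(s, c).
     let S = switching_sheaf G;
         \<delta> = restr S A (A \<inter> W) s \<ominus>\<^bsub>sections S (A \<inter> W)\<^esub> restr S W (A \<inter> W) (wire_section G W c)
     in (wire_value G I (restr S (A \<inter> W) I \<delta>), wire_value G J (restr S (A \<inter> W) J \<delta>)))"

end

theory Submission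
  imports Defs "HOL-Complex_Analysis.Winding_Numbers"
begin

text \<open>
  Over the field with two elements a finite space has \<open>2\<close> to the power of its dimension elements,
  so every dimension formula is a count of elements, and exactness reduces to
  \<open>card domain = card image * card kernel\<close>.

  Let \<open>Y\<close> be \<open>X\<close> or \<open>A\<close>. It is the union of small open stars \<open>B\<close> around the vertices and of a
  disjoint union \<open>C\<close> of open intervals inside edges, and \<open>B \<inter> C\<close> consists of the legs of the
  stars. Every Godement cocycle becomes a coboundary on \<open>B\<close> and on \<open>C\<close>, because the sheaf is
  constant on intervals; hence \<open>H\<^sup>1(Y)\<close> is the cokernel of \<open>\<S>(B) \<oplus> \<S>(C) \<rightarrow> \<S>(B \<inter> C)\<close>, whose kernel
  is \<open>\<S>(Y)\<close>. So \<open>dim H\<^sup>0(Y) - dim H\<^sup>1(Y) = dim \<S>(B) + dim \<S>(C) - dim \<S>(B \<inter> C)\<close>. The stars and their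
  legs are the same for \<open>X\<close> and \<open>A\<close>, while \<open>A\<close> has one interval more, so this number is larger
  by \<open>2\<close> for \<open>A\<close>. As \<open>\<S>(X)\<close> is the kernel of \<open>\<Delta>\<close>, also
  \<open>dim H\<^sup>0(X) = dim H\<^sup>0(A) + 2 - rank \<Delta>\<close>, and both formulas follow.
\<close>

section \<open>Finite vector spaces over the field with two elements\<close>

text \<open>The cover X = A \<union> W itself is not acyclic, since H^1(A) may be nonzero; it serves
  only to identify the kernel of \<Delta>, and the comparison of two Euler characteristics replaces
  the rest of its Mayer-Vietoris sequence. The size of the sections over the stars is never
  computed: it is the same finite factor for X and for A and cancels. Two obstacles shape the rest.
  First, a cocycle has primitives only on stars whose radius depends on the cocycle, while B is
  fixed in advance; the primitives are enlarged along the legs, where sections are constant and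
  therefore extend. Second, the base contains all contractible one-vertex open sets, not only round
  stars, and the restriction to an edge set is selected by the end along which it is joined to the
  vertex. On a self-loop both ends would qualify if the set contained the whole loop.
  Contractibility excludes this by a winding number, and that is what makes the restrictions
  functorial.\<close>

lemma UNIV_bit: "(UNIV :: bit set) = {0, 1}"
  using bit_not_zero_iff by auto

lemma finite_bit [simp]: "finite (A :: bit set)"
proof (rule finite_subset)
  show "A \<subseteq> {0, 1}"
    by (metis UNIV_bit subset_UNIV)
qed simp

lemma card_bit: "card (UNIV :: bit set) = 2"
  by (simp add: UNIV_bit)

text \<open>The two scalar laws fix the whole action of F_2, so a vector space is an abelian group
  of exponent 2.\<close>

locale bit_space = abelian_group M for M :: "(bit, 'b) module" (structure) +
  assumes add_self: "x \<in> carrier M \<Longrightarrow> x \<oplus> x = \<zero>"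
    and smult_one: "x \<in> carrier M \<Longrightarrow> 1 \<odot> x = x"
    and smult_zero: "x \<in> carrier M \<Longrightarrow> 0 \<odot> x = \<zero>"

lemma bit_spaceI:
  fixes M :: "(bit, 'b) module" (structure)
  assumes "\<And>x y. \<lbrakk>x \<in> carrier M; y \<in> carrier M\<rbrakk> \<Longrightarrow> x \<oplus> y \<in> carrier M"
    and "\<zero> \<in> carrier M"
    and "\<And>x y z. \<lbrakk>x \<in> carrier M; y \<in> carrier M; z \<in> carrier M\<rbrakk> \<Longrightarrow> (x \<oplus> y) \<oplus> z = x \<oplus> (y \<oplus> z)"
    and "\<And>x y. \<lbrakk>x \<in> carrier M; y \<in> carrier M\<rbrakk> \<Longrightarrow> x \<oplus> y = y \<oplus> x"
    and "\<And>x. x \<in> carrier M \<Longrightarrow> \<zero> \<oplus> x = x"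
    and "\<And>x. x \<in> carrier M \<Longrightarrow> x \<oplus> x = \<zero>"
    and "\<And>x. x \<in> carrier M \<Longrightarrow> 1 \<odot> x = x"
    and "\<And>x. x \<in> carrier M \<Longrightarrow> 0 \<odot> x = \<zero>"
  shows "bit_space M"
proof (intro bit_space.intro abelian_groupI bit_space_axioms.intro)
  show "\<exists>y\<in>carrier M. y \<oplus> x = \<zero>" if "x \<in> carrier M" for x
    using that assms(6) by blast
qed (rule assms; assumption)+

context bit_space
begin

lemma smult_closed: "x \<in> carrier M \<Longrightarrow> r \<odot> x \<in> carrier M"
  by (cases r rule: bit.exhaust) (auto simp: smult_one smult_zero)

lemma smult_add: "x \<in> carrier M \<Longrightarrow> (r + s) \<odot> x = r \<odot> x \<oplus> s \<odot> x"
  by (cases r rule: bit.exhaust; cases s rule: bit.exhaust)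
     (auto simp: smult_one smult_zero add_self)

lemma add_add_self: "x \<in> carrier M \<Longrightarrow> y \<in> carrier M \<Longrightarrow> x \<oplus> (x \<oplus> y) = y"
  by (metis a_assoc add_self l_zero)

lemma add_eq_zero: "x \<in> carrier M \<Longrightarrow> y \<in> carrier M \<Longrightarrow> x \<oplus> y = \<zero> \<longleftrightarrow> x = y"
  by (metis add_add_self add_self r_zero)

lemma minus_eq_add: "x \<in> carrier M \<Longrightarrow> y \<in> carrier M \<Longrightarrow> x \<ominus> y = x \<oplus> y"
  by (metis a_minus_def add_self minus_equality)

lemma bit_space_sub:
  assumes "H \<subseteq> carrier M" "\<zero> \<in> H" "\<And>x y. x \<in> H \<Longrightarrow> y \<in> H \<Longrightarrow> x \<oplus> y \<in> H"
  shows "bit_space (M\<lparr>carrier := H\<rparr>)"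
  using assms by (intro bit_spaceI) (auto simp: a_assoc add_self smult_one smult_zero subset_iff intro: a_comm)

end

text \<open>Linear maps: over F_2 compatibility with scalars follows from additivity, see
  \<open>additive_smult\<close>.\<close>

definition additive_map :: "(bit, 'b) module \<Rightarrow> (bit, 'c) module \<Rightarrow> ('b \<Rightarrow> 'c) \<Rightarrow> bool" where
  "additive_map M N f \<longleftrightarrow> f \<in> carrier M \<rightarrow> carrier N \<and>
     (\<forall>x\<in>carrier M. \<forall>y\<in>carrier M. f (x \<oplus>\<^bsub>M\<^esub> y) = f x \<oplus>\<^bsub>N\<^esub> f y)"

lemma additive_closed: "additive_map M N f \<Longrightarrow> x \<in> carrier M \<Longrightarrow> f x \<in> carrier N"
  by (auto simp: additive_map_def)

lemma additive_add:
  "additive_map M N f \<Longrightarrow> x \<in> carrier M \<Longrightarrow> y \<in> carrier M \<Longrightarrow> f (x \<oplus>\<^bsub>M\<^esub> y) = f x \<oplus>\<^bsub>N\<^esub> f y"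
  by (auto simp: additive_map_def)

lemma additive_zero:
  assumes "bit_space M" "bit_space N" "additive_map M N f"
  shows "f \<zero>\<^bsub>M\<^esub> = \<zero>\<^bsub>N\<^esub>"
proof -
  interpret M: bit_space M by fact
  interpret N: bit_space N by fact
  have "f (\<zero>\<^bsub>M\<^esub> \<oplus>\<^bsub>M\<^esub> \<zero>\<^bsub>M\<^esub>) = f \<zero>\<^bsub>M\<^esub> \<oplus>\<^bsub>N\<^esub> f \<zero>\<^bsub>M\<^esub>"
    by (rule additive_add[OF assms(3)]) auto
  then show ?thesis
    using additive_closed[OF assms(3), of "\<zero>\<^bsub>M\<^esub>"] by (simp add: N.add_self)
qed

lemma additive_smult:
  assumes "bit_space M" "bit_space N" "additive_map M N f" "x \<in> carrier M"
  shows "f (r \<odot>\<^bsub>M\<^esub> x) = r \<odot>\<^bsub>N\<^esub> f x"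
  using assms additive_zero[OF assms(1-3)] additive_closed[OF assms(3,4)]
  by (cases r rule: bit.exhaust) (auto simp: bit_space.smult_one bit_space.smult_zero)

text \<open>Rank-nullity as a count: every fibre over the image is a translate of the
  kernel.\<close>

lemma card_image_kernel:
  assumes "bit_space M" "bit_space N" "additive_map M N f" "finite (carrier M)"
  shows "card (carrier M) = card (f ` carrier M) * card {x \<in> carrier M. f x = \<zero>\<^bsub>N\<^esub>}"
proof -
  interpret M: bit_space M by fact
  interpret N: bit_space N by fact
  note add = additive_add[OF assms(3)] and clo = additive_closed[OF assms(3)]
  let ?K = "{x \<in> carrier M. f x = \<zero>\<^bsub>N\<^esub>}"
  have fibre: "card {x \<in> carrier M. f x = y} = card ?K" if y: "y \<in> f ` carrier M" for y
  proof -
    obtain x0 where x0: "x0 \<in> carrier M" "y = f x0"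
      using y by auto
    \<comment> \<open>Translation by x0 is its own inverse in characteristic 2.\<close>
    have "bij_betw (\<lambda>x. x0 \<oplus>\<^bsub>M\<^esub> x) {x \<in> carrier M. f x = y} ?K"
      by (rule bij_betwI[where g = "\<lambda>x. x0 \<oplus>\<^bsub>M\<^esub> x"])
        (use x0 in \<open>auto simp: add clo M.add_add_self N.add_self\<close>)
    then show ?thesis
      by (rule bij_betw_same_card)
  qed
  have "carrier M = (\<Union>y\<in>f ` carrier M. {x \<in> carrier M. f x = y})"
    by auto
  then have "card (carrier M) = card (\<Union>y\<in>f ` carrier M. {x \<in> carrier M. f x = y})"
    by simp
  also have "\<dots> = (\<Sum>y\<in>f ` carrier M. card {x \<in> carrier M. f x = y})"
    by (rule card_UN_disjoint) (use assms(4) in auto)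
  also have "\<dots> = card (f ` carrier M) * card ?K"
    by (simp add: fibre)
  finally show ?thesis .
qed

section \<open>Bases and dimension of a finite space\<close>

lemma card_bit_funs: "finite B \<Longrightarrow> card (B \<rightarrow>\<^sub>E (UNIV :: bit set)) = 2 ^ card B"
  by (simp add: card_PiE card_bit)

context bit_space
begin

definition comb :: "'b set \<Rightarrow> ('b \<Rightarrow> bit) \<Rightarrow> 'b" where
  "comb B c = finsum M (\<lambda>b. c b \<odot> b) B"

lemma comb_closed: "B \<subseteq> carrier M \<Longrightarrow> comb B c \<in> carrier M"
  unfolding comb_def by (rule finsum_closed) (auto intro: smult_closed)

lemma comb_cong: "B \<subseteq> carrier M \<Longrightarrow> (\<And>b. b \<in> B \<Longrightarrow> c b = c' b) \<Longrightarrow> comb B c = comb B c'"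
  unfolding comb_def by (rule finsum_cong') (auto intro!: smult_closed)

lemma comb_insert:
  assumes "finite B" "B \<subseteq> carrier M" "x \<in> carrier M" "x \<notin> B"
  shows "comb (insert x B) c = c x \<odot> x \<oplus> comb B c"
  unfolding comb_def by (rule finsum_insert) (use assms in \<open>auto intro: smult_closed\<close>)

lemma comb_add:
  assumes "B \<subseteq> carrier M"
  shows "comb B (\<lambda>b. c b + c' b) = comb B c \<oplus> comb B c'"
proof -
  have "comb B (\<lambda>b. c b + c' b) = finsum M (\<lambda>b. c b \<odot> b \<oplus> c' b \<odot> b) B"
    unfolding comb_def
  proof (rule finsum_cong')
    show "(\<lambda>b. c b \<odot> b \<oplus> c' b \<odot> b) \<in> B \<rightarrow> carrier M"
      using assms by (auto intro: smult_closed)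
    show "(c b + c' b) \<odot> b = c b \<odot> b \<oplus> c' b \<odot> b" if "b \<in> B" for b
      using assms that by (intro smult_add) auto
  qed simp
  also have "\<dots> = comb B c \<oplus> comb B c'"
    unfolding comb_def by (rule finsum_addf) (use assms in \<open>auto intro: smult_closed\<close>)
  finally show ?thesis .
qed

text \<open>Unique representation is a bijection with the coefficient functions, which turns a basis
  into a count of elements.\<close>

lemma vbasis_iff:
  "vbasis M B \<longleftrightarrow> finite B \<and> B \<subseteq> carrier M \<and> bij_betw (comb B) (B \<rightarrow>\<^sub>E UNIV) (carrier M)"
proof -
  have "bij_betw (comb B) (B \<rightarrow>\<^sub>E UNIV) (carrier M) \<longleftrightarrow>
      (\<forall>x\<in>carrier M. \<exists>!c. c \<in> B \<rightarrow>\<^sub>E (UNIV :: bit set) \<and> x = comb B c)" (is "?L \<longleftrightarrow> ?R")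
    if B: "B \<subseteq> carrier M"
  proof
    assume ?L
    then show ?R
      unfolding bij_betw_def inj_on_def by blast
  next
    assume R: ?R
    then have "inj_on (comb B) (B \<rightarrow>\<^sub>E UNIV)"
      using comb_closed[OF B] by (intro inj_onI) metis
    moreover have "comb B ` (B \<rightarrow>\<^sub>E UNIV) = carrier M"
      using R comb_closed[OF B] by blast
    ultimately show ?L
      unfolding bij_betw_def by blast
  qed
  then show ?thesis
    unfolding vbasis_def comb_def[symmetric] by blast
qed

lemma card_vbasis: "vbasis M B \<Longrightarrow> card (carrier M) = 2 ^ card B"
  using bij_betw_same_card card_bit_funs unfolding vbasis_iff by metis

text \<open>If two equal combinations had different coefficients at x, one of them 1 and the other
  0, then x would be the sum of the two remaining parts and hence in the span of B.\<close>

lemma inj_comb_insert: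
  assumes "finite B" "B \<subseteq> carrier M" "inj_on (comb B) (B \<rightarrow>\<^sub>E UNIV)"
    and x: "x \<in> carrier M" "x \<notin> comb B ` (B \<rightarrow>\<^sub>E UNIV)" "x \<notin> B"
  shows "inj_on (comb (insert x B)) (insert x B \<rightarrow>\<^sub>E UNIV)"
proof (rule inj_onI)
  fix c c' assume c: "c \<in> insert x B \<rightarrow>\<^sub>E (UNIV :: bit set)" "c' \<in> insert x B \<rightarrow>\<^sub>E (UNIV :: bit set)"
    and eq: "comb (insert x B) c = comb (insert x B) c'"
  have res: "comb B d = comb B (restrict d B)" for d
    by (rule comb_cong) (use assms in auto)
  have eq': "c x \<odot> x \<oplus> comb B c = c' x \<odot> x \<oplus> comb B c'"
    using eq assms by (simp add: comb_insert)
  have "c x = c' x"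
  proof (rule ccontr)
    assume "c x \<noteq> c' x"
    then have "x \<oplus> comb B c = comb B c' \<or> x \<oplus> comb B c' = comb B c"
      using eq' x comb_closed[OF assms(2)]
      by (cases "c x" rule: bit.exhaust; cases "c' x" rule: bit.exhaust) (auto simp: smult_one smult_zero)
    then have "x = comb B c \<oplus> comb B c'"
      using x(1) comb_closed[OF assms(2)] by (metis add_add_self a_comm)
    then have "x = comb B (restrict (\<lambda>b. c b + c' b) B)"
      using comb_add[OF assms(2)] res by metis
    then show False
      using x(2) by auto
  qed
  then have "comb B c = comb B c'"
    using eq' x(1) comb_closed[OF assms(2)] smult_closed by (metis add_add_self)
  then have "restrict c B = restrict c' B"
    using res[of c] res[of c'] by (intro inj_onD[OF assms(3)]) auto
  then show "c = c'"
    using \<open>c x = c' x\<close> c by (intro PiE_ext[OF c]) (metis insertE restrict_apply')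
qed

text \<open>An independent set of greatest size spans: a vector outside its span could be adjoined
  by \<open>inj_comb_insert\<close>.\<close>

lemma ex_vbasis:
  assumes fin: "finite (carrier M)"
  shows "\<exists>B. vbasis M B"
proof -
  let ?P = "\<lambda>B. B \<subseteq> carrier M \<and> inj_on (comb B) (B \<rightarrow>\<^sub>E UNIV)"
  have "?P {}" by simp
  moreover have "\<forall>B. ?P B \<longrightarrow> card B < Suc (card (carrier M))"
    using card_mono[OF fin] by (auto simp: less_Suc_eq_le)
  ultimately obtain B where B: "?P B" and max: "\<forall>B'. ?P B' \<longrightarrow> card B' \<le> card B"
    using ex_has_greatest_nat[of ?P "{}" card "Suc (card (carrier M))"] by auto
  have finB: "finite B"
    using B fin finite_subset by blast
  have "carrier M \<subseteq> comb B ` (B \<rightarrow>\<^sub>E UNIV)"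
  proof (rule ccontr)
    assume "\<not> ?thesis"
    then obtain x where x: "x \<in> carrier M" "x \<notin> comb B ` (B \<rightarrow>\<^sub>E UNIV)" by auto
    \<comment> \<open>An element x of B is in the span: take the indicator of x as
      coefficients.\<close>
    have "x \<notin> B"
    proof
      assume "x \<in> B"
      then have ins: "insert x (B - {x}) = B" by auto
      have "comb B (\<lambda>b\<in>B. if b = x then 1 else 0) = comb (insert x (B - {x})) (\<lambda>b\<in>B. if b = x then 1 else 0)"
        using ins by simp
      also have "\<dots> = x \<oplus> comb (B - {x}) (\<lambda>b\<in>B. if b = x then 1 else 0)"
        using B finB x \<open>x \<in> B\<close> by (subst comb_insert) (auto simp: smult_one)
      also have "comb (B - {x}) (\<lambda>b\<in>B. if b = x then 1 else 0) = \<zero>"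
        unfolding comb_def using B by (intro add.finprod_one_eqI) (auto simp: smult_zero subset_iff)
      finally have "comb B (\<lambda>b\<in>B. if b = x then 1 else 0) = x"
        unfolding r_zero[OF x(1)] .
      moreover have "(\<lambda>b\<in>B. if b = x then 1 else 0) \<in> B \<rightarrow>\<^sub>E (UNIV :: bit set)"
        by auto
      ultimately show False
        using x(2) by (metis image_eqI)
    qed
    then have "?P (insert x B)"
      using inj_comb_insert[OF finB _ _ x] B x by auto
    then have "card (insert x B) \<le> card B"
      using max by blast
    then show False
      using finB \<open>x \<notin> B\<close> by simp
  qed
  then have "vbasis M B"
    unfolding vbasis_iff bij_betw_def using B finB comb_closed[of B] by auto
  then show ?thesis ..
qed

lemma fin_dimI: "finite (carrier M) \<Longrightarrow> fin_dim M"
  using ex_vbasis unfolding fin_dim_def .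

text \<open>The description in \<open>vdim\<close> is unique because 2 ^ n determines n, so any two
  bases have the same size.\<close>

lemma card_eq_vdim:
  assumes "finite (carrier M)"
  shows "card (carrier M) = 2 ^ vdim M"
proof -
  obtain B where B: "vbasis M B"
    using ex_vbasis[OF assms] by blast
  have "vdim M = card B"
    unfolding vdim_def
  proof (rule the_equality)
    show "\<exists>B'. vbasis M B' \<and> card B' = card B" using B by blast
    fix n assume "\<exists>B'. vbasis M B' \<and> card B' = n"
    then obtain B' where "vbasis M B'" "card B' = n" by blast
    then have "(2::nat) ^ n = 2 ^ card B"
      using card_vbasis B by metis
    then show "n = card B" by simp
  qed
  then show ?thesis
    using card_vbasis[OF B] by simp
qed

end

section \<open>Tensor powers, direct sums, products and quotients\<close>

lemma bit_space_tens: "bit_space (tens m)"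
  by (rule bit_spaceI) (auto simp: tens_def mk_module_def fun_eq_iff add.assoc add.commute)

lemma bit_space_dir_sum:
  assumes "bit_space M" "bit_space N"
  shows "bit_space (dir_sum M N)"
proof -
  interpret M: bit_space M by fact
  interpret N: bit_space N by fact
  show ?thesis
    by (rule bit_spaceI)
      (auto simp: dir_sum_def mk_module_def M.a_assoc N.a_assoc M.add_self N.add_self
        M.smult_one N.smult_one M.smult_zero N.smult_zero intro: M.a_comm N.a_comm)
qed

lemma prod_module_simps:
  "carrier (prod_module I M) = (\<Pi>\<^sub>E i\<in>I. carrier (M i))"
  "\<zero>\<^bsub>prod_module I M\<^esub> = (\<lambda>i\<in>I. \<zero>\<^bsub>M i\<^esub>)"
  "s \<oplus>\<^bsub>prod_module I M\<^esub> t = (\<lambda>i\<in>I. s i \<oplus>\<^bsub>M i\<^esub> t i)"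
  "r \<odot>\<^bsub>prod_module I M\<^esub> s = (\<lambda>i\<in>I. r \<odot>\<^bsub>M i\<^esub> s i)"
  by (auto simp: prod_module_def mk_module_def)

lemma bit_space_prod_module:
  assumes "\<And>i. i \<in> I \<Longrightarrow> bit_space (M i)"
  shows "bit_space (prod_module I M)"
proof -
  have closed: "x \<in> carrier (M i) \<Longrightarrow> y \<in> carrier (M i) \<Longrightarrow> x \<oplus>\<^bsub>M i\<^esub> y \<in> carrier (M i)"
    and zero: "\<zero>\<^bsub>M i\<^esub> \<in> carrier (M i)"
    and assoc: "x \<in> carrier (M i) \<Longrightarrow> y \<in> carrier (M i) \<Longrightarrow> z \<in> carrier (M i) \<Longrightarrow>
      (x \<oplus>\<^bsub>M i\<^esub> y) \<oplus>\<^bsub>M i\<^esub> z = x \<oplus>\<^bsub>M i\<^esub> (y \<oplus>\<^bsub>M i\<^esub> z)"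
    and comm: "x \<in> carrier (M i) \<Longrightarrow> y \<in> carrier (M i) \<Longrightarrow> x \<oplus>\<^bsub>M i\<^esub> y = y \<oplus>\<^bsub>M i\<^esub> x"
    and l_zero: "x \<in> carrier (M i) \<Longrightarrow> \<zero>\<^bsub>M i\<^esub> \<oplus>\<^bsub>M i\<^esub> x = x"
    and self: "x \<in> carrier (M i) \<Longrightarrow> x \<oplus>\<^bsub>M i\<^esub> x = \<zero>\<^bsub>M i\<^esub>"
    and one: "x \<in> carrier (M i) \<Longrightarrow> 1 \<odot>\<^bsub>M i\<^esub> x = x"
    and null: "x \<in> carrier (M i) \<Longrightarrow> 0 \<odot>\<^bsub>M i\<^esub> x = \<zero>\<^bsub>M i\<^esub>" if "i \<in> I" for i x y z
  proof -
    interpret bit_space "M i" by (rule assms) fact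
    show "x \<in> carrier (M i) \<Longrightarrow> y \<in> carrier (M i) \<Longrightarrow> x \<oplus>\<^bsub>M i\<^esub> y \<in> carrier (M i)"
      "\<zero>\<^bsub>M i\<^esub> \<in> carrier (M i)"
      "x \<in> carrier (M i) \<Longrightarrow> y \<in> carrier (M i) \<Longrightarrow> z \<in> carrier (M i) \<Longrightarrow>
        (x \<oplus>\<^bsub>M i\<^esub> y) \<oplus>\<^bsub>M i\<^esub> z = x \<oplus>\<^bsub>M i\<^esub> (y \<oplus>\<^bsub>M i\<^esub> z)"
      "x \<in> carrier (M i) \<Longrightarrow> y \<in> carrier (M i) \<Longrightarrow> x \<oplus>\<^bsub>M i\<^esub> y = y \<oplus>\<^bsub>M i\<^esub> x"
      "x \<in> carrier (M i) \<Longrightarrow> \<zero>\<^bsub>M i\<^esub> \<oplus>\<^bsub>M i\<^esub> x = x"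
      "x \<in> carrier (M i) \<Longrightarrow> x \<oplus>\<^bsub>M i\<^esub> x = \<zero>\<^bsub>M i\<^esub>"
      "x \<in> carrier (M i) \<Longrightarrow> 1 \<odot>\<^bsub>M i\<^esub> x = x"
      "x \<in> carrier (M i) \<Longrightarrow> 0 \<odot>\<^bsub>M i\<^esub> x = \<zero>\<^bsub>M i\<^esub>"
      by (auto simp: a_assoc add_self smult_one smult_zero intro: a_comm)
  qed
  note mem = PiE_mem[where T = "\<lambda>i. carrier (M i)"]
  show ?thesis
  proof (rule bit_spaceI, unfold prod_module_simps)
    fix x y z assume x: "x \<in> (\<Pi>\<^sub>E i\<in>I. carrier (M i))" and y: "y \<in> (\<Pi>\<^sub>E i\<in>I. carrier (M i))"
      and z: "z \<in> (\<Pi>\<^sub>E i\<in>I. carrier (M i))"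
    show "(\<lambda>i\<in>I. (\<lambda>i\<in>I. x i \<oplus>\<^bsub>M i\<^esub> y i) i \<oplus>\<^bsub>M i\<^esub> z i) = (\<lambda>i\<in>I. x i \<oplus>\<^bsub>M i\<^esub> (\<lambda>i\<in>I. y i \<oplus>\<^bsub>M i\<^esub> z i) i)"
      using mem[OF x] mem[OF y] mem[OF z] by (intro restrict_ext) (simp add: assoc)
  next
    fix x y assume x: "x \<in> (\<Pi>\<^sub>E i\<in>I. carrier (M i))" and y: "y \<in> (\<Pi>\<^sub>E i\<in>I. carrier (M i))"
    show "(\<lambda>i\<in>I. x i \<oplus>\<^bsub>M i\<^esub> y i) \<in> (\<Pi>\<^sub>E i\<in>I. carrier (M i))"
      using mem[OF x] mem[OF y] by (auto intro: closed)
    show "(\<lambda>i\<in>I. x i \<oplus>\<^bsub>M i\<^esub> y i) = (\<lambda>i\<in>I. y i \<oplus>\<^bsub>M i\<^esub> x i)"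
      using mem[OF x] mem[OF y] by (intro restrict_ext) (simp add: comm)
  next
    fix x assume x: "x \<in> (\<Pi>\<^sub>E i\<in>I. carrier (M i))"
    show "(\<lambda>i\<in>I. (\<lambda>i\<in>I. \<zero>\<^bsub>M i\<^esub>) i \<oplus>\<^bsub>M i\<^esub> x i) = x" "(\<lambda>i\<in>I. 1 \<odot>\<^bsub>M i\<^esub> x i) = x"
      using mem[OF x] PiE_arb[OF x] by (auto simp: l_zero one fun_eq_iff restrict_def)
    show "(\<lambda>i\<in>I. x i \<oplus>\<^bsub>M i\<^esub> x i) = (\<lambda>i\<in>I. \<zero>\<^bsub>M i\<^esub>)" "(\<lambda>i\<in>I. 0 \<odot>\<^bsub>M i\<^esub> x i) = (\<lambda>i\<in>I. \<zero>\<^bsub>M i\<^esub>)"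
      using mem[OF x] by (auto simp: self null fun_eq_iff restrict_def)
  qed (auto intro: zero)
qed

locale bit_subspace = bit_space M for M :: "(bit, 'b) module" (structure) + fixes N
  assumes sub: "N \<subseteq> carrier M" and zero_mem: "\<zero> \<in> N"
    and add_mem: "x \<in> N \<Longrightarrow> y \<in> N \<Longrightarrow> x \<oplus> y \<in> N"
begin

lemma mem_coset: "u \<in> N +> s \<longleftrightarrow> (\<exists>n\<in>N. u = n \<oplus> s)"
  by (simp add: a_r_coset_def')

lemma coset_eq_iff:
  assumes "s \<in> carrier M" "t \<in> carrier M"
  shows "N +> s = N +> t \<longleftrightarrow> s \<oplus> t \<in> N"
proof
  assume "N +> s = N +> t"
  then have "s \<in> N +> t"
    using mem_coset[of s s] zero_mem assms by (metis l_zero)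
  then obtain n where "n \<in> N" "s = n \<oplus> t"
    using mem_coset by blast
  then show "s \<oplus> t \<in> N"
    using assms sub a_assoc[of n t t] add_self[of t] by auto
next
  assume st: "s \<oplus> t \<in> N"
  have eq: "s = (s \<oplus> t) \<oplus> t" "t = (s \<oplus> t) \<oplus> s"
    using assms by (metis a_assoc add_self r_zero a_comm)+
  have nc: "n \<in> N \<Longrightarrow> n \<in> carrier M" for n using sub by auto
  show "N +> s = N +> t"
  proof (intro Set.set_eqI)
    fix u
    have "\<exists>m\<in>N. n \<oplus> s = m \<oplus> t" "\<exists>m\<in>N. n \<oplus> t = m \<oplus> s" if "n \<in> N" for n
    proof -
      have "n \<oplus> s = (n \<oplus> (s \<oplus> t)) \<oplus> t" "n \<oplus> t = (n \<oplus> (s \<oplus> t)) \<oplus> s"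
        using eq nc[OF that] nc[OF st] assms by (metis a_assoc)+
      then show "\<exists>m\<in>N. n \<oplus> s = m \<oplus> t" "\<exists>m\<in>N. n \<oplus> t = m \<oplus> s"
        using add_mem[OF that st] by auto
    qed
    then show "u \<in> N +> s \<longleftrightarrow> u \<in> N +> t"
      unfolding mem_coset by metis
  qed
qed

lemma coset_zero: "N +> \<zero> = N"
proof (intro Set.set_eqI)
  show "u \<in> N +> \<zero> \<longleftrightarrow> u \<in> N" for u
    unfolding mem_coset using sub by (metis r_zero subsetD)
qed

lemma coset_mem: "s \<in> N \<Longrightarrow> N +> s = N"
  using coset_eq_iff[of s \<zero>] coset_zero sub by (metis r_zero subsetD zero_closed)

lemma quot_module_simps:
  "carrier (quot_module M N) = {N +> s | s. s \<in> carrier M}"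
  "\<zero>\<^bsub>quot_module M N\<^esub> = N"
  by (auto simp: quot_module_def mk_module_def A_RCOSETS_def')

lemma quot_add:
  assumes s: "s \<in> carrier M" and t: "t \<in> carrier M"
  shows "(N +> s) \<oplus>\<^bsub>quot_module M N\<^esub> (N +> t) = N +> (s \<oplus> t)"
proof -
  have nc: "n \<in> N \<Longrightarrow> n \<in> carrier M" for n using sub by auto
  have "u \<in> set_add M (N +> s) (N +> t) \<longleftrightarrow> u \<in> N +> (s \<oplus> t)" for u
  proof
    assume "u \<in> set_add M (N +> s) (N +> t)"
    then obtain n m where nm: "n \<in> N" "m \<in> N" "u = (n \<oplus> s) \<oplus> (m \<oplus> t)"
      unfolding set_add_def' by (auto simp: mem_coset)
    then have "u = (n \<oplus> m) \<oplus> (s \<oplus> t)"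
      using s t nc by (simp add: a_ac)
    then show "u \<in> N +> (s \<oplus> t)"
      unfolding mem_coset using add_mem nm by blast
  next
    assume "u \<in> N +> (s \<oplus> t)"
    then obtain n where n: "n \<in> N" "u = n \<oplus> (s \<oplus> t)"
      using mem_coset by auto
    then have "u = (n \<oplus> s) \<oplus> (\<zero> \<oplus> t)"
      using s t nc by (simp add: a_assoc)
    moreover have "n \<oplus> s \<in> N +> s" "\<zero> \<oplus> t \<in> N +> t"
      unfolding mem_coset using n zero_mem by blast+
    ultimately show "u \<in> set_add M (N +> s) (N +> t)"
      unfolding set_add_def' by blast
  qed
  then show ?thesis
    by (auto simp: quot_module_def mk_module_def)
qed

text \<open>The union in \<open>quot_module\<close> runs over all representatives, which all give
  the same coset.\<close>

lemma quot_smult: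
  assumes s: "s \<in> carrier M"
  shows "r \<odot>\<^bsub>quot_module M N\<^esub> (N +> s) = N +> (r \<odot> s)"
proof -
  have "N +> (r \<odot> u) = N +> (r \<odot> s)" if us: "u \<in> N +> s" for u
  proof -
    obtain n where n: "n \<in> N" "u = n \<oplus> s"
      using us mem_coset by auto
    have u: "u \<in> carrier M"
      using n s sub by auto
    have "u \<oplus> s = n"
      using n s sub a_assoc[of n s s] by (auto simp: add_self)
    then have "N +> u = N +> s"
      using coset_eq_iff u s n by simp
    then show ?thesis
      using u s by (cases r rule: bit.exhaust) (auto simp: smult_one smult_zero)
  qed
  moreover have "s \<in> N +> s"
    unfolding mem_coset using zero_mem s by force
  ultimately have "(\<Union>x\<in>N +> s. N +> r \<odot> x) = N +> (r \<odot> s)"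
    by blast
  then show ?thesis
    by (simp add: quot_module_def mk_module_def)
qed

lemma bit_space_quot: "bit_space (quot_module M N)"
proof -
  have z: "\<zero>\<^bsub>quot_module M N\<^esub> = N +> \<zero>"
    by (simp add: quot_module_simps coset_zero)
  show ?thesis
  proof (rule bit_spaceI)
    fix x y z assume "x \<in> carrier (quot_module M N)" "y \<in> carrier (quot_module M N)" "z \<in> carrier (quot_module M N)"
    then show "x \<oplus>\<^bsub>quot_module M N\<^esub> y \<oplus>\<^bsub>quot_module M N\<^esub> z = x \<oplus>\<^bsub>quot_module M N\<^esub> (y \<oplus>\<^bsub>quot_module M N\<^esub> z)"
      unfolding quot_module_simps by (auto simp: quot_add a_assoc)
  next
    fix x y assume "x \<in> carrier (quot_module M N)" "y \<in> carrier (quot_module M N)"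
    then obtain s t where st: "x = N +> s" "s \<in> carrier M" "y = N +> t" "t \<in> carrier M"
      unfolding quot_module_simps by blast
    show "x \<oplus>\<^bsub>quot_module M N\<^esub> y \<in> carrier (quot_module M N)"
      unfolding st quot_add[OF st(2,4)] unfolding quot_module_simps using st by blast
    show "x \<oplus>\<^bsub>quot_module M N\<^esub> y = y \<oplus>\<^bsub>quot_module M N\<^esub> x"
      using st by (simp add: quot_add a_comm)
  next
    show "\<zero>\<^bsub>quot_module M N\<^esub> \<in> carrier (quot_module M N)"
      unfolding z unfolding quot_module_simps by blast
  next
    fix x assume "x \<in> carrier (quot_module M N)"
    then obtain s where "x = N +> s" "s \<in> carrier M"
      unfolding quot_module_simps by blast
    then show "\<zero>\<^bsub>quot_module M N\<^esub> \<oplus>\<^bsub>quot_module M N\<^esub> x = x" "x \<oplus>\<^bsub>quot_module M N\<^esub> x = \<zero>\<^bsub>quot_module M N\<^esub>"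
      "1 \<odot>\<^bsub>quot_module M N\<^esub> x = x" "0 \<odot>\<^bsub>quot_module M N\<^esub> x = \<zero>\<^bsub>quot_module M N\<^esub>"
      unfolding z by (simp_all add: quot_add quot_smult add_self smult_one smult_zero)
  qed
qed

end

lemma bit_subspace_image:
  assumes "bit_space M" "bit_space N" "additive_map M N f"
  shows "bit_subspace N (f ` carrier M)"
proof -
  interpret M: bit_space M by fact
  interpret N: bit_space N by fact
  show ?thesis
  proof unfold_locales
    show "f ` carrier M \<subseteq> carrier N"
      using additive_closed[OF assms(3)] by auto
    show "\<zero>\<^bsub>N\<^esub> \<in> f ` carrier M"
      using additive_zero[OF assms] M.zero_closed by force
    show "x \<oplus>\<^bsub>N\<^esub> y \<in> f ` carrier M" if xy: "x \<in> f ` carrier M" "y \<in> f ` carrier M" for x y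
    proof -
      obtain x' y' where "x' \<in> carrier M" "y' \<in> carrier M" "x = f x'" "y = f y'"
        using xy by blast
      then show ?thesis
        using additive_add[OF assms(3)] M.a_closed by (metis image_eqI)
    qed
  qed
qed

section \<open>Stalks and sheafification\<close>

lemma stalk_ops:
  "\<zero>\<^bsub>stalk F x\<^esub> = (THE k. \<exists>U\<in>opens F. x \<in> U \<and> k = germ F x U \<zero>\<^bsub>sections F U\<^esub>)"
  "g \<oplus>\<^bsub>stalk F x\<^esub> h = (THE k. \<exists>U\<in>opens F. x \<in> U \<and> (\<exists>a\<in>carrier (sections F U). \<exists>b\<in>carrier (sections F U).
     g = germ F x U a \<and> h = germ F x U b \<and> k = germ F x U (a \<oplus>\<^bsub>sections F U\<^esub> b)))"
  "r \<odot>\<^bsub>stalk F x\<^esub> g = (THE k. \<exists>U\<in>opens F. x \<in> U \<and> (\<exists>a\<in>carrier (sections F U).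
     g = germ F x U a \<and> k = germ F x U (r \<odot>\<^bsub>sections F U\<^esub> a)))"
  by (simp_all add: stalk_def mk_module_def)

locale base_presheaf =
  fixes F :: "('x, 's) presheaf"
  assumes space: "U \<in> opens F \<Longrightarrow> bit_space (sections F U)"
    and restr_additive:
      "\<lbrakk>U \<in> opens F; V \<in> opens F; V \<subseteq> U\<rbrakk> \<Longrightarrow> additive_map (sections F U) (sections F V) (restr F U V)"
    and restr_restr:
      "\<lbrakk>U \<in> opens F; V \<in> opens F; W \<in> opens F; V \<subseteq> U; W \<subseteq> V; a \<in> carrier (sections F U)\<rbrakk> \<Longrightarrow>
        restr F V W (restr F U V a) = restr F U W a"
    and base: "\<lbrakk>U \<in> opens F; V \<in> opens F; x \<in> U; x \<in> V\<rbrakk> \<Longrightarrow> \<exists>N\<in>opens F. x \<in> N \<and> N \<subseteq> U \<inter> V"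
begin

lemma restr_closed:
  "\<lbrakk>U \<in> opens F; V \<in> opens F; V \<subseteq> U; a \<in> carrier (sections F U)\<rbrakk> \<Longrightarrow> restr F U V a \<in> carrier (sections F V)"
  by (rule additive_closed[OF restr_additive])

lemma restr_add:
  "\<lbrakk>U \<in> opens F; V \<in> opens F; V \<subseteq> U; a \<in> carrier (sections F U); b \<in> carrier (sections F U)\<rbrakk> \<Longrightarrow>
    restr F U V (a \<oplus>\<^bsub>sections F U\<^esub> b) = restr F U V a \<oplus>\<^bsub>sections F V\<^esub> restr F U V b"
  by (rule additive_add[OF restr_additive])

lemma restr_zero:
  "\<lbrakk>U \<in> opens F; V \<in> opens F; V \<subseteq> U\<rbrakk> \<Longrightarrow> restr F U V \<zero>\<^bsub>sections F U\<^esub> = \<zero>\<^bsub>sections F V\<^esub>"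
  by (rule additive_zero[OF space space restr_additive])

lemma restr_smult:
  "\<lbrakk>U \<in> opens F; V \<in> opens F; V \<subseteq> U; a \<in> carrier (sections F U)\<rbrakk> \<Longrightarrow>
    restr F U V (r \<odot>\<^bsub>sections F U\<^esub> a) = r \<odot>\<^bsub>sections F V\<^esub> restr F U V a"
  by (rule additive_smult[OF space space restr_additive])

text \<open>A germ is the set of all pairs equivalent to (U, a). This is transitivity of that
  relation, checked on a common refinement of the two witnessing neighbourhoods.\<close>

lemma germ_subset:
  assumes U: "U \<in> opens F" "x \<in> U" "a \<in> carrier (sections F U)"
    and V: "V \<in> opens F" "x \<in> V" "b \<in> carrier (sections F V)"
    and N: "N \<in> opens F" "x \<in> N" "N \<subseteq> U \<inter> V" "restr F U N a = restr F V N b"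
  shows "germ F x V b \<subseteq> germ F x U a"
proof
  fix p assume "p \<in> germ F x V b"
  then obtain W c N' where p: "p = (W, c)" and W: "W \<in> opens F" "x \<in> W" "c \<in> carrier (sections F W)"
    and N': "N' \<in> opens F" "x \<in> N'" "N' \<subseteq> V \<inter> W" "restr F V N' b = restr F W N' c"
    unfolding germ_def by blast
  obtain M where M: "M \<in> opens F" "x \<in> M" "M \<subseteq> N \<inter> N'"
    using base[of N N' x] N N' by blast
  have "restr F U M a = restr F N M (restr F U N a)"
    using U N M by (intro restr_restr[symmetric]) auto
  also have "\<dots> = restr F V M b"
    unfolding N(4) using V N M by (intro restr_restr) auto
  also have "\<dots> = restr F N' M (restr F V N' b)"
    using V N' M by (intro restr_restr[symmetric]) auto
  also have "\<dots> = restr F W M c"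
    unfolding N'(4) using W N' M by (intro restr_restr) auto
  finally have "restr F U M a = restr F W M c" .
  moreover have "M \<subseteq> U \<inter> W"
    using M N N' by blast
  ultimately show "p \<in> germ F x U a"
    unfolding germ_def p using W M by blast
qed

lemma germ_eq_iff:
  assumes U: "U \<in> opens F" "x \<in> U" "a \<in> carrier (sections F U)"
    and V: "V \<in> opens F" "x \<in> V" "b \<in> carrier (sections F V)"
  shows "germ F x U a = germ F x V b \<longleftrightarrow>
    (\<exists>N\<in>opens F. x \<in> N \<and> N \<subseteq> U \<inter> V \<and> restr F U N a = restr F V N b)"
proof
  assume eq: "germ F x U a = germ F x V b"
  obtain N where "N \<in> opens F" "x \<in> N" "N \<subseteq> V \<inter> V"
    using base[of V V x] V by blast
  then have "(V, b) \<in> germ F x V b"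
    unfolding germ_def using V by blast
  then have "(V, b) \<in> germ F x U a"
    using eq by simp
  then show "\<exists>N\<in>opens F. x \<in> N \<and> N \<subseteq> U \<inter> V \<and> restr F U N a = restr F V N b"
    unfolding germ_def by blast
next
  assume "\<exists>N\<in>opens F. x \<in> N \<and> N \<subseteq> U \<inter> V \<and> restr F U N a = restr F V N b"
  then obtain N where N: "N \<in> opens F" "x \<in> N" "N \<subseteq> U \<inter> V" "restr F U N a = restr F V N b"
    by blast
  show "germ F x U a = germ F x V b"
  proof
    show "germ F x V b \<subseteq> germ F x U a"
      by (rule germ_subset[OF U V N])
    show "germ F x U a \<subseteq> germ F x V b"
      by (rule germ_subset[OF V U N(1,2)]) (use N in auto)
  qed
qed

lemma germ_restr:
  assumes "U \<in> opens F" "V \<in> opens F" "V \<subseteq> U" "x \<in> V" "a \<in> carrier (sections F U)"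
  shows "germ F x V (restr F U V a) = germ F x U a"
proof -
  obtain N where N: "N \<in> opens F" "x \<in> N" "N \<subseteq> V \<inter> V"
    using base[of V V x] assms by blast
  have "restr F V N (restr F U V a) = restr F U N a"
    using assms N by (intro restr_restr) auto
  then show ?thesis
    using assms N restr_closed by (subst germ_eq_iff) blast+
qed

lemma carrier_stalk:
  "carrier (stalk F x) = {germ F x U a | U a. U \<in> opens F \<and> x \<in> U \<and> a \<in> carrier (sections F U)}"
  by (simp add: stalk_def mk_module_def)

lemma germ_in_stalk:
  "\<lbrakk>U \<in> opens F; x \<in> U; a \<in> carrier (sections F U)\<rbrakk> \<Longrightarrow> germ F x U a \<in> carrier (stalk F x)"
  unfolding carrier_stalk by blast

text \<open>One neighbourhood for both equalities at once, as independence of representatives for a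
  binary operation requires.\<close>

lemma germ_eq_common:
  assumes U: "U \<in> opens F" "x \<in> U" and a: "a \<in> carrier (sections F U)" "b \<in> carrier (sections F U)"
    and V: "V \<in> opens F" "x \<in> V" and c: "c \<in> carrier (sections F V)" "d \<in> carrier (sections F V)"
    and eq: "germ F x U a = germ F x V c" "germ F x U b = germ F x V d"
  obtains N where "N \<in> opens F" "x \<in> N" "N \<subseteq> U" "N \<subseteq> V"
    "restr F U N a = restr F V N c" "restr F U N b = restr F V N d"
proof -
  obtain N1 where N1: "N1 \<in> opens F" "x \<in> N1" "N1 \<subseteq> U \<inter> V" "restr F U N1 a = restr F V N1 c"
    using eq(1) germ_eq_iff[OF U a(1) V c(1)] by blast
  obtain N2 where N2: "N2 \<in> opens F" "x \<in> N2" "N2 \<subseteq> U \<inter> V" "restr F U N2 b = restr F V N2 d"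
    using eq(2) germ_eq_iff[OF U a(2) V c(2)] by blast
  obtain N where N: "N \<in> opens F" "x \<in> N" "N \<subseteq> N1 \<inter> N2"
    using base[of N1 N2 x] N1 N2 by blast
  have "restr F U N a = restr F N1 N (restr F U N1 a)"
    using U a N N1 by (intro restr_restr[symmetric]) auto
  also have "\<dots> = restr F V N c"
    unfolding N1(4) using V c N N1 by (intro restr_restr) auto
  finally have 1: "restr F U N a = restr F V N c" .
  have "restr F U N b = restr F N2 N (restr F U N2 b)"
    using U a N N2 by (intro restr_restr[symmetric]) auto
  also have "\<dots> = restr F V N d"
    unfolding N2(4) using V c N N2 by (intro restr_restr) auto
  finally have "restr F U N b = restr F V N d" .
  with 1 N N1 show ?thesis
    by (intro that) auto
qed

text \<open>Here and in the next two lemmas the \<open>THE\<close> in \<open>stalk\<close> is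
  resolved: different representatives agree after restriction to a common neighbourhood.\<close>

lemma stalk_zero:
  assumes "U \<in> opens F" "x \<in> U"
  shows "\<zero>\<^bsub>stalk F x\<^esub> = germ F x U \<zero>\<^bsub>sections F U\<^esub>"
proof -
  have zero: "\<zero>\<^bsub>sections F V\<^esub> \<in> carrier (sections F V)" if "V \<in> opens F" for V
  proof -
    interpret bit_space "sections F V" by (rule space) fact
    show ?thesis by simp
  qed
  have "germ F x V \<zero>\<^bsub>sections F V\<^esub> = germ F x U \<zero>\<^bsub>sections F U\<^esub>" if V: "V \<in> opens F" "x \<in> V" for V
  proof -
    obtain N where "N \<in> opens F" "x \<in> N" "N \<subseteq> V \<inter> U"
      using base[of V U x] assms V by blast
    then show ?thesis
      using V assms zero restr_zero by (subst germ_eq_iff) auto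
  qed
  then show ?thesis
    unfolding stalk_ops using assms by (intro the_equality) (blast | metis)+
qed

lemma stalk_add:
  assumes "U \<in> opens F" "x \<in> U" "a \<in> carrier (sections F U)" "b \<in> carrier (sections F U)"
  shows "germ F x U a \<oplus>\<^bsub>stalk F x\<^esub> germ F x U b = germ F x U (a \<oplus>\<^bsub>sections F U\<^esub> b)"
proof -
  have add: "c \<oplus>\<^bsub>sections F V\<^esub> d \<in> carrier (sections F V)"
    if "V \<in> opens F" "c \<in> carrier (sections F V)" "d \<in> carrier (sections F V)" for V c d
  proof -
    interpret bit_space "sections F V" by (rule space) fact
    show ?thesis using that by simp
  qed
  have "germ F x V (c \<oplus>\<^bsub>sections F V\<^esub> d) = germ F x U (a \<oplus>\<^bsub>sections F U\<^esub> b)"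
    if V: "V \<in> opens F" "x \<in> V" "c \<in> carrier (sections F V)" "d \<in> carrier (sections F V)"
      and eq: "germ F x U a = germ F x V c" "germ F x U b = germ F x V d" for V c d
  proof -
    obtain N where N: "N \<in> opens F" "x \<in> N" "N \<subseteq> U" "N \<subseteq> V"
      "restr F U N a = restr F V N c" "restr F U N b = restr F V N d"
      using germ_eq_common[OF assms V eq] .
    have "restr F V N (c \<oplus>\<^bsub>sections F V\<^esub> d) = restr F U N (a \<oplus>\<^bsub>sections F U\<^esub> b)"
      using N V assms by (simp add: restr_add)
    then show ?thesis
      using V assms N add by (subst germ_eq_iff) auto
  qed
  then show ?thesis
    unfolding stalk_ops using assms by (intro the_equality) (blast | metis)+
qed

lemma stalk_smult:
  assumes "U \<in> opens F" "x \<in> U" "a \<in> carrier (sections F U)"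
  shows "r \<odot>\<^bsub>stalk F x\<^esub> germ F x U a = germ F x U (r \<odot>\<^bsub>sections F U\<^esub> a)"
proof -
  have cl: "r \<odot>\<^bsub>sections F V\<^esub> c \<in> carrier (sections F V)"
    if "V \<in> opens F" "c \<in> carrier (sections F V)" for V c
  proof -
    interpret bit_space "sections F V" by (rule space) fact
    show ?thesis using that by (simp add: smult_closed)
  qed
  have "germ F x V (r \<odot>\<^bsub>sections F V\<^esub> c) = germ F x U (r \<odot>\<^bsub>sections F U\<^esub> a)"
    if V: "V \<in> opens F" "x \<in> V" "c \<in> carrier (sections F V)"
      and eq: "germ F x U a = germ F x V c" for V c
  proof -
    obtain N where N: "N \<in> opens F" "x \<in> N" "N \<subseteq> U" "N \<subseteq> V"
      "restr F U N a = restr F V N c"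
      using germ_eq_common[OF assms assms(3) V V(3) eq eq] .
    have "restr F V N (r \<odot>\<^bsub>sections F V\<^esub> c) = restr F U N (r \<odot>\<^bsub>sections F U\<^esub> a)"
      using N V assms by (simp add: restr_smult)
    then show ?thesis
      using V assms N cl by (subst germ_eq_iff) auto
  qed
  then show ?thesis
    unfolding stalk_ops using assms by (intro the_equality) (blast | metis)+
qed

lemma stalk_common:
  assumes "g \<in> carrier (stalk F x)" "h \<in> carrier (stalk F x)" "k \<in> carrier (stalk F x)"
  obtains N a b c where "N \<in> opens F" "x \<in> N"
    "a \<in> carrier (sections F N)" "g = germ F x N a"
    "b \<in> carrier (sections F N)" "h = germ F x N b"
    "c \<in> carrier (sections F N)" "k = germ F x N c"
proof -
  obtain U a where U: "U \<in> opens F" "x \<in> U" "a \<in> carrier (sections F U)" "g = germ F x U a"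
    using assms(1) unfolding carrier_stalk by blast
  obtain V b where V: "V \<in> opens F" "x \<in> V" "b \<in> carrier (sections F V)" "h = germ F x V b"
    using assms(2) unfolding carrier_stalk by blast
  obtain W c where W: "W \<in> opens F" "x \<in> W" "c \<in> carrier (sections F W)" "k = germ F x W c"
    using assms(3) unfolding carrier_stalk by blast
  obtain N1 where N1: "N1 \<in> opens F" "x \<in> N1" "N1 \<subseteq> U \<inter> V"
    using base[of U V x] U V by blast
  obtain N where N: "N \<in> opens F" "x \<in> N" "N \<subseteq> N1 \<inter> W"
    using base[of N1 W x] N1 W by blast
  have sub: "N \<subseteq> U" "N \<subseteq> V" "N \<subseteq> W" using N N1 by auto
  show ?thesis
    by (rule that[OF N(1,2) restr_closed[OF U(1) N(1) sub(1) U(3)] _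
        restr_closed[OF V(1) N(1) sub(2) V(3)] _ restr_closed[OF W(1) N(1) sub(3) W(3)]])
      (use U V W N sub in \<open>simp_all add: germ_restr\<close>)
qed

lemma bit_space_stalk:
  assumes "x \<in> \<Union>(opens F)"
  shows "bit_space (stalk F x)"
proof -
  \<comment> \<open>A law in at most three germs may be checked on representatives over a common
    neighbourhood.\<close>
  have loc: "P g h k" if ghk: "g \<in> carrier (stalk F x)" "h \<in> carrier (stalk F x)" "k \<in> carrier (stalk F x)"
    and P: "\<And>N a b c. \<lbrakk>N \<in> opens F; x \<in> N; bit_space (sections F N); a \<in> carrier (sections F N);
      b \<in> carrier (sections F N); c \<in> carrier (sections F N)\<rbrakk> \<Longrightarrow> P (germ F x N a) (germ F x N b) (germ F x N c)"
    for g h k P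
    using stalk_common[OF ghk] P space by metis
  have ag: "abelian_group (sections F N)" "abelian_monoid (sections F N)" if "bit_space (sections F N)" for N
    using that by (auto simp: bit_space_def abelian_group_def)
  show ?thesis
  proof (rule bit_spaceI)
    fix g h k assume ghk: "g \<in> carrier (stalk F x)" "h \<in> carrier (stalk F x)" "k \<in> carrier (stalk F x)"
    show "g \<oplus>\<^bsub>stalk F x\<^esub> h \<oplus>\<^bsub>stalk F x\<^esub> k = g \<oplus>\<^bsub>stalk F x\<^esub> (h \<oplus>\<^bsub>stalk F x\<^esub> k)"
      by (rule loc[OF ghk])
        (simp add: stalk_add abelian_monoid.a_closed[OF ag(2)] abelian_monoid.a_assoc[OF ag(2)])
  next
    fix g h assume gh: "g \<in> carrier (stalk F x)" "h \<in> carrier (stalk F x)"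
    show "g \<oplus>\<^bsub>stalk F x\<^esub> h \<in> carrier (stalk F x)"
      by (rule loc[OF gh(1) gh])
        (simp add: stalk_add abelian_monoid.a_closed[OF ag(2)] germ_in_stalk)
    show "g \<oplus>\<^bsub>stalk F x\<^esub> h = h \<oplus>\<^bsub>stalk F x\<^esub> g"
      by (rule loc[OF gh(1) gh]) (metis stalk_add abelian_monoid.a_comm[OF ag(2)])
  next
    fix g assume g: "g \<in> carrier (stalk F x)"
    show "\<zero>\<^bsub>stalk F x\<^esub> \<oplus>\<^bsub>stalk F x\<^esub> g = g"
      by (rule loc[OF g g g]) (simp add: stalk_zero stalk_add abelian_monoid.zero_closed[OF ag(2)]
          abelian_monoid.l_zero[OF ag(2)])
    show "g \<oplus>\<^bsub>stalk F x\<^esub> g = \<zero>\<^bsub>stalk F x\<^esub>"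
      by (rule loc[OF g g g]) (simp add: stalk_zero stalk_add bit_space.add_self)
    show "1 \<odot>\<^bsub>stalk F x\<^esub> g = g"
      by (rule loc[OF g g g]) (simp add: stalk_smult bit_space.smult_one)
    show "0 \<odot>\<^bsub>stalk F x\<^esub> g = \<zero>\<^bsub>stalk F x\<^esub>"
      by (rule loc[OF g g g]) (simp add: stalk_smult stalk_zero bit_space.smult_zero)
  next
    obtain U where U: "U \<in> opens F" "x \<in> U" using assms by blast
    then interpret bit_space "sections F U" by (intro space)
    show "\<zero>\<^bsub>stalk F x\<^esub> \<in> carrier (stalk F x)"
      using U by (auto simp: stalk_zero[OF U] intro!: germ_in_stalk)
  qed
qed

lemma bit_space_germ_families: "U \<subseteq> \<Union>(opens F) \<Longrightarrow> bit_space (prod_module U (stalk F))"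
  by (rule bit_space_prod_module, rule bit_space_stalk) auto

lemma germs_of_additive:
  assumes "U \<in> opens F"
  shows "additive_map (sections F U) (prod_module U (stalk F)) (germs_of F U)"
  unfolding additive_map_def
proof (intro conjI ballI funcsetI)
  fix a assume a: "a \<in> carrier (sections F U)"
  then show "germs_of F U a \<in> carrier (prod_module U (stalk F))"
    using assms by (auto simp: germs_of_def prod_module_simps germ_in_stalk)
  fix b assume b: "b \<in> carrier (sections F U)"
  show "germs_of F U (a \<oplus>\<^bsub>sections F U\<^esub> b) = germs_of F U a \<oplus>\<^bsub>prod_module U (stalk F)\<^esub> germs_of F U b"
    unfolding germs_of_def prod_module_simps using assms a b
    by (intro restrict_ext) (simp add: stalk_add)
qed

end

text \<open>Sheaves realised by functions, with restriction of functions. Separatedness is then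
  extensionality, and gluing says that being a section is a local condition. The etale-space
  sheafification has this form.\<close>

locale fun_sheaf = base_presheaf F for F :: "('x, 'x \<Rightarrow> 'g) presheaf" +
  assumes open_Int: "\<lbrakk>U \<in> opens F; V \<in> opens F\<rbrakk> \<Longrightarrow> U \<inter> V \<in> opens F"
    and open_Union: "\<U> \<subseteq> opens F \<Longrightarrow> \<Union>\<U> \<in> opens F"
    and restr_eq: "restr F U V s = restrict s V"
    and extensional: "\<lbrakk>U \<in> opens F; s \<in> carrier (sections F U)\<rbrakk> \<Longrightarrow> s \<in> extensional U"
    and glue: "\<lbrakk>U \<in> opens F; s \<in> extensional U;
      \<And>x. x \<in> U \<Longrightarrow> \<exists>N\<in>opens F. x \<in> N \<and> N \<subseteq> U \<and> restrict s N \<in> carrier (sections F N)\<rbrakk>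
      \<Longrightarrow> s \<in> carrier (sections F U)"

lemma fun_sheaf_restrict_sheaf:
  assumes "fun_sheaf F" "A \<in> opens F"
  shows "fun_sheaf (restrict_sheaf F A)"
proof -
  interpret fun_sheaf F by fact
  show ?thesis
  proof (intro fun_sheaf.intro base_presheaf.intro fun_sheaf_axioms.intro, goal_cases)
    case (4 U V x)
    then show ?case
      using open_Int[of U V] by (auto simp: restrict_sheaf_def)
  next
    case (6 \<U>)
    then show ?case
      using open_Union[of \<U>] by (auto simp: restrict_sheaf_def)
  next
    case (9 U s)
    have "s \<in> carrier (sections F U)"
    proof (rule glue)
      show "\<exists>N\<in>opens F. x \<in> N \<and> N \<subseteq> U \<and> restrict s N \<in> carrier (sections F N)" if "x \<in> U" for x
        using 9(3)[OF that] by (auto simp: restrict_sheaf_def)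
    qed (use 9 in \<open>auto simp: restrict_sheaf_def\<close>)
    then show ?case
      by (simp add: restrict_sheaf_def)
  qed (auto simp: restrict_sheaf_def intro: space restr_additive restr_restr open_Int restr_eq extensional)
qed

context base_presheaf
begin

lemma carrier_sheafify:
  "carrier (sections (sheafify \<O> F) U) = {s \<in> \<Pi>\<^sub>E x\<in>U. carrier (stalk F x).
     \<forall>x\<in>U. \<exists>N\<in>opens F. x \<in> N \<and> N \<subseteq> U \<and> (\<exists>a\<in>carrier (sections F N). \<forall>y\<in>N. s y = germ F y N a)}"
  by (simp add: sheafify_def prod_module_simps)

lemma sheafify_ops:
  "\<zero>\<^bsub>sections (sheafify \<O> F) U\<^esub> = (\<lambda>x\<in>U. \<zero>\<^bsub>stalk F x\<^esub>)"
  "s \<oplus>\<^bsub>sections (sheafify \<O> F) U\<^esub> t = (\<lambda>x\<in>U. s x \<oplus>\<^bsub>stalk F x\<^esub> t x)"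
  "opens (sheafify \<O> F) = \<O>" "restr (sheafify \<O> F) U V s = restrict s V"
  by (simp_all add: sheafify_def prod_module_simps)

lemma sheafifyE:
  assumes "s \<in> carrier (sections (sheafify \<O> F) U)" "x \<in> U"
  obtains N a where "N \<in> opens F" "x \<in> N" "N \<subseteq> U" "a \<in> carrier (sections F N)"
    "\<And>y. y \<in> N \<Longrightarrow> s y = germ F y N a"
  using assms unfolding carrier_sheafify by blast

lemma germs_of_in_sheafify:
  assumes "U \<in> opens F" "a \<in> carrier (sections F U)"
  shows "germs_of F U a \<in> carrier (sections (sheafify \<O> F) U)"
  using assms unfolding carrier_sheafify by (auto simp: germs_of_def germ_in_stalk)

lemma bit_space_sheafify:
  assumes U: "U \<in> \<O>" and refine: "\<And>x. x \<in> U \<Longrightarrow> \<exists>N\<in>opens F. x \<in> N \<and> N \<subseteq> U"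
  shows "bit_space (sections (sheafify \<O> F) U)"
proof -
  have "U \<subseteq> \<Union>(opens F)"
    using refine by blast
  then interpret P: bit_space "prod_module U (stalk F)"
    by (rule bit_space_germ_families)
  have "bit_space ((prod_module U (stalk F))\<lparr>carrier := carrier (sections (sheafify \<O> F) U)\<rparr>)"
  proof (rule P.bit_space_sub)
    show "carrier (sections (sheafify \<O> F) U) \<subseteq> carrier (prod_module U (stalk F))"
      by (auto simp: sheafify_def)
    show "\<zero>\<^bsub>prod_module U (stalk F)\<^esub> \<in> carrier (sections (sheafify \<O> F) U)"
      unfolding carrier_sheafify
    proof (intro CollectI conjI ballI)
      show "\<zero>\<^bsub>prod_module U (stalk F)\<^esub> \<in> (\<Pi>\<^sub>E x\<in>U. carrier (stalk F x))"
        using P.zero_closed by (simp add: prod_module_simps)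
      fix x assume "x \<in> U"
      then obtain N where N: "N \<in> opens F" "x \<in> N" "N \<subseteq> U"
        using refine by blast
      then interpret N: bit_space "sections F N" by (intro space)
      show "\<exists>N\<in>opens F. x \<in> N \<and> N \<subseteq> U \<and> (\<exists>a\<in>carrier (sections F N). \<forall>y\<in>N. \<zero>\<^bsub>prod_module U (stalk F)\<^esub> y = germ F y N a)"
        using N by (intro bexI[OF _ N(1)] conjI bexI[OF _ N.zero_closed]) (auto simp: prod_module_simps stalk_zero[OF N(1)])
    qed
    fix s t assume s: "s \<in> carrier (sections (sheafify \<O> F) U)" and t: "t \<in> carrier (sections (sheafify \<O> F) U)"
    show "s \<oplus>\<^bsub>prod_module U (stalk F)\<^esub> t \<in> carrier (sections (sheafify \<O> F) U)"
      unfolding carrier_sheafify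
    proof (intro CollectI conjI ballI)
      show "s \<oplus>\<^bsub>prod_module U (stalk F)\<^esub> t \<in> (\<Pi>\<^sub>E x\<in>U. carrier (stalk F x))"
        using P.a_closed[of s t] s t by (auto simp: prod_module_simps carrier_sheafify)
      fix x assume x: "x \<in> U"
      obtain N1 a where N1: "N1 \<in> opens F" "x \<in> N1" "N1 \<subseteq> U" "a \<in> carrier (sections F N1)"
        "\<And>y. y \<in> N1 \<Longrightarrow> s y = germ F y N1 a"
        using sheafifyE[OF s x] by metis
      obtain N2 b where N2: "N2 \<in> opens F" "x \<in> N2" "N2 \<subseteq> U" "b \<in> carrier (sections F N2)"
        "\<And>y. y \<in> N2 \<Longrightarrow> t y = germ F y N2 b"
        using sheafifyE[OF t x] by metis
      obtain N where N: "N \<in> opens F" "x \<in> N" "N \<subseteq> N1 \<inter> N2"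
        using base[of N1 N2 x] N1 N2 by blast
      then interpret N: bit_space "sections F N" by (intro space)
      let ?a = "restr F N1 N a" and ?b = "restr F N2 N b"
      have ab: "?a \<in> carrier (sections F N)" "?b \<in> carrier (sections F N)"
        using N N1 N2 by (auto intro!: restr_closed)
      have "(s \<oplus>\<^bsub>prod_module U (stalk F)\<^esub> t) y = germ F y N (?a \<oplus>\<^bsub>sections F N\<^esub> ?b)" if "y \<in> N" for y
      proof -
        have "s y = germ F y N ?a" "t y = germ F y N ?b"
          using that N N1 N2 by (auto simp: germ_restr)
        then show ?thesis
          using that N N1 ab by (auto simp: prod_module_simps stalk_add)
      qed
      then show "\<exists>N\<in>opens F. x \<in> N \<and> N \<subseteq> U \<and> (\<exists>a\<in>carrier (sections F N). \<forall>y\<in>N. (s \<oplus>\<^bsub>prod_module U (stalk F)\<^esub> t) y = germ F y N a)"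
        using N N1 ab by (intro bexI[OF _ N(1)] conjI bexI[of _ "?a \<oplus>\<^bsub>sections F N\<^esub> ?b"]) auto
    qed
  qed
  moreover have "(prod_module U (stalk F))\<lparr>carrier := carrier (sections (sheafify \<O> F) U)\<rparr> = sections (sheafify \<O> F) U"
    by (simp add: sheafify_def)
  ultimately show ?thesis
    by simp
qed

text \<open>Membership in the etale-space construction is a local condition, hence gluing. For
  restriction to V, a base set is chosen inside the intersection of V with a witness on U.\<close>

lemma fun_sheaf_sheafify:
  assumes sub: "opens F \<subseteq> \<O>" and refine: "\<And>U x. U \<in> \<O> \<Longrightarrow> x \<in> U \<Longrightarrow> \<exists>N\<in>opens F. x \<in> N \<and> N \<subseteq> U"
    and Int: "\<And>U V. U \<in> \<O> \<Longrightarrow> V \<in> \<O> \<Longrightarrow> U \<inter> V \<in> \<O>" and Un: "\<And>\<U>. \<U> \<subseteq> \<O> \<Longrightarrow> \<Union>\<U> \<in> \<O>"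
  shows "fun_sheaf (sheafify \<O> F)"
proof -
  have res: "restrict s V \<in> carrier (sections (sheafify \<O> F) V)"
    if UV: "U \<in> \<O>" "V \<in> \<O>" "V \<subseteq> U" and s: "s \<in> carrier (sections (sheafify \<O> F) U)" for U V s
    unfolding carrier_sheafify
  proof (intro CollectI conjI ballI)
    show "restrict s V \<in> (\<Pi>\<^sub>E x\<in>V. carrier (stalk F x))"
      using s UV(3) by (auto simp: carrier_sheafify)
    fix x assume x: "x \<in> V"
    then obtain N a where N: "N \<in> opens F" "x \<in> N" "N \<subseteq> U" "a \<in> carrier (sections F N)"
      "\<And>y. y \<in> N \<Longrightarrow> s y = germ F y N a"
      using sheafifyE[OF s, of x] UV(3) by blast
    have "N \<inter> V \<in> \<O>"
      using N UV sub Int by blast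
    then obtain N' where N': "N' \<in> opens F" "x \<in> N'" "N' \<subseteq> N \<inter> V"
      using refine[of "N \<inter> V" x] N x by blast
    have "restrict s V y = germ F y N' (restr F N N' a)" if "y \<in> N'" for y
      using N N' that by (subst germ_restr) auto
    then show "\<exists>N\<in>opens F. x \<in> N \<and> N \<subseteq> V \<and> (\<exists>a\<in>carrier (sections F N). \<forall>y\<in>N. restrict s V y = germ F y N a)"
      using N N' by (intro bexI[OF _ N'(1)] conjI bexI[OF _ restr_closed[OF N(1) N'(1) _ N(4)]]) auto
  qed
  show ?thesis
  proof (intro fun_sheaf.intro base_presheaf.intro fun_sheaf_axioms.intro, unfold sheafify_ops, goal_cases)
    case (1 U)
    then show ?case by (intro bit_space_sheafify refine)
  next
    case (2 U V)
    then show ?case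
      using res[OF 2] 2(3) unfolding additive_map_def sheafify_ops by (auto simp: fun_eq_iff restrict_def)
  next
    case (3 U V W a)
    then show ?case by (auto simp: restrict_def fun_eq_iff)
  next
    case (4 U V x)
    then show ?case using Int by blast
  next
    case (8 U s)
    then show ?case by (auto simp: carrier_sheafify PiE_def)
  next
    case (9 U s)
    show ?case
      unfolding carrier_sheafify
    proof (intro CollectI conjI ballI PiE_I)
      fix x assume x: "x \<in> U"
      then obtain N where N: "N \<in> \<O>" "x \<in> N" "N \<subseteq> U" "restrict s N \<in> carrier (sections (sheafify \<O> F) N)"
        using 9 by blast
      then show "s x \<in> carrier (stalk F x)"
        by (auto simp: carrier_sheafify dest!: PiE_mem[of _ _ _ x])
      obtain N' a where "N' \<in> opens F" "x \<in> N'" "N' \<subseteq> N" "a \<in> carrier (sections F N')"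
        "\<And>y. y \<in> N' \<Longrightarrow> restrict s N y = germ F y N' a"
        using sheafifyE[OF N(4,2)] by metis
      then show "\<exists>N\<in>opens F. x \<in> N \<and> N \<subseteq> U \<and> (\<exists>a\<in>carrier (sections F N). \<forall>y\<in>N. s y = germ F y N a)"
        using N by (intro bexI[of _ N'] conjI bexI[of _ a]) (auto simp: restrict_def subset_iff)
    next
      show "s x = undefined" if "x \<notin> U" for x
        using 9(2) that by (auto simp: extensional_def)
    qed
  qed (use Int Un in auto)
qed

end

section \<open>First cohomology of a union of two open sets\<close>

context fun_sheaf
begin

abbreviation "Y \<equiv> \<Union>(opens F)"

abbreviation "C0 U \<equiv> prod_module U (stalk F)"

text \<open>The copy of F(U) inside the families of germs; the embedding is injective by
  \<open>inj_germs_of\<close>.\<close>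

definition E :: "'x set \<Rightarrow> ('x \<Rightarrow> ('x set \<times> ('x \<Rightarrow> 'g)) set) set" where
  "E U = germs_of F U ` carrier (sections F U)"

lemma Y_open: "Y \<in> opens F"
  by (rule open_Union) simp

lemma bit_space_C0: "U \<in> opens F \<Longrightarrow> bit_space (C0 U)"
  by (rule bit_space_germ_families) auto

lemma E_subspace: "U \<in> opens F \<Longrightarrow> bit_subspace (C0 U) (E U)"
  unfolding E_def by (intro bit_subspace_image space bit_space_C0 germs_of_additive)

text \<open>Sections are functions and equal germs agree on a neighbourhood, so the value at the
  point can be read off the germ.\<close>

lemma germ_eq_imp:
  assumes "U \<in> opens F" "x \<in> U" "f \<in> carrier (sections F U)"
    and "V \<in> opens F" "x \<in> V" "g \<in> carrier (sections F V)"
    and "germ F x U f = germ F x V g"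
  shows "f x = g x"
proof -
  obtain N where "x \<in> N" "restrict f N = restrict g N"
    using assms(7) unfolding germ_eq_iff[OF assms(1-6)] restr_eq by blast
  then show ?thesis
    by (metis restrict_apply')
qed

lemma inj_germs_of: "U \<in> opens F \<Longrightarrow> inj_on (germs_of F U) (carrier (sections F U))"
proof (rule inj_onI)
  fix f g assume U: "U \<in> opens F" and fg: "f \<in> carrier (sections F U)" "g \<in> carrier (sections F U)"
    and eq: "germs_of F U f = germs_of F U g"
  show "f = g"
  proof (rule extensionalityI[OF extensional[OF U fg(1)] extensional[OF U fg(2)]])
    fix x assume x: "x \<in> U"
    then have "germ F x U f = germ F x U g"
      using fun_cong[OF eq, of x] by (simp add: germs_of_def)
    then show "f x = g x"
      by (intro germ_eq_imp) (use U x fg in auto)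
  qed
qed

lemma restrict_closed:
  "\<lbrakk>U \<in> opens F; V \<in> opens F; V \<subseteq> U; f \<in> carrier (sections F U)\<rbrakk> \<Longrightarrow> restrict f V \<in> carrier (sections F V)"
  using restr_closed[of U V f] by (simp add: restr_eq)

lemma restrict_germs_of:
  assumes "U \<in> opens F" "V \<in> opens F" "V \<subseteq> U" "f \<in> carrier (sections F U)"
  shows "restrict (germs_of F U f) V = germs_of F V (restrict f V)"
proof -
  have "germ F x V (restrict f V) = germ F x U f" if "x \<in> V" for x
    using germ_restr[OF assms(1-3) that assms(4)] by (simp add: restr_eq)
  then show ?thesis
    using assms(3) by (auto simp: germs_of_def restrict_def fun_eq_iff)
qed

lemma E_restrict: "\<lbrakk>U \<in> opens F; V \<in> opens F; V \<subseteq> U; c \<in> E U\<rbrakk> \<Longrightarrow> restrict c V \<in> E V"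
  unfolding E_def using restrict_germs_of restrict_closed by auto

lemma C0_restrict: "V \<subseteq> U \<Longrightarrow> c \<in> carrier (C0 U) \<Longrightarrow> restrict c V \<in> carrier (C0 V)"
  by (auto simp: prod_module_simps)

lemma C0_extensional: "c \<in> carrier (C0 U) \<Longrightarrow> c \<in> extensional U"
  by (auto simp: prod_module_simps PiE_def)

lemma C0_restrict_add:
  "V \<subseteq> U \<Longrightarrow> restrict (s \<oplus>\<^bsub>C0 U\<^esub> t) V = restrict s V \<oplus>\<^bsub>C0 V\<^esub> restrict t V"
  by (auto simp: prod_module_simps restrict_def fun_eq_iff)

lemma C0_add_apply: "x \<in> U \<Longrightarrow> (s \<oplus>\<^bsub>C0 U\<^esub> t) x = s x \<oplus>\<^bsub>stalk F x\<^esub> t x"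
  by (simp add: prod_module_simps)

text \<open>Local sections with the same germs have the same values, so the local witnesses are
  compatible and glue.\<close>

lemma E_local:
  assumes U: "U \<in> opens F" and c: "c \<in> extensional U"
    and loc: "\<And>x. x \<in> U \<Longrightarrow> \<exists>N\<in>opens F. x \<in> N \<and> N \<subseteq> U \<and> restrict c N \<in> E N"
  shows "c \<in> E U"
proof -
  have "\<forall>x\<in>U. \<exists>N f. N \<in> opens F \<and> x \<in> N \<and> N \<subseteq> U \<and> f \<in> carrier (sections F N) \<and> restrict c N = germs_of F N f"
    using loc unfolding E_def by fast
  then obtain N f where N: "\<And>x. x \<in> U \<Longrightarrow> N x \<in> opens F" "\<And>x. x \<in> U \<Longrightarrow> x \<in> N x" "\<And>x. x \<in> U \<Longrightarrow> N x \<subseteq> U"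
    and f: "\<And>x. x \<in> U \<Longrightarrow> f x \<in> carrier (sections F (N x))"
      "\<And>x. x \<in> U \<Longrightarrow> restrict c (N x) = germs_of F (N x) (f x)"
    by metis
  have cg: "c y = germ F y (N x) (f x)" if "x \<in> U" "y \<in> N x" for x y
    using fun_cong[OF f(2)[OF that(1)], of y] that(2) by (simp add: germs_of_def)
  \<comment> \<open>The glued section takes at x the value of the local section chosen for
    x.\<close>
  define g where "g = (\<lambda>x\<in>U. f x x)"
  have gf: "restrict g (N x) = f x" if x: "x \<in> U" for x
  proof (rule extensionalityI[of _ "N x"])
    show "f x \<in> extensional (N x)"
      using extensional N(1) f(1) x by blast
    fix y assume y: "y \<in> N x"
    then have yU: "y \<in> U" using N(3) x by blast
    have "f y y = f x y"
      using N f x y yU cg[OF yU N(2)[OF yU]] cg[OF x y] by (intro germ_eq_imp[of "N y" y _ "N x"]) auto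
    then show "restrict g (N x) y = f x y"
      using y yU by (simp add: g_def)
  qed auto
  have g: "g \<in> carrier (sections F U)"
  proof (rule glue[OF U])
    show "\<exists>M\<in>opens F. x \<in> M \<and> M \<subseteq> U \<and> restrict g M \<in> carrier (sections F M)" if "x \<in> U" for x
      using N[OF that] gf[OF that] f(1)[OF that] by metis
  qed (simp add: g_def)
  have "germs_of F U g = c"
  proof (rule extensionalityI[OF _ c])
    fix x assume x: "x \<in> U"
    have "germ F x U g = germ F x (N x) (restrict g (N x))"
      using germ_restr[of U "N x" x g] N[OF x] U g by (simp add: restr_eq)
    then show "germs_of F U g x = c x"
      using x cg[OF x N(2)[OF x]] gf[OF x] by (simp add: germs_of_def)
  qed (simp add: germs_of_def)
  then show ?thesis
    unfolding E_def using g by blast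
qed

section \<open>The quotient presheaf and the Godement differential\<close>

abbreviation "Q \<equiv> godement_quot F"

lemma Q_simps:
  "opens Q = opens F" "sections Q U = quot_module (C0 U) (E U)"
  "restr Q U V C = (\<Union>s\<in>C. E V +>\<^bsub>C0 V\<^esub> restrict s V)"
  by (simp_all add: godement_quot_def E_def)

lemma restr_Q:
  assumes "U \<in> opens F" "V \<in> opens F" "V \<subseteq> U" "s \<in> carrier (C0 U)"
  shows "restr Q U V (E U +>\<^bsub>C0 U\<^esub> s) = E V +>\<^bsub>C0 V\<^esub> restrict s V"
proof -
  interpret EU: bit_subspace "C0 U" "E U" by (rule E_subspace) fact
  interpret EV: bit_subspace "C0 V" "E V" by (rule E_subspace) fact
  have "E V +>\<^bsub>C0 V\<^esub> restrict t V = E V +>\<^bsub>C0 V\<^esub> restrict s V" if t: "t \<in> E U +>\<^bsub>C0 U\<^esub> s" for t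
  proof -
    obtain n where n: "n \<in> E U" "t = n \<oplus>\<^bsub>C0 U\<^esub> s"
      using t EU.mem_coset by auto
    have s: "restrict s V \<in> carrier (C0 V)" and nV: "restrict n V \<in> E V"
      using assms C0_restrict E_restrict n by auto
    have "restrict t V = restrict n V \<oplus>\<^bsub>C0 V\<^esub> restrict s V"
      unfolding n using C0_restrict_add assms(3) by simp
    then have "restrict t V \<oplus>\<^bsub>C0 V\<^esub> restrict s V = restrict n V"
      using s nV EV.sub EV.a_assoc[of "restrict n V" "restrict s V" "restrict s V"] EV.add_self[OF s] by auto
    then show ?thesis
      using s nV EV.sub \<open>restrict t V = _\<close> by (subst EV.coset_eq_iff) auto
  qed
  moreover have "s \<in> E U +>\<^bsub>C0 U\<^esub> s"
    unfolding EU.mem_coset using EU.zero_mem EU.l_zero[OF assms(4)] by force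
  ultimately show ?thesis
    unfolding Q_simps by blast
qed

lemma base_presheaf_Q: "base_presheaf Q"
proof (rule base_presheaf.intro, unfold Q_simps(1,2))
  show "bit_space (quot_module (C0 U) (E U))" if "U \<in> opens F" for U
    using bit_subspace.bit_space_quot[OF E_subspace[OF that]] .
next
  fix U V assume UV: "U \<in> opens F" "V \<in> opens F" "V \<subseteq> U"
  interpret EU: bit_subspace "C0 U" "E U" by (rule E_subspace) fact
  interpret EV: bit_subspace "C0 V" "E V" by (rule E_subspace) fact
  show "additive_map (quot_module (C0 U) (E U)) (quot_module (C0 V) (E V)) (restr Q U V)"
    unfolding additive_map_def
  proof (intro conjI ballI funcsetI)
    fix x assume "x \<in> carrier (quot_module (C0 U) (E U))"
    then obtain s where s: "x = E U +>\<^bsub>C0 U\<^esub> s" "s \<in> carrier (C0 U)"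
      unfolding EU.quot_module_simps by blast
    show "restr Q U V x \<in> carrier (quot_module (C0 V) (E V))"
      unfolding s restr_Q[OF UV s(2)] EV.quot_module_simps using C0_restrict[OF UV(3) s(2)] by blast
    fix y assume "y \<in> carrier (quot_module (C0 U) (E U))"
    then obtain t where t: "y = E U +>\<^bsub>C0 U\<^esub> t" "t \<in> carrier (C0 U)"
      unfolding EU.quot_module_simps by blast
    show "restr Q U V (x \<oplus>\<^bsub>quot_module (C0 U) (E U)\<^esub> y) = restr Q U V x \<oplus>\<^bsub>quot_module (C0 V) (E V)\<^esub> restr Q U V y"
      unfolding s t EU.quot_add[OF s(2) t(2)]
      using s t UV by (simp add: restr_Q EV.quot_add C0_restrict C0_restrict_add)
  qed
next
  fix U V W a assume UVW: "U \<in> opens F" "V \<in> opens F" "W \<in> opens F" "V \<subseteq> U" "W \<subseteq> V"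
    and a: "a \<in> carrier (quot_module (C0 U) (E U))"
  interpret EU: bit_subspace "C0 U" "E U" by (rule E_subspace) fact
  obtain s where s: "a = E U +>\<^bsub>C0 U\<^esub> s" "s \<in> carrier (C0 U)"
    using a unfolding EU.quot_module_simps by blast
  have "restrict (restrict s V) W = restrict s W"
    using UVW by (auto simp: restrict_def fun_eq_iff)
  then show "restr Q V W (restr Q U V a) = restr Q U W a"
    using UVW s C0_restrict[OF UVW(4) s(2)] by (simp add: restr_Q)
qed (rule base)

lemma coset_in_Q: "U \<in> opens F \<Longrightarrow> s \<in> carrier (C0 U) \<Longrightarrow> E U +>\<^bsub>C0 U\<^esub> s \<in> carrier (sections Q U)"
  using bit_subspace.quot_module_simps(1)[OF E_subspace] by (auto simp: Q_simps)

text \<open>The value at x of the Godement differential of s, for s over any open U;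
  \<open>godement_d_eq\<close> treats the case U = Y.\<close>

definition D where "D U s x = germ Q x U (E U +>\<^bsub>C0 U\<^esub> s)"

lemma D_restrict:
  assumes "U \<in> opens F" "V \<in> opens F" "V \<subseteq> U" "x \<in> V" "s \<in> carrier (C0 U)"
  shows "D V (restrict s V) x = D U s x"
  unfolding D_def restr_Q[OF assms(1-3,5), symmetric]
  by (rule base_presheaf.germ_restr[OF base_presheaf_Q]) (use assms coset_in_Q in \<open>auto simp: Q_simps(1)\<close>)

lemma D_closed: "\<lbrakk>U \<in> opens F; x \<in> U; s \<in> carrier (C0 U)\<rbrakk> \<Longrightarrow> D U s x \<in> carrier (stalk Q x)"
  unfolding D_def by (rule base_presheaf.germ_in_stalk[OF base_presheaf_Q]) (auto simp: Q_simps(1) coset_in_Q)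

lemma D_add:
  assumes "U \<in> opens F" "x \<in> U" "s \<in> carrier (C0 U)" "t \<in> carrier (C0 U)"
  shows "D U (s \<oplus>\<^bsub>C0 U\<^esub> t) x = D U s x \<oplus>\<^bsub>stalk Q x\<^esub> D U t x"
proof -
  interpret EU: bit_subspace "C0 U" "E U" by (rule E_subspace) fact
  show ?thesis
    unfolding D_def
    by (subst base_presheaf.stalk_add[OF base_presheaf_Q])
      (use assms coset_in_Q in \<open>auto simp: Q_simps(1,2) EU.quot_add\<close>)
qed

lemma bit_space_stalk_Q: "x \<in> Y \<Longrightarrow> bit_space (stalk Q x)"
  using base_presheaf.bit_space_stalk[OF base_presheaf_Q] by (simp add: Q_simps)

lemma zero_stalk_Q: "U \<in> opens F \<Longrightarrow> x \<in> U \<Longrightarrow> \<zero>\<^bsub>stalk Q x\<^esub> = germ Q x U (E U)"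
  using base_presheaf.stalk_zero[OF base_presheaf_Q, of U x] bit_subspace.quot_module_simps(2)[OF E_subspace, of U]
  by (simp add: Q_simps)

lemma D_E: "\<lbrakk>U \<in> opens F; x \<in> U; f \<in> E U\<rbrakk> \<Longrightarrow> D U f x = \<zero>\<^bsub>stalk Q x\<^esub>"
  unfolding D_def using bit_subspace.coset_mem[OF E_subspace] zero_stalk_Q by metis

text \<open>Exactness of the resolution at its first term: a vanishing germ in the quotient means
  that s is locally a section, and \<open>E_local\<close> globalises this.\<close>

lemma D_zero_imp_E:
  assumes U: "U \<in> opens F" and s: "s \<in> carrier (C0 U)" and z: "\<And>x. x \<in> U \<Longrightarrow> D U s x = \<zero>\<^bsub>stalk Q x\<^esub>"
  shows "s \<in> E U"
proof (rule E_local[OF U C0_extensional[OF s]])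
  interpret EU: bit_subspace "C0 U" "E U" by (rule E_subspace) fact
  fix x assume x: "x \<in> U"
  have "germ Q x U (E U +>\<^bsub>C0 U\<^esub> s) = germ Q x U (E U +>\<^bsub>C0 U\<^esub> \<zero>\<^bsub>C0 U\<^esub>)"
    using z[OF x] zero_stalk_Q[OF U x] by (simp add: D_def EU.coset_zero)
  then obtain N where N: "N \<in> opens F" "x \<in> N" "N \<subseteq> U"
    and eq: "restr Q U N (E U +>\<^bsub>C0 U\<^esub> s) = restr Q U N (E U +>\<^bsub>C0 U\<^esub> \<zero>\<^bsub>C0 U\<^esub>)"
    using base_presheaf.germ_eq_iff[OF base_presheaf_Q, of U x _ U] U x s coset_in_Q[OF U s] coset_in_Q[OF U EU.zero_closed]
    by (auto simp: Q_simps(1))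
  interpret EN: bit_subspace "C0 N" "E N" by (rule E_subspace) fact
  have "restrict \<zero>\<^bsub>C0 U\<^esub> N = \<zero>\<^bsub>C0 N\<^esub>"
    using N by (auto simp: prod_module_simps restrict_def fun_eq_iff)
  then have "E N +>\<^bsub>C0 N\<^esub> restrict s N = E N +>\<^bsub>C0 N\<^esub> \<zero>\<^bsub>C0 N\<^esub>"
    using eq U N s by (simp add: restr_Q)
  then have "restrict s N \<in> E N"
    using EN.coset_eq_iff[OF C0_restrict[OF N(3) s] EN.zero_closed] EN.r_zero[OF C0_restrict[OF N(3) s]] by simp
  then show "\<exists>N\<in>opens F. x \<in> N \<and> N \<subseteq> U \<and> restrict s N \<in> E N"
    using N by blast
qed

text \<open>s is a primitive of \<sigma> over U: a cochain whose coboundary is \<sigma>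
  there.\<close>

definition sol where
  "sol \<sigma> U s \<longleftrightarrow> U \<in> opens F \<and> s \<in> carrier (C0 U) \<and> (\<forall>x\<in>U. \<sigma> x = D U s x)"

lemma sol_restrict: "sol \<sigma> U s \<Longrightarrow> V \<in> opens F \<Longrightarrow> V \<subseteq> U \<Longrightarrow> sol \<sigma> V (restrict s V)"
  unfolding sol_def
proof (intro conjI ballI)
  assume s: "U \<in> opens F \<and> s \<in> carrier (C0 U) \<and> (\<forall>x\<in>U. \<sigma> x = D U s x)" and V: "V \<in> opens F" "V \<subseteq> U"
  then show "restrict s V \<in> carrier (C0 V)"
    using C0_restrict by blast
  fix x assume "x \<in> V"
  then show "\<sigma> x = D V (restrict s V) x"
    using s V by (subst D_restrict[of U]) auto
qed

text \<open>Two primitives have the same coboundary, so their difference, which is their sum here,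
  lies in the kernel of the differential.\<close>

lemma sol_diff:
  assumes "sol \<sigma> U s" "sol \<sigma> U t"
  shows "s \<oplus>\<^bsub>C0 U\<^esub> t \<in> E U"
proof -
  have U: "U \<in> opens F" and st: "s \<in> carrier (C0 U)" "t \<in> carrier (C0 U)"
    using assms by (auto simp: sol_def)
  interpret C: bit_space "C0 U" by (rule bit_space_C0) fact
  show ?thesis
  proof (rule D_zero_imp_E[OF U])
    fix x assume x: "x \<in> U"
    interpret S: bit_space "stalk Q x" by (rule bit_space_stalk_Q) (use x U in auto)
    have "D U s x = D U t x"
      using assms x by (auto simp: sol_def)
    then show "D U (s \<oplus>\<^bsub>C0 U\<^esub> t) x = \<zero>\<^bsub>stalk Q x\<^esub>"
      using U x st by (simp add: D_add S.add_self D_closed)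
  qed (use st in simp)
qed

lemma sol_add_E:
  assumes "sol \<sigma> U s" "f \<in> E U"
  shows "sol \<sigma> U (s \<oplus>\<^bsub>C0 U\<^esub> f)"
proof -
  have U: "U \<in> opens F" and s: "s \<in> carrier (C0 U)"
    using assms by (auto simp: sol_def)
  interpret EU: bit_subspace "C0 U" "E U" by (rule E_subspace) fact
  have f: "f \<in> carrier (C0 U)" using assms EU.sub by auto
  have "D U (s \<oplus>\<^bsub>C0 U\<^esub> f) x = D U s x" if x: "x \<in> U" for x
  proof -
    interpret S: bit_space "stalk Q x" by (rule bit_space_stalk_Q) (use x U in auto)
    show ?thesis
      using U x s f by (simp add: D_add D_E[OF U x assms(2)] D_closed)
  qed
  then show ?thesis
    using assms s f U by (auto simp: sol_def)
qed

text \<open>The differential at a point depends only on the cochain near it, so agreeing primitives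
  glue.\<close>

lemma sol_local:
  assumes W: "W \<in> opens F" and u: "u \<in> extensional W"
    and loc: "\<And>x. x \<in> W \<Longrightarrow> \<exists>N s. x \<in> N \<and> N \<subseteq> W \<and> sol \<sigma> N s \<and> (\<forall>y\<in>N. u y = s y)"
  shows "sol \<sigma> W u"
proof -
  have *: "\<exists>N. N \<in> opens F \<and> x \<in> N \<and> N \<subseteq> W \<and> sol \<sigma> N (restrict u N)" if x: "x \<in> W" for x
  proof -
    obtain N s where N: "x \<in> N" "N \<subseteq> W" "sol \<sigma> N s" "\<forall>y\<in>N. u y = s y"
      using loc[OF x] by blast
    then have "restrict u N = s"
      by (intro extensionalityI[of _ N]) (auto simp: sol_def intro: C0_extensional)
    with N show ?thesis by (auto simp: sol_def)
  qed
  have uC: "u \<in> carrier (C0 W)"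
    unfolding prod_module_simps
  proof (rule PiE_I)
    fix x assume "x \<in> W"
    then obtain N where "x \<in> N" "restrict u N \<in> carrier (C0 N)"
      using *[of x] unfolding sol_def by blast
    then show "u x \<in> carrier (stalk F x)"
      by (auto simp: prod_module_simps dest!: PiE_mem[of _ _ _ x])
  qed (use u in \<open>auto simp: extensional_def\<close>)
  have "\<sigma> x = D W u x" if x: "x \<in> W" for x
  proof -
    obtain N where "N \<in> opens F" "x \<in> N" "N \<subseteq> W" "sol \<sigma> N (restrict u N)"
      using *[OF x] by blast
    then show ?thesis
      using D_restrict[OF W _ _ _ uC] by (auto simp: sol_def)
  qed
  then show ?thesis
    using W uC by (auto simp: sol_def)
qed

text \<open>The two primitives differ on the overlap by a section. If it extends to V, adding the
  extension to t removes the discrepancy and the two glue.\<close>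

lemma sol_Un:
  assumes s: "sol \<sigma> U s" and t: "sol \<sigma> V t"
    and ext: "\<And>f. f \<in> E (U \<inter> V) \<Longrightarrow> \<exists>g\<in>E V. restrict g (U \<inter> V) = f"
  shows "\<exists>u. sol \<sigma> (U \<union> V) u"
proof -
  let ?I = "U \<inter> V"
  have op: "U \<in> opens F" "V \<in> opens F" "?I \<in> opens F" "U \<union> V \<in> opens F"
    using s t open_Int open_Union[of "{U, V}"] by (auto simp: sol_def)
  interpret EI: bit_subspace "C0 ?I" "E ?I" by (rule E_subspace) fact
  have rs: "sol \<sigma> ?I (restrict s ?I)" "sol \<sigma> ?I (restrict t ?I)"
    using sol_restrict s t op by auto
  then have c: "restrict s ?I \<in> carrier (C0 ?I)" "restrict t ?I \<in> carrier (C0 ?I)"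
    by (auto simp: sol_def)
  obtain g where g: "g \<in> E V" "restrict g ?I = restrict s ?I \<oplus>\<^bsub>C0 ?I\<^esub> restrict t ?I"
    using ext sol_diff[OF rs] by blast
  let ?t = "t \<oplus>\<^bsub>C0 V\<^esub> g"
  have t': "sol \<sigma> V ?t"
    using sol_add_E[OF t g(1)] .
  have "restrict ?t ?I = restrict t ?I \<oplus>\<^bsub>C0 ?I\<^esub> (restrict s ?I \<oplus>\<^bsub>C0 ?I\<^esub> restrict t ?I)"
    using C0_restrict_add[of ?I V t g] g by simp
  also have "\<dots> = restrict s ?I"
    using c by (metis EI.add_add_self EI.a_comm)
  finally have agree: "?t y = s y" if "y \<in> ?I" for y
    using that by (metis restrict_apply')
  have "sol \<sigma> (U \<union> V) (\<lambda>x\<in>U \<union> V. if x \<in> U then s x else ?t x)"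
  proof (rule sol_local[OF op(4)])
    fix x assume "x \<in> U \<union> V"
    then consider "x \<in> U" | "x \<in> V" by blast
    then show "\<exists>N r. x \<in> N \<and> N \<subseteq> U \<union> V \<and> sol \<sigma> N r \<and>
        (\<forall>y\<in>N. (\<lambda>x\<in>U \<union> V. if x \<in> U then s x else ?t x) y = r y)"
    proof cases
      case 1 then show ?thesis using s by (intro exI[of _ U] exI[of _ s]) auto
    next
      case 2 then show ?thesis using t' agree by (intro exI[of _ V] exI[of _ ?t]) auto
    qed
  qed simp
  then show ?thesis by blast
qed

lemma sol_disjoint_UN:
  assumes s: "\<And>j. j \<in> J \<Longrightarrow> sol \<sigma> (U j) (s j)"
    and disj: "\<And>i j. i \<in> J \<Longrightarrow> j \<in> J \<Longrightarrow> i \<noteq> j \<Longrightarrow> U i \<inter> U j = {}"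
  shows "\<exists>u. sol \<sigma> (\<Union>j\<in>J. U j) u"
proof -
  let ?u = "\<lambda>x\<in>\<Union>j\<in>J. U j. s (THE j. j \<in> J \<and> x \<in> U j) x"
  have "sol \<sigma> (\<Union>j\<in>J. U j) ?u"
  proof (rule sol_local)
    show "(\<Union>j\<in>J. U j) \<in> opens F"
      using s by (intro open_Union) (auto simp: sol_def)
    fix x assume "x \<in> (\<Union>j\<in>J. U j)"
    then obtain j where j: "j \<in> J" "x \<in> U j" by blast
    have "(THE j. j \<in> J \<and> y \<in> U j) = j" if "y \<in> U j" for y
      using that j disj by (intro the_equality) blast+
    then show "\<exists>N r. x \<in> N \<and> N \<subseteq> (\<Union>j\<in>J. U j) \<and> sol \<sigma> N r \<and> (\<forall>y\<in>N. ?u y = r y)"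
      using j s[OF j(1)] by (intro exI[of _ "U j"] exI[of _ "s j"]) auto
  qed simp
  then show ?thesis by blast
qed

section \<open>Global cocycles and their classes\<close>

abbreviation "Z1 \<equiv> sections (godement_cocycles F) Y"

lemma cocycles_eq: "godement_cocycles F = sheafify (opens F) Q"
  by (simp add: godement_cocycles_def)

lemma bit_space_Z1: "bit_space Z1"
  unfolding cocycles_eq
  by (rule base_presheaf.bit_space_sheafify[OF base_presheaf_Q Y_open]) (auto simp: Q_simps(1))

lemma Z1_add: "s \<oplus>\<^bsub>Z1\<^esub> t = (\<lambda>x\<in>Y. s x \<oplus>\<^bsub>stalk Q x\<^esub> t x)"
  unfolding cocycles_eq base_presheaf.sheafify_ops[OF base_presheaf_Q] ..

text \<open>A section of the sheafified quotient is locally the class of one cochain, which is a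
  primitive. \<open>Z1I\<close> is the converse.\<close>

lemma Z1_local:
  assumes "\<sigma> \<in> carrier Z1" "x \<in> Y"
  obtains N s where "x \<in> N" "sol \<sigma> N s"
proof -
  obtain N a where N: "N \<in> opens F" "x \<in> N" "a \<in> carrier (sections Q N)" "\<And>y. y \<in> N \<Longrightarrow> \<sigma> y = germ Q y N a"
    using base_presheaf.sheafifyE[OF base_presheaf_Q assms[unfolded cocycles_eq]] by (metis Q_simps(1))
  moreover obtain s where "s \<in> carrier (C0 N)" "a = E N +>\<^bsub>C0 N\<^esub> s"
    using N bit_subspace.quot_module_simps(1)[OF E_subspace[OF N(1)]] by (auto simp: Q_simps)
  ultimately show ?thesis
    by (intro that[of N s]) (auto simp: sol_def D_def)
qed

lemma Z1I:
  assumes "\<sigma> \<in> extensional Y" "\<And>x. x \<in> Y \<Longrightarrow> \<exists>N s. x \<in> N \<and> sol \<sigma> N s"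
  shows "\<sigma> \<in> carrier Z1"
  unfolding cocycles_eq base_presheaf.carrier_sheafify[OF base_presheaf_Q]
proof (intro CollectI conjI ballI PiE_I)
  fix x assume "x \<in> Y"
  then obtain N s where N: "x \<in> N" "sol \<sigma> N s"
    using assms(2) by blast
  then have op: "N \<in> opens F" and s: "s \<in> carrier (C0 N)" "\<And>y. y \<in> N \<Longrightarrow> \<sigma> y = D N s y"
    by (auto simp: sol_def)
  show "\<sigma> x \<in> carrier (stalk Q x)"
    using s(2)[OF N(1)] D_closed[OF op N(1) s(1)] by simp
  show "\<exists>N\<in>opens Q. x \<in> N \<and> N \<subseteq> Y \<and> (\<exists>a\<in>carrier (sections Q N). \<forall>y\<in>N. \<sigma> y = germ Q y N a)"
    using N op s coset_in_Q[OF op s(1)] unfolding Q_simps(1)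
    by (intro bexI[OF _ op] conjI bexI[of _ "E N +>\<^bsub>C0 N\<^esub> s"]) (auto simp: D_def)
qed (use assms(1) in \<open>auto simp: extensional_def\<close>)

lemma godement_d_eq: "godement_d F Y s = (\<lambda>x\<in>Y. D Y s x)"
  by (simp add: godement_d_def germs_of_def D_def E_def)

lemma sol_godement_d: "s \<in> carrier (C0 Y) \<Longrightarrow> sol (godement_d F Y s) Y s"
  unfolding sol_def godement_d_eq using Y_open by auto

lemma godement_d_additive: "additive_map (C0 Y) Z1 (godement_d F Y)"
  unfolding additive_map_def
proof (intro conjI ballI funcsetI)
  fix s assume s: "s \<in> carrier (C0 Y)"
  show "godement_d F Y s \<in> carrier Z1"
    by (rule Z1I) (use sol_godement_d[OF s] in \<open>auto simp: godement_d_eq\<close>)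
  fix t assume t: "t \<in> carrier (C0 Y)"
  show "godement_d F Y (s \<oplus>\<^bsub>C0 Y\<^esub> t) = godement_d F Y s \<oplus>\<^bsub>Z1\<^esub> godement_d F Y t"
    unfolding Z1_add godement_d_eq using D_add[OF Y_open _ s t] by (auto simp: fun_eq_iff restrict_def)
qed

lemma boundaries_subspace: "bit_subspace Z1 (godement_d F Y ` carrier (C0 Y))"
  by (rule bit_subspace_image[OF bit_space_C0[OF Y_open] bit_space_Z1 godement_d_additive])

lemma H1_eq: "H1 F = quot_module Z1 (godement_d F Y ` carrier (C0 Y))"
  by (simp add: H1_def Let_def)

lemma bit_space_H1: "bit_space (H1 F)"
  unfolding H1_eq by (rule bit_subspace.bit_space_quot[OF boundaries_subspace])

lemma card_E: "U \<in> opens F \<Longrightarrow> card (E U) = card (carrier (sections F U))"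
  unfolding E_def using inj_germs_of by (rule card_image)

abbreviation "E_space U \<equiv> (C0 U)\<lparr>carrier := E U\<rparr>"

lemma bit_space_E:
  assumes "U \<in> opens F"
  shows "bit_space (E_space U)"
proof -
  interpret EU: bit_subspace "C0 U" "E U" by (rule E_subspace) fact
  show ?thesis
    by (rule EU.bit_space_sub) (use EU.sub EU.zero_mem EU.add_mem in auto)
qed

section \<open>The connecting map of a cover by two open sets\<close>

context
  fixes B C :: "'x set"
  assumes B: "B \<in> opens F" and C: "C \<in> opens F" and cover: "B \<union> C = Y"
begin

text \<open>Extension by zero is possible because cochains are arbitrary families of germs.\<close>

definition ext0 where "ext0 t = (\<lambda>x\<in>B. if x \<in> C then t x else \<zero>\<^bsub>stalk F x\<^esub>)"

text \<open>The Mayer-Vietoris connecting map on cocycles: the coboundary of the zero extension of t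
  on B, and zero outside B.\<close>

definition connecting where
  "connecting t = (\<lambda>x\<in>Y. if x \<in> B then D B (ext0 t) x else \<zero>\<^bsub>stalk Q x\<^esub>)"

lemma BC_open: "B \<inter> C \<in> opens F"
  using open_Int B C .

lemma zero_stalk_closed: "x \<in> Y \<Longrightarrow> \<zero>\<^bsub>stalk F x\<^esub> \<in> carrier (stalk F x)"
  by (rule abelian_monoid.zero_closed) (use bit_space_stalk in \<open>auto simp: bit_space_def abelian_group_def\<close>)

lemma ext0_closed:
  assumes "t \<in> carrier (C0 (B \<inter> C))"
  shows "ext0 t \<in> carrier (C0 B)"
  unfolding prod_module_simps
proof (rule PiE_I)
  fix x assume x: "x \<in> B"
  then have "x \<in> Y" using cover by blast
  then show "ext0 t x \<in> carrier (stalk F x)"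
    using PiE_mem[OF assms[unfolded prod_module_simps], of x] zero_stalk_closed[of x] x by (simp add: ext0_def)
qed (simp add: ext0_def)

lemma restrict_ext0: "t \<in> carrier (C0 (B \<inter> C)) \<Longrightarrow> restrict (ext0 t) (B \<inter> C) = t"
  by (rule extensionalityI[OF _ C0_extensional]) (auto simp: ext0_def)

lemma sol_connecting_B:
  assumes "t \<in> carrier (C0 (B \<inter> C))"
  shows "sol (connecting t) B (ext0 t)"
  unfolding sol_def connecting_def using assms B cover ext0_closed by auto

text \<open>On the overlap the zero extension coincides with t, which is a section and so has zero
  coboundary. Hence the two clauses of \<open>connecting\<close> fit together on C.\<close>

lemma connecting_C:
  assumes t: "t \<in> E (B \<inter> C)" and x: "x \<in> C"
  shows "connecting t x = \<zero>\<^bsub>stalk Q x\<^esub>"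
proof (cases "x \<in> B")
  case True
  have tC: "t \<in> carrier (C0 (B \<inter> C))"
    using t bit_subspace.sub[OF E_subspace[OF BC_open]] by auto
  have "D B (ext0 t) x = D (B \<inter> C) t x"
    using D_restrict[OF B BC_open _ _ ext0_closed[OF tC], of x] x True by (simp add: restrict_ext0[OF tC])
  also have "\<dots> = \<zero>\<^bsub>stalk Q x\<^esub>"
    using D_E[OF BC_open _ t] x True by simp
  finally show ?thesis
    using True x cover by (auto simp: connecting_def)
qed (use x cover in \<open>auto simp: connecting_def\<close>)

lemma sol_connecting_C:
  assumes "t \<in> E (B \<inter> C)" "c \<in> E C"
  shows "sol (connecting t) C c"
  unfolding sol_def using C assms connecting_C D_E bit_subspace.sub[OF E_subspace[OF C]] by auto

lemma connecting_closed:
  assumes t: "t \<in> E (B \<inter> C)"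
  shows "connecting t \<in> carrier Z1"
proof (rule Z1I)
  have tC: "t \<in> carrier (C0 (B \<inter> C))"
    using t bit_subspace.sub[OF E_subspace[OF BC_open]] by auto
  fix x assume "x \<in> Y"
  then have "x \<in> B \<or> x \<in> C" using cover by blast
  then show "\<exists>N s. x \<in> N \<and> sol (connecting t) N s"
    using sol_connecting_B[OF tC] sol_connecting_C[OF t bit_subspace.zero_mem[OF E_subspace[OF C]]] by blast
qed (simp add: connecting_def)

lemma connecting_additive: "additive_map (E_space (B \<inter> C)) Z1 connecting"
  unfolding additive_map_def
proof (intro conjI ballI funcsetI)
  fix t assume "t \<in> carrier (E_space (B \<inter> C))"
  then have t: "t \<in> E (B \<inter> C)" by simp
  then show "connecting t \<in> carrier Z1" by (rule connecting_closed)
  fix u assume "u \<in> carrier (E_space (B \<inter> C))"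
  then have u: "u \<in> E (B \<inter> C)" by simp
  have tu: "t \<in> carrier (C0 (B \<inter> C))" "u \<in> carrier (C0 (B \<inter> C))"
    using t u bit_subspace.sub[OF E_subspace[OF BC_open]] by auto
  have stalk: "bit_space (stalk F x)" if "x \<in> Y" for x
    using bit_space_stalk that .
  have "ext0 (t \<oplus>\<^bsub>C0 (B \<inter> C)\<^esub> u) = ext0 t \<oplus>\<^bsub>C0 B\<^esub> ext0 u"
  proof (rule extensionalityI[of _ B])
    fix x assume x: "x \<in> B"
    then have "x \<in> Y" using cover by blast
    interpret S: bit_space "stalk F x" by (rule stalk) fact
    show "ext0 (t \<oplus>\<^bsub>C0 (B \<inter> C)\<^esub> u) x = (ext0 t \<oplus>\<^bsub>C0 B\<^esub> ext0 u) x"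
      using x by (auto simp: ext0_def C0_add_apply)
  qed (auto simp: ext0_def prod_module_simps)
  moreover have "\<zero>\<^bsub>stalk Q x\<^esub> = \<zero>\<^bsub>stalk Q x\<^esub> \<oplus>\<^bsub>stalk Q x\<^esub> \<zero>\<^bsub>stalk Q x\<^esub>" if "x \<in> Y" for x
  proof -
    interpret S: bit_space "stalk Q x" by (rule bit_space_stalk_Q) fact
    show ?thesis by simp
  qed
  ultimately show "connecting (t \<oplus>\<^bsub>E_space (B \<inter> C)\<^esub> u) = connecting t \<oplus>\<^bsub>Z1\<^esub> connecting u"
    using D_add[OF B _ ext0_closed[OF tu(1)] ext0_closed[OF tu(2)]]
    by (intro extensionalityI[of _ Y]) (simp_all add: connecting_def Z1_add)
qed

text \<open>Let t be the disagreement of b and c on the overlap. After subtracting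
  \<open>ext0 t\<close>, the cochain b agrees with c there, so the two glue to a global primitive of
  the corrected cocycle.\<close>

lemma connecting_surj:
  assumes \<sigma>: "\<sigma> \<in> carrier Z1" and b: "sol \<sigma> B b" and c: "sol \<sigma> C c"
  shows "\<exists>t\<in>E (B \<inter> C). \<exists>s\<in>carrier (C0 Y). \<sigma> \<oplus>\<^bsub>Z1\<^esub> connecting t = godement_d F Y s"
proof -
  let ?I = "B \<inter> C"
  interpret EI: bit_subspace "C0 ?I" "E ?I" by (rule E_subspace[OF BC_open])
  interpret CB: bit_space "C0 B" by (rule bit_space_C0[OF B])
  have rs: "sol \<sigma> ?I (restrict b ?I)" "sol \<sigma> ?I (restrict c ?I)"
    using sol_restrict[OF b BC_open] sol_restrict[OF c BC_open] by auto
  define t where "t = restrict b ?I \<oplus>\<^bsub>C0 ?I\<^esub> restrict c ?I"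
  have t: "t \<in> E ?I"
    unfolding t_def by (rule sol_diff[OF rs])
  then have tC: "t \<in> carrier (C0 ?I)" using EI.sub by auto
  let ?b = "b \<oplus>\<^bsub>C0 B\<^esub> ext0 t"
  have bC: "b \<in> carrier (C0 B)" and cC: "c \<in> carrier (C0 C)"
    using b c by (auto simp: sol_def)
  let ?\<tau> = "\<sigma> \<oplus>\<^bsub>Z1\<^esub> connecting t"
  have \<tau>B: "sol ?\<tau> B ?b"
    unfolding sol_def
  proof (intro conjI ballI)
    show "?b \<in> carrier (C0 B)"
      using bC ext0_closed[OF tC] by simp
    fix x assume x: "x \<in> B"
    then have "x \<in> Y" using cover by blast
    then show "?\<tau> x = D B ?b x"
      using x b by (simp add: Z1_add D_add[OF B x bC ext0_closed[OF tC]] sol_def connecting_def)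
  qed (rule B)
  have \<tau>C: "sol ?\<tau> C c"
    unfolding sol_def
  proof (intro conjI ballI)
    fix x assume x: "x \<in> C"
    then have xY: "x \<in> Y" using cover by blast
    interpret S: bit_space "stalk Q x" by (rule bit_space_stalk_Q) fact
    show "?\<tau> x = D C c x"
      using xY x c connecting_C[OF t x] D_closed[OF C x cC] by (simp add: Z1_add sol_def)
  qed (use C cC in auto)
  have agree: "?b x = c x" if x: "x \<in> ?I" for x
  proof -
    interpret S: bit_space "stalk F x" by (rule bit_space_stalk) (use x B in auto)
    have "b x \<in> carrier (stalk F x)" "c x \<in> carrier (stalk F x)"
      using bC cC x by (auto simp: prod_module_simps)
    then show ?thesis
      using x by (auto simp: C0_add_apply ext0_def t_def S.add_add_self)
  qed
  define s where "s = (\<lambda>x\<in>Y. if x \<in> C then c x else ?b x)"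
  have sol: "sol ?\<tau> Y s"
  proof (rule sol_local[OF Y_open])
    fix x assume "x \<in> Y"
    then consider "x \<in> C" | "x \<in> B" using cover by blast
    then show "\<exists>N r. x \<in> N \<and> N \<subseteq> Y \<and> sol ?\<tau> N r \<and> (\<forall>y\<in>N. s y = r y)"
    proof cases
      case 1
      then show ?thesis using \<tau>C C by (intro exI[of _ C] exI[of _ c]) (auto simp: s_def)
    next
      case 2
      then show ?thesis using \<tau>B B agree by (intro exI[of _ B] exI[of _ ?b]) (auto simp: s_def)
    qed
  qed (simp add: s_def)
  have "?\<tau> = godement_d F Y s"
    using sol unfolding godement_d_eq sol_def by (intro extensionalityI[of _ Y]) (auto simp: Z1_add)
  with t sol show ?thesis
    by (auto simp: sol_def)
qed

text \<open>The kernel of the connecting map is the image of the difference map. Both directions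
  compare a global primitive with the known primitives \<open>ext0 t\<close> on B and sections on
  C.\<close>

lemma connecting_boundary_iff:
  assumes t: "t \<in> E (B \<inter> C)"
  shows "connecting t \<in> godement_d F Y ` carrier (C0 Y) \<longleftrightarrow>
    (\<exists>b\<in>E B. \<exists>c\<in>E C. t = restrict b (B \<inter> C) \<oplus>\<^bsub>C0 (B \<inter> C)\<^esub> restrict c (B \<inter> C))"
proof
  let ?I = "B \<inter> C"
  interpret EI: bit_subspace "C0 ?I" "E ?I" by (rule E_subspace[OF BC_open])
  interpret EC: bit_subspace "C0 C" "E C" by (rule E_subspace[OF C])
  interpret EB: bit_subspace "C0 B" "E B" by (rule E_subspace[OF B])
  have tC: "t \<in> carrier (C0 ?I)" using EI.sub t by auto
  {
    assume "connecting t \<in> godement_d F Y ` carrier (C0 Y)"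
    then obtain s where "connecting t = godement_d F Y s" "s \<in> carrier (C0 Y)"
      by blast
    then have s: "s \<in> carrier (C0 Y)" "sol (connecting t) Y s"
      using sol_godement_d[of s] by simp_all
    have "sol (connecting t) C (restrict s C)" "sol (connecting t) B (restrict s B)"
      using sol_restrict[OF s(2)] B C by auto
    \<comment> \<open>On C the zero cochain is a primitive of \<open>connecting t\<close>, on B so
      is \<open>ext0 t\<close>; the global primitive s differs from each of them by a
      section.\<close>
    then have c: "restrict s C \<oplus>\<^bsub>C0 C\<^esub> \<zero>\<^bsub>C0 C\<^esub> \<in> E C" and b: "ext0 t \<oplus>\<^bsub>C0 B\<^esub> restrict s B \<in> E B"
      using sol_diff sol_connecting_C[OF t EC.zero_mem] sol_connecting_B[OF tC] by blast+
    have sC: "restrict s C \<in> E C"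
      using c C0_restrict[of C Y s] C s EC.r_zero by force
    have sI: "restrict s ?I \<in> carrier (C0 ?I)"
      using C0_restrict[of ?I Y s] B s by auto
    have "restrict (ext0 t \<oplus>\<^bsub>C0 B\<^esub> restrict s B) ?I = t \<oplus>\<^bsub>C0 ?I\<^esub> restrict s ?I"
      by (simp add: C0_restrict_add restrict_ext0[OF tC] Int_absorb1)
    moreover have "restrict (restrict s C) ?I = restrict s ?I"
      by (simp add: Int_absorb1)
    ultimately have "t = restrict (ext0 t \<oplus>\<^bsub>C0 B\<^esub> restrict s B) ?I \<oplus>\<^bsub>C0 ?I\<^esub> restrict (restrict s C) ?I"
      using tC sI by (simp add: EI.a_assoc EI.add_self)
    then show "\<exists>b\<in>E B. \<exists>c\<in>E C. t = restrict b ?I \<oplus>\<^bsub>C0 ?I\<^esub> restrict c ?I"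
      using b sC by blast
  next
    assume "\<exists>b\<in>E B. \<exists>c\<in>E C. t = restrict b ?I \<oplus>\<^bsub>C0 ?I\<^esub> restrict c ?I"
    then obtain b c where bc: "b \<in> E B" "c \<in> E C" and t_eq: "t = restrict b ?I \<oplus>\<^bsub>C0 ?I\<^esub> restrict c ?I"
      by blast
    have bC: "b \<in> carrier (C0 B)" "c \<in> carrier (C0 C)"
      using bc EB.sub EC.sub by auto
    \<comment> \<open>On B this is \<open>ext0 t\<close> plus b: off C the extension is zero, and on
      the overlap t = b + c gives t + b = c.\<close>
    define s where "s = (\<lambda>x\<in>Y. if x \<in> C then c x else b x)"
    have b': "sol (connecting t) B (ext0 t \<oplus>\<^bsub>C0 B\<^esub> b)"
      by (rule sol_add_E[OF sol_connecting_B[OF tC] bc(1)])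
    have agree: "s x = (ext0 t \<oplus>\<^bsub>C0 B\<^esub> b) x" if x: "x \<in> B" for x
    proof -
      have xY: "x \<in> Y" using x B by blast
      interpret S: bit_space "stalk F x" by (rule bit_space_stalk) fact
      have bx: "b x \<in> carrier (stalk F x)"
        using bC x by (auto simp: prod_module_simps)
      show ?thesis
      proof (cases "x \<in> C")
        case True
        have cx: "c x \<in> carrier (stalk F x)"
          using bC True by (auto simp: prod_module_simps)
        have "b x \<oplus>\<^bsub>stalk F x\<^esub> c x \<oplus>\<^bsub>stalk F x\<^esub> b x = c x"
          using bx cx by (metis S.a_comm S.a_closed S.add_add_self)
        then show ?thesis
          using True x xY by (simp add: s_def C0_add_apply ext0_def t_eq)
      next
        case False
        then show ?thesis
          using x xY bx by (simp add: s_def C0_add_apply ext0_def)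
      qed
    qed
    have "sol (connecting t) Y s"
    proof (rule sol_local[OF Y_open])
      fix x assume "x \<in> Y"
      then consider "x \<in> C" | "x \<in> B" using cover by blast
      then show "\<exists>N r. x \<in> N \<and> N \<subseteq> Y \<and> sol (connecting t) N r \<and> (\<forall>y\<in>N. s y = r y)"
      proof cases
        case 1
        then show ?thesis using sol_connecting_C[OF t bc(2)] C by (intro exI[of _ C] exI[of _ c]) (auto simp: s_def)
      next
        case 2
        then show ?thesis using b' B agree by (intro exI[of _ B] exI) auto
      qed
    qed (simp add: s_def)
    then have s: "s \<in> carrier (C0 Y)" "\<And>x. x \<in> Y \<Longrightarrow> connecting t x = D Y s x"
      unfolding sol_def by blast+
    have "connecting t = godement_d F Y s"
    proof (rule extensionalityI[of _ Y])
      show "connecting t x = godement_d F Y s x" if "x \<in> Y" for x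
        using s(2)[OF that] that by (simp add: godement_d_eq)
    qed (simp_all add: connecting_def godement_d_eq)
    then show "connecting t \<in> godement_d F Y ` carrier (C0 Y)"
      using s(1) by blast
  }
qed

text \<open>The sheaf condition for the cover by B and C, read as a count.\<close>

lemma card_glued_pairs:
  "card {(b, c) \<in> E B \<times> E C. restrict b (B \<inter> C) = restrict c (B \<inter> C)} = card (E Y)"
proof -
  let ?f = "\<lambda>e. (restrict e B, restrict e C)"
  have "bij_betw ?f (E Y) {(b, c) \<in> E B \<times> E C. restrict b (B \<inter> C) = restrict c (B \<inter> C)}"
    unfolding bij_betw_def
  proof
    show "inj_on ?f (E Y)"
    proof (rule inj_onI)
      fix e e' assume e: "e \<in> E Y" "e' \<in> E Y" and eq: "?f e = ?f e'"
      have ee: "e \<in> extensional Y" "e' \<in> extensional Y"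
        using e by (auto simp: E_def germs_of_def)
      show "e = e'"
      proof (rule extensionalityI[OF ee])
        fix x assume "x \<in> Y"
        then have "x \<in> B \<or> x \<in> C" using cover by blast
        then show "e x = e' x"
          using eq by (metis prod.inject restrict_apply')
      qed
    qed
    show "?f ` E Y = {(b, c) \<in> E B \<times> E C. restrict b (B \<inter> C) = restrict c (B \<inter> C)}"
    proof (intro equalityI subsetI)
      fix p assume "p \<in> ?f ` E Y"
      then obtain e where "e \<in> E Y" "p = ?f e" by blast
      moreover have "B \<subseteq> Y" "C \<subseteq> Y" using B C by auto
      ultimately show "p \<in> {(b, c) \<in> E B \<times> E C. restrict b (B \<inter> C) = restrict c (B \<inter> C)}"
        using E_restrict[OF Y_open B] E_restrict[OF Y_open C] by (auto simp: Int_absorb1)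
    next
      fix p assume "p \<in> {(b, c) \<in> E B \<times> E C. restrict b (B \<inter> C) = restrict c (B \<inter> C)}"
      then obtain b c where p: "p = (b, c)" and bc: "b \<in> E B" "c \<in> E C"
        and eq: "restrict b (B \<inter> C) = restrict c (B \<inter> C)" by blast
      have bce: "b \<in> extensional B" "c \<in> extensional C"
        using bc by (auto simp: E_def germs_of_def)
      define e where "e = (\<lambda>x\<in>Y. if x \<in> B then b x else c x)"
      have BY: "x \<in> Y" if "x \<in> B \<or> x \<in> C" for x
        using that cover by blast
      have "b x = c x" if "x \<in> B" "x \<in> C" for x
        using that fun_cong[OF eq, of x] by simp
      then have rB: "restrict e B = b" and rC: "restrict e C = c"
        using BY by (auto intro!: extensionalityI[OF _ bce(1)] extensionalityI[OF _ bce(2)] simp: e_def simp del: Union_iff split: if_splits)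
      have "e \<in> E Y"
      proof (rule E_local[OF Y_open])
        show "\<exists>N\<in>opens F. x \<in> N \<and> N \<subseteq> Y \<and> restrict e N \<in> E N" if "x \<in> Y" for x
          using that B C bc rB rC cover by (metis Sup_upper UnE)
      qed (simp add: e_def)
      then show "p \<in> ?f ` E Y"
        using rB rC p by blast
    qed
  qed
  then show ?thesis
    by (rule bij_betw_same_card[symmetric])
qed

text \<open>The exact sequence 0 -> F(Y) -> F(B) + F(C) -> F(B \<inter> C) -> H^1 -> 0, where
  exactness at the end needs primitives on B and on C. \<open>card_image_kernel\<close> is applied
  to its two middle maps, and the size of the image of the difference map is eliminated.\<close>

lemma card_H1:
  assumes sol: "\<And>\<sigma>. \<sigma> \<in> carrier Z1 \<Longrightarrow> \<exists>s. sol \<sigma> B s" "\<And>\<sigma>. \<sigma> \<in> carrier Z1 \<Longrightarrow> \<exists>s. sol \<sigma> C s"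
    and fin: "finite (carrier (sections F B))" "finite (carrier (sections F C))" "finite (carrier (sections F (B \<inter> C)))"
  shows "finite (carrier (H1 F))"
    and "card (carrier (H1 F)) * (card (carrier (sections F B)) * card (carrier (sections F C))) =
      card (carrier (sections F Y)) * card (carrier (sections F (B \<inter> C)))"
proof -
  let ?I = "B \<inter> C"
  interpret EI: bit_subspace "C0 ?I" "E ?I" by (rule E_subspace[OF BC_open])
  interpret EC: bit_subspace "C0 C" "E C" by (rule E_subspace[OF C])
  interpret EB: bit_subspace "C0 B" "E B" by (rule E_subspace[OF B])
  let ?im = "godement_d F Y ` carrier (C0 Y)"
  interpret Z: bit_subspace Z1 ?im by (rule boundaries_subspace)
  have finE: "finite (E B)" "finite (E C)" "finite (E ?I)"
    unfolding E_def using fin by auto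
  let ?\<Phi> = "\<lambda>t. ?im +>\<^bsub>Z1\<^esub> connecting t"
  have \<Phi>: "additive_map (E_space ?I) (H1 F) ?\<Phi>"
    unfolding additive_map_def
  proof (intro conjI ballI funcsetI)
    fix t assume t: "t \<in> carrier (E_space ?I)"
    then have ct: "connecting t \<in> carrier Z1" using connecting_closed by simp
    then show "?\<Phi> t \<in> carrier (H1 F)"
      unfolding H1_eq Z.quot_module_simps by blast
    fix u assume u: "u \<in> carrier (E_space ?I)"
    then have cu: "connecting u \<in> carrier Z1" using connecting_closed by simp
    show "?\<Phi> (t \<oplus>\<^bsub>E_space ?I\<^esub> u) = ?\<Phi> t \<oplus>\<^bsub>H1 F\<^esub> ?\<Phi> u"
      using additive_add[OF connecting_additive t u] by (simp add: H1_eq Z.quot_add[OF ct cu])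
  qed
  have surj: "?\<Phi> ` carrier (E_space ?I) = carrier (H1 F)"
  proof
    show "?\<Phi> ` carrier (E_space ?I) \<subseteq> carrier (H1 F)"
      using additive_closed[OF \<Phi>] by blast
    show "carrier (H1 F) \<subseteq> ?\<Phi> ` carrier (E_space ?I)"
    proof
      fix h assume "h \<in> carrier (H1 F)"
      then obtain \<sigma> where h: "h = ?im +>\<^bsub>Z1\<^esub> \<sigma>" and \<sigma>: "\<sigma> \<in> carrier Z1"
        unfolding H1_eq Z.quot_module_simps by blast
      obtain t where "t \<in> E ?I" "\<sigma> \<oplus>\<^bsub>Z1\<^esub> connecting t \<in> ?im"
        using connecting_surj[OF \<sigma>] sol[OF \<sigma>] by blast
      then show "h \<in> ?\<Phi> ` carrier (E_space ?I)"
        using Z.coset_eq_iff[OF \<sigma> connecting_closed] h by auto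
    qed
  qed
  moreover have "finite (?\<Phi> ` carrier (E_space ?I))"
    using finE(3) by simp
  ultimately show "finite (carrier (H1 F))"
    by metis
  \<comment> \<open>The difference map of the cover: its kernel counts the sections over Y, its
    image is the kernel of the connecting map into cohomology.\<close>
  let ?g = "\<lambda>(b, c). restrict b ?I \<oplus>\<^bsub>C0 ?I\<^esub> restrict c ?I"
  let ?EBC = "dir_sum (E_space B) (E_space C)"
  have cEBC: "carrier ?EBC = E B \<times> E C"
    by (simp add: dir_sum_def mk_module_def)
  have rI: "restrict b ?I \<in> E ?I" if "b \<in> E B" for b
    using E_restrict[OF B BC_open _ that] by auto
  have rI': "restrict c ?I \<in> E ?I" if "c \<in> E C" for c
    using E_restrict[OF C BC_open _ that] by auto
  have g: "additive_map ?EBC (E_space ?I) ?g"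
    unfolding additive_map_def cEBC
  proof (intro conjI ballI funcsetI)
    fix p q assume "p \<in> E B \<times> E C" "q \<in> E B \<times> E C"
    then obtain b c b' c' where p: "p = (b, c)" "b \<in> E B" "c \<in> E C" and q: "q = (b', c')" "b' \<in> E B" "c' \<in> E C"
      by blast
    then have "restrict b ?I \<in> carrier (C0 ?I)" "restrict b' ?I \<in> carrier (C0 ?I)"
      "restrict c ?I \<in> carrier (C0 ?I)" "restrict c' ?I \<in> carrier (C0 ?I)"
      using rI rI' EI.sub by auto
    then show "?g (p \<oplus>\<^bsub>?EBC\<^esub> q) = ?g p \<oplus>\<^bsub>E_space ?I\<^esub> ?g q"
      unfolding p q by (simp add: dir_sum_def mk_module_def C0_restrict_add EI.a_ac)
  next
    show "?g p \<in> carrier (E_space ?I)" if "p \<in> E B \<times> E C" for p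
      using that rI rI' EI.add_mem by auto
  qed
  have "{t \<in> carrier (E_space ?I). ?\<Phi> t = \<zero>\<^bsub>H1 F\<^esub>} = ?g ` carrier ?EBC"
  proof -
    have "?\<Phi> t = \<zero>\<^bsub>H1 F\<^esub> \<longleftrightarrow> connecting t \<in> ?im" if t: "t \<in> E ?I" for t
      using Z.coset_eq_iff[OF connecting_closed[OF t] Z.zero_closed] connecting_closed[OF t]
      by (simp add: H1_eq Z.quot_module_simps Z.coset_zero)
    then have "{t \<in> carrier (E_space ?I). ?\<Phi> t = \<zero>\<^bsub>H1 F\<^esub>} =
        {t \<in> E ?I. \<exists>b\<in>E B. \<exists>c\<in>E C. t = restrict b ?I \<oplus>\<^bsub>C0 ?I\<^esub> restrict c ?I}"
      using connecting_boundary_iff by auto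
    also have "\<dots> = ?g ` carrier ?EBC"
      unfolding cEBC using rI rI' EI.add_mem by (auto simp: image_iff)
    finally show ?thesis .
  qed
  then have "card (E ?I) = card (carrier (H1 F)) * card (?g ` carrier ?EBC)"
    using card_image_kernel[OF bit_space_E[OF BC_open] bit_space_H1 \<Phi>] finE surj by simp
  moreover have "card (E B) * card (E C) = card (?g ` carrier ?EBC) * card (E Y)"
  proof -
    have "{p \<in> carrier ?EBC. ?g p = \<zero>\<^bsub>E_space ?I\<^esub>} =
        {(b, c) \<in> E B \<times> E C. restrict b ?I = restrict c ?I}"
      unfolding cEBC using rI rI' EI.sub EI.add_eq_zero by (auto simp: subset_iff)
    then show ?thesis
      using card_image_kernel[OF bit_space_dir_sum[OF bit_space_E[OF B] bit_space_E[OF C]] bit_space_E[OF BC_open] g]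
        finE card_glued_pairs by (simp add: cEBC card_cartesian_product)
  qed
  ultimately show "card (carrier (H1 F)) * (card (carrier (sections F B)) * card (carrier (sections F C))) =
      card (carrier (sections F Y)) * card (carrier (sections F ?I))"
    by (simp add: card_E[OF B, symmetric] card_E[OF C, symmetric] card_E[OF BC_open, symmetric] card_E[OF Y_open, symmetric] algebra_simps)
qed

end

end

section \<open>Topology of the graph\<close>

lemma in_edge_seg [simp]: "Edg e t \<in> edge_seg e' p q \<longleftrightarrow> e = e' \<and> p < t \<and> t < q" "Vtx v \<notin> edge_seg e' p q"
  by (auto simp: edge_seg_def)

locale circuit_graph =
  fixes G :: "('v, 'e) circuit"
  assumes circuit: "logic_circuit G"
begin

lemma finite_verts: "finite (verts G)" and finite_edges: "finite (edges G)"
  using circuit by (auto simp: logic_circuit_def)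

lemma src_in_verts: "e \<in> edges G \<Longrightarrow> src G e = Some v \<Longrightarrow> v \<in> verts G"
  and tgt_in_verts: "e \<in> edges G \<Longrightarrow> tgt G e = Some v \<Longrightarrow> v \<in> verts G"
  using circuit by (auto simp: logic_circuit_def)

abbreviation "\<T> \<equiv> graph_top G"

abbreviation "pull e U \<equiv> {t \<in> edge_dom G e. edge_map G e t \<in> U}"

lemma open_iff:
  "openin \<T> U \<longleftrightarrow> U \<subseteq> graph_points G \<and> (\<forall>e\<in>edges G. openin (top_of_set (edge_dom G e)) (pull e U))"
  by (simp add: openin_graph_top graph_open_def)

lemma edge_dom_bounds: "t \<in> edge_dom G e \<Longrightarrow> 0 \<le> t \<and> t \<le> 1"
  by (auto simp: edge_dom_def split: if_splits)

lemma inner_in_edge_dom: "0 < t \<Longrightarrow> t < 1 \<Longrightarrow> t \<in> edge_dom G e"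
  by (auto simp: edge_dom_def)

lemma edge_map_inner: "0 < t \<Longrightarrow> t < 1 \<Longrightarrow> edge_map G e t = Edg e t"
  by (auto simp: edge_map_def)

lemma edge_map_in_points: "e \<in> edges G \<Longrightarrow> t \<in> edge_dom G e \<Longrightarrow> edge_map G e t \<in> graph_points G"
  using src_in_verts tgt_in_verts
  by (auto simp: edge_dom_def edge_map_def graph_points_def split: if_splits)

lemma Edg_in_points: "Edg e t \<in> graph_points G \<longleftrightarrow> e \<in> edges G \<and> 0 < t \<and> t < 1"
  and Vtx_in_points: "Vtx v \<in> graph_points G \<longleftrightarrow> v \<in> verts G"
  by (auto simp: graph_points_def)

lemma open_points: "openin \<T> (graph_points G)"
  unfolding open_iff
proof (intro conjI ballI)
  fix e assume e: "e \<in> edges G"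
  then have "pull e (graph_points G) = edge_dom G e"
    using edge_map_in_points by auto
  then show "openin (top_of_set (edge_dom G e)) (pull e (graph_points G))"
    by simp
qed simp

lemma topspace_graph: "topspace \<T> = graph_points G"
  using open_points openin_subset[of \<T>] open_iff by (metis openin_topspace subset_antisym)

lemma open_Edg_image:
  assumes e: "e \<in> edges G" and N: "open N" "N \<subseteq> {0<..<1}"
  shows "openin \<T> (Edg e ` N)"
  unfolding open_iff
proof (intro conjI ballI)
  show "Edg e ` N \<subseteq> graph_points G"
    using e N(2) by (auto simp: graph_points_def edge_seg_def)
  fix e' assume "e' \<in> edges G"
  have "t \<in> pull e' (Edg e ` N) \<longleftrightarrow> e' = e \<and> t \<in> N" for t
    using N(2) by (auto simp: edge_map_def inner_in_edge_dom subset_iff)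
  then have "pull e' (Edg e ` N) = (if e' = e then N else {})"
    by auto
  moreover have "N \<subseteq> edge_dom G e"
    using N(2) by (auto simp: edge_dom_def)
  ultimately show "openin (top_of_set (edge_dom G e')) (pull e' (Edg e ` N))"
    using N(1) by (auto simp: open_subset)
qed

lemma open_edge_seg: "e \<in> edges G \<Longrightarrow> 0 \<le> p \<Longrightarrow> q \<le> 1 \<Longrightarrow> openin \<T> (edge_seg e p q)"
  unfolding edge_seg_def by (rule open_Edg_image) auto

lemma continuous_edge_map:
  assumes "e \<in> edges G"
  shows "continuous_map (top_of_set (edge_dom G e)) \<T> (edge_map G e)"
  unfolding continuous_map
  using assms edge_map_in_points by (auto simp: topspace_graph open_iff)

text \<open>The universal property of the quotient topology.\<close>

lemma continuous_map_from_graph: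
  assumes f: "\<And>x. x \<in> graph_points G \<Longrightarrow> f x \<in> topspace Z"
    and e: "\<And>e. e \<in> edges G \<Longrightarrow> continuous_map (top_of_set (edge_dom G e)) Z (\<lambda>t. f (edge_map G e t))"
  shows "continuous_map \<T> Z f"
  unfolding continuous_map
proof (intro conjI allI impI)
  show "f ` topspace \<T> \<subseteq> topspace Z"
    using f by (auto simp: topspace_graph)
  fix V assume V: "openin Z V"
  show "openin \<T> {x \<in> topspace \<T>. f x \<in> V}"
    unfolding open_iff
  proof (intro conjI ballI)
    fix e assume eG: "e \<in> edges G"
    have "pull e {x \<in> topspace \<T>. f x \<in> V} = {t \<in> topspace (top_of_set (edge_dom G e)). f (edge_map G e t) \<in> V}"
      using edge_map_in_points[OF eG] by (auto simp: topspace_graph)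
    then show "openin (top_of_set (edge_dom G e)) (pull e {x \<in> topspace \<T>. f x \<in> V})"
      using openin_continuous_map_preimage[OF e[OF eG] V] by simp
  qed (auto simp: topspace_graph)
qed

lemma edge_seg_nbhd:
  assumes U: "openin \<T> U" and x: "Edg e t \<in> U"
  obtains r where "0 < r" "0 \<le> t - r" "t + r \<le> 1" "edge_seg e (t - r) (t + r) \<subseteq> U"
proof -
  have "Edg e t \<in> graph_points G"
    using assms unfolding open_iff by blast
  then have e: "e \<in> edges G" and t: "0 < t" "t < 1"
    by (auto simp: Edg_in_points)
  then have "openin (top_of_set (edge_dom G e)) (pull e U)"
    using U open_iff by blast
  then obtain N where N: "open N" "pull e U = edge_dom G e \<inter> N"
    unfolding openin_open by blast
  have "t \<in> N"
    using N(2) x t inner_in_edge_dom edge_map_inner by force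
  then obtain r where r: "r > 0" "ball t r \<subseteq> N"
    using N(1) openE by blast
  let ?r = "min r (min t (1 - t))"
  have "edge_seg e (t - ?r) (t + ?r) \<subseteq> U"
  proof
    fix y :: "('v, 'e) point" assume "y \<in> edge_seg e (t - ?r) (t + ?r)"
    then obtain s where s: "y = Edg e s" "t - ?r < s" "s < t + ?r"
      by (auto simp: edge_seg_def)
    then have s': "0 < s" "s < 1" "\<bar>s - t\<bar> < r"
      by (auto simp: min_def split: if_splits)
    then have "s \<in> edge_dom G e \<inter> N"
      using r(2) inner_in_edge_dom by (auto simp: dist_real_def)
    then have "edge_map G e s \<in> U"
      unfolding N(2)[symmetric] by blast
    then show "y \<in> U"
      using s' s(1) edge_map_inner by simp
  qed
  then show ?thesis
    using r t by (intro that[of ?r]) auto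
qed

section \<open>Round stars of vertices: they form a neighbourhood base and are contractible\<close>

definition star :: "'v \<Rightarrow> real \<Rightarrow> ('v, 'e) point set" where
  "star v r = insert (Vtx v) ((\<Union>e\<in>{e \<in> edges G. src G e = Some v}. edge_seg e 0 r) \<union>
     (\<Union>e\<in>{e \<in> edges G. tgt G e = Some v}. edge_seg e (1 - r) 1))"

lemma Vtx_in_star [simp]: "Vtx w \<in> star v r \<longleftrightarrow> w = v"
  by (auto simp: star_def edge_seg_def)

lemma Edg_in_star: "Edg e t \<in> star v r \<longleftrightarrow> e \<in> edges G \<and>
    (src G e = Some v \<and> 0 < t \<and> t < r \<or> tgt G e = Some v \<and> 1 - r < t \<and> t < 1)"
  by (auto simp: star_def edge_seg_def)

lemma star_mono: "r \<le> r' \<Longrightarrow> star v r \<subseteq> star v r'"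
  by (auto simp: star_def edge_seg_def)

lemma open_star:
  assumes v: "v \<in> verts G" and r: "0 < r" "r \<le> 1"
  shows "openin \<T> (star v r)"
  unfolding open_iff
proof (intro conjI ballI)
  show "star v r \<subseteq> graph_points G"
    using v r by (auto simp: star_def edge_seg_def graph_points_def)
  fix e assume e: "e \<in> edges G"
  have "pull e (star v r) = edge_dom G e \<inter>
      ((if src G e = Some v then {..<r} else {}) \<union> (if tgt G e = Some v then {1 - r<..} else {}))"
    using r e by (auto simp: edge_map_def Edg_in_star edge_dom_def split: if_splits)
  then show "openin (top_of_set (edge_dom G e)) (pull e (star v r))"
    by (auto intro!: openin_open_Int)
qed

text \<open>Finitely many edges admit one radius for all of them. The bound 1/2 is what makes stars
  of different vertices, and the two legs on one edge, disjoint.\<close>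

lemma star_nbhd:
  assumes U: "openin \<T> U" and v: "Vtx v \<in> U"
  obtains r where "0 < r" "r \<le> 1/2" "star v r \<subseteq> U"
proof -
  have "\<exists>r>0. (src G e = Some v \<longrightarrow> edge_seg e 0 r \<subseteq> U) \<and> (tgt G e = Some v \<longrightarrow> edge_seg e (1 - r) 1 \<subseteq> U)"
    if e: "e \<in> edges G" for e
  proof -
    have "openin (top_of_set (edge_dom G e)) (pull e U)"
      using U e open_iff by blast
    then obtain N where N: "open N" "pull e U = edge_dom G e \<inter> N"
      unfolding openin_open by blast
    have inU: "Edg e s \<in> U" if "0 < s" "s < 1" "s \<in> N" for s
    proof -
      have "s \<in> pull e U"
        unfolding N(2) using that inner_in_edge_dom by blast
      then show ?thesis
        using that edge_map_inner by simp
    qed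
    have 1: "\<exists>r>0. r \<le> 1 \<and> edge_seg e 0 r \<subseteq> U" if "src G e = Some v"
    proof -
      have "0 \<in> pull e U"
        using that v by (simp add: edge_dom_def edge_map_def)
      then have "0 \<in> N" unfolding N(2) by blast
      then obtain r where "r > 0" "ball 0 r \<subseteq> N"
        using N(1) openE by blast
      then show ?thesis
        by (intro exI[of _ "min r 1"]) (auto simp: edge_seg_def dist_real_def subset_iff intro!: inU)
    qed
    have 2: "\<exists>r>0. r \<le> 1 \<and> edge_seg e (1 - r) 1 \<subseteq> U" if "tgt G e = Some v"
    proof -
      have "1 \<in> pull e U"
        using that v by (simp add: edge_dom_def edge_map_def)
      then have "1 \<in> N" unfolding N(2) by blast
      then obtain r where "r > 0" "ball 1 r \<subseteq> N"
        using N(1) openE by blast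
      then show ?thesis
        by (intro exI[of _ "min r 1"]) (auto simp: edge_seg_def dist_real_def subset_iff intro!: inU)
    qed
    obtain r1 where r1: "r1 > 0" "src G e = Some v \<longrightarrow> edge_seg e 0 r1 \<subseteq> U"
      using 1 zero_less_one by blast
    obtain r2 where r2: "r2 > 0" "tgt G e = Some v \<longrightarrow> edge_seg e (1 - r2) 1 \<subseteq> U"
      using 2 zero_less_one by blast
    have "edge_seg e 0 (min r1 r2) \<subseteq> edge_seg e 0 r1" "edge_seg e (1 - min r1 r2) 1 \<subseteq> edge_seg e (1 - r2) 1"
      by (auto simp: edge_seg_def)
    then show ?thesis
      using r1 r2 by (intro exI[of _ "min r1 r2"]) auto
  qed
  then obtain r where r: "\<And>e. e \<in> edges G \<Longrightarrow> r e > 0"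
    "\<And>e. e \<in> edges G \<Longrightarrow> src G e = Some v \<Longrightarrow> edge_seg e 0 (r e) \<subseteq> U"
    "\<And>e. e \<in> edges G \<Longrightarrow> tgt G e = Some v \<Longrightarrow> edge_seg e (1 - r e) 1 \<subseteq> U"
    by metis
  \<comment> \<open>The entry 1/2 bounds the radius and keeps the set nonempty when there are no
    edges.\<close>
  define m where "m = Min (insert (1/2) (r ` edges G))"
  have fin: "finite (insert (1/2) (r ` edges G))"
    using finite_edges by simp
  have m: "m \<le> 1/2" "\<And>e. e \<in> edges G \<Longrightarrow> m \<le> r e" "m > 0"
  proof -
    show "m \<le> 1/2"
      unfolding m_def by (rule Min_le[OF fin]) blast
    show "m \<le> r e" if "e \<in> edges G" for e
      unfolding m_def by (rule Min_le[OF fin]) (use that in blast)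
    have "m \<in> insert (1/2) (r ` edges G)"
      unfolding m_def by (rule Min_in[OF fin]) blast
    then show "m > 0"
      using r(1) by auto
  qed
  have "star v m \<subseteq> U"
  proof
    fix x assume x: "x \<in> star v m"
    show "x \<in> U"
    proof (cases x)
      case (Vtx w)
      then show ?thesis using x v by simp
    next
      case (Edg e t)
      then consider "e \<in> edges G" "src G e = Some v" "x \<in> edge_seg e 0 m" |
          "e \<in> edges G" "tgt G e = Some v" "x \<in> edge_seg e (1 - m) 1"
        using x by (auto simp: Edg_in_star edge_seg_def)
      then show ?thesis
      proof cases
        case 1
        then have "x \<in> edge_seg e 0 (r e)"
          using m(2)[of e] by (auto simp: edge_seg_def)
        then show ?thesis using r(2) 1 by blast
      next
        case 2
        then have "x \<in> edge_seg e (1 - r e) 1"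
          using m(2)[of e] by (auto simp: edge_seg_def)
        then show ?thesis using r(3) 2 by blast
      qed
    qed
  qed
  with m show ?thesis
    by (intro that[of m]) auto
qed

text \<open>The contraction towards the vertex by the factor s; passing through
  \<open>edge_map\<close> makes s = 0 land on the vertex itself. The threshold 1/2 tells a source
  leg from a target leg, correctly so on stars of radius at most 1/2.\<close>

definition shrink :: "real \<Rightarrow> ('v, 'e) point \<Rightarrow> ('v, 'e) point" where
  "shrink s x = (case x of Vtx v \<Rightarrow> Vtx v
     | Edg e t \<Rightarrow> if t < 1/2 then edge_map G e (s * t) else edge_map G e (1 - s * (1 - t)))"

text \<open>Joint continuity of the contraction in the edge coordinate: f is the identity on source
  legs and 1 - x on target legs.\<close>

lemma mult_nbhd:
  fixes a b :: real
  assumes "open N" "f (a * b) \<in> N" "continuous_on UNIV f"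
  obtains A B where "open A" "open B" "a \<in> A" "b \<in> B" "\<And>x y. x \<in> A \<Longrightarrow> y \<in> B \<Longrightarrow> f (x * y) \<in> N"
proof -
  have "continuous_on UNIV (\<lambda>p::real \<times> real. f (fst p * snd p))"
    by (rule continuous_on_compose2[OF assms(3)]) (auto intro!: continuous_intros)
  then have "open ((\<lambda>p. f (fst p * snd p)) -` N)"
    using assms(1) by (simp add: open_vimage continuous_on_open_vimage)
  moreover have "(a, b) \<in> (\<lambda>p. f (fst p * snd p)) -` N"
    using assms(2) by simp
  ultimately obtain A B where "open A" "open B" "(a, b) \<in> A \<times> B" "A \<times> B \<subseteq> (\<lambda>p. f (fst p * snd p)) -` N"
    by (rule open_prod_elim)
  then show ?thesis
    by (intro that[of A B]) auto
qed

lemma shrink_in_star: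
  assumes s: "0 \<le> s" "s \<le> 1" and r: "0 < r" "r \<le> 1/2" and x: "x \<in> star v r"
  shows "shrink s x \<in> star v r"
proof (cases x)
  case (Vtx w)
  then show ?thesis using x by (simp add: shrink_def)
next
  case (Edg e t)
  then consider "t < 1/2" "e \<in> edges G" "src G e = Some v" "0 < t" "t < r"
    | "\<not> t < 1/2" "e \<in> edges G" "tgt G e = Some v" "1 - r < t" "t < 1"
    using x r by (auto simp: Edg_in_star)
  then show ?thesis
  proof cases
    case 1
    define u where "u = s * t"
    have "0 \<le> u" "u \<le> t"
      unfolding u_def using s 1 mult_left_le_one_le[of t s] by auto
    moreover have "shrink s x = edge_map G e u"
      using 1 Edg by (simp add: shrink_def u_def)
    ultimately show ?thesis
      using 1 r by (auto simp: edge_map_def Edg_in_star)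
  next
    case 2
    define u where "u = s * (1 - t)"
    have "0 \<le> u" "u \<le> 1 - t"
      unfolding u_def using s 2 mult_left_le_one_le[of "1 - t" s] by auto
    moreover have "shrink s x = edge_map G e (1 - u)"
      using 2 Edg by (simp add: shrink_def u_def)
    ultimately show ?thesis
      using 2 r by (auto simp: edge_map_def Edg_in_star)
  qed
qed

text \<open>\<open>shrink\<close> is the contracting homotopy. Its joint continuity at the vertex
  holds because every smaller star is mapped into itself for all s at once; at a point of an edge it
  is continuity of multiplication.\<close>

lemma contractible_star:
  assumes v: "v \<in> verts G" and r: "0 < r" "r \<le> 1/2"
  shows "contractible_space (subtopology \<T> (star v r))"
proof -
  let ?X = "subtopology \<T> (star v r)"
  have op: "openin \<T> (star v r)"
    using open_star v r by simp
  then have top: "topspace ?X = star v r"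
    using openin_subset by (auto simp: topspace_subtopology)
  let ?h = "\<lambda>(s, x). shrink s x"
  have "continuous_map (prod_topology (top_of_set {0..1}) ?X) \<T> ?h"
    unfolding continuous_map
  proof (intro conjI allI impI)
    show "?h ` topspace (prod_topology (top_of_set {0..1}) ?X) \<subseteq> topspace \<T>"
      using shrink_in_star[OF _ _ r] op openin_subset[OF op] by (auto simp: top)
    fix O' assume O': "openin \<T> O'"
    show "openin (prod_topology (top_of_set {0..1}) ?X)
        {p \<in> topspace (prod_topology (top_of_set {0..1}) ?X). ?h p \<in> O'}"
      unfolding openin_prod_topology_alt
    proof (intro allI impI)
      fix s x assume "(s, x) \<in> {p \<in> topspace (prod_topology (top_of_set {0..1}) ?X). ?h p \<in> O'}"
      then have s: "0 \<le> s" "s \<le> 1" and x: "x \<in> star v r" and hO: "shrink s x \<in> O'"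
        by (auto simp: top)
      have *: "\<exists>A N. open A \<and> openin \<T> N \<and> s \<in> A \<and> x \<in> N \<and>
          (\<forall>s'\<in>{0..1} \<inter> A. \<forall>x'\<in>star v r \<inter> N. shrink s' x' \<in> O')"
      proof (cases x)
        case (Vtx w)
        then have w: "Vtx v \<in> O'" "w = v"
          using hO x by (auto simp: shrink_def)
        obtain r' where r': "0 < r'" "r' \<le> 1/2" "star v r' \<subseteq> O'"
          using star_nbhd[OF O' w(1)] .
        have "openin \<T> (star v r')"
          using open_star v r' by simp
        then show ?thesis
          using r' Vtx w shrink_in_star[OF _ _ r'(1,2)] by (intro exI[of _ UNIV] exI[of _ "star v r'"]) auto
      next
        case (Edg e t)
        then consider "t < 1/2" "e \<in> edges G" "src G e = Some v" "0 < t" "t < r"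
          | "\<not> t < 1/2" "e \<in> edges G" "tgt G e = Some v" "1 - r < t" "t < 1"
          using x r by (auto simp: Edg_in_star)
        then show ?thesis
        proof cases
          case 1
          have "openin (top_of_set (edge_dom G e)) (pull e O')"
            using O' open_iff 1 by blast
          then obtain N where N: "open N" "pull e O' = edge_dom G e \<inter> N"
            unfolding openin_open by blast
          \<comment> \<open>The product may be 0, which is in the domain because e has v as its
            source.\<close>
          have dom: "s' * t' \<in> edge_dom G e" if "0 \<le> s'" "s' \<le> 1" "0 < t'" "t' < r" for s' t'
          proof -
            define u where "u = s' * t'"
            have "0 \<le> u" "u \<le> t'"
              unfolding u_def using that mult_left_le_one_le[of t' s'] by auto
            then have "u \<in> edge_dom G e" using that r 1 by (auto simp: edge_dom_def)
            then show ?thesis by (simp add: u_def)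
          qed
          have "s * t \<in> pull e O'"
            using hO Edg 1 dom[of s t] s by (simp add: shrink_def)
          then have "s * t \<in> N" unfolding N(2) by blast
          then obtain A B where AB: "open A" "open B" "s \<in> A" "t \<in> B" "\<And>x y. x \<in> A \<Longrightarrow> y \<in> B \<Longrightarrow> x * y \<in> N"
            using mult_nbhd[OF N(1), of "\<lambda>x. x" s t] by auto
          let ?N = "Edg e ` (B \<inter> {0<..<r})"
          have "openin \<T> ?N"
          proof (rule open_Edg_image[OF 1(2)])
            show "open (B \<inter> {0<..<r})"
              using AB(2) by (intro open_Int) auto
          qed (use r in auto)
          moreover have "shrink s' x' \<in> O'" if "s' \<in> {0..1} \<inter> A" "x' \<in> ?N" for s' x'
          proof -
            from \<open>x' \<in> ?N\<close> obtain t' where t': "x' = Edg e t'" "t' \<in> B" "0 < t'" "t' < r"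
              by auto
            have "s' * t' \<in> edge_dom G e \<inter> N"
              using AB(5)[of s' t'] dom[of s' t'] t' that by auto
            then have "edge_map G e (s' * t') \<in> O'"
              unfolding N(2)[symmetric] by blast
            then show ?thesis
              using t' r by (simp add: shrink_def)
          qed
          moreover have "x \<in> ?N"
            using AB(4) Edg 1 by simp
          ultimately show ?thesis
            using AB(1,3) by blast
        next
          case 2
          have "openin (top_of_set (edge_dom G e)) (pull e O')"
            using O' open_iff 2 by blast
          then obtain N where N: "open N" "pull e O' = edge_dom G e \<inter> N"
            unfolding openin_open by blast
          have dom: "1 - s' * (1 - t') \<in> edge_dom G e" if "0 \<le> s'" "s' \<le> 1" "1 - r < t'" "t' < 1" for s' t'
          proof -
            define u where "u = s' * (1 - t')"
            have "0 \<le> u" "u \<le> 1 - t'"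
              unfolding u_def using that mult_left_le_one_le[of "1 - t'" s'] by auto
            then have "1 - u \<in> edge_dom G e" using that r 2 by (auto simp: edge_dom_def)
            then show ?thesis by (simp add: u_def)
          qed
          have "1 - s * (1 - t) \<in> pull e O'"
            using hO Edg 2 dom[of s t] s by (simp add: shrink_def)
          then have mem: "1 - s * (1 - t) \<in> N" unfolding N(2) by blast
          have "continuous_on UNIV (\<lambda>x::real. 1 - x)"
            by (intro continuous_intros)
          then have "\<exists>A B. open A \<and> open B \<and> s \<in> A \<and> 1 - t \<in> B \<and> (\<forall>x y. x \<in> A \<longrightarrow> y \<in> B \<longrightarrow> 1 - x * y \<in> N)"
            by (rule mult_nbhd[where f = "\<lambda>x. 1 - x", OF N(1) mem]) blast
          then obtain A B where AB: "open A" "open B" "s \<in> A" "1 - t \<in> B" "\<And>x y. x \<in> A \<Longrightarrow> y \<in> B \<Longrightarrow> 1 - x * y \<in> N"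
            by blast
          let ?B = "(\<lambda>t. 1 - t) -` B \<inter> {1 - r<..<1}"
          let ?N = "Edg e ` ?B"
          have "open ((\<lambda>t::real. 1 - t) -` B)"
            using AB(2) by (intro open_vimage continuous_intros)
          then have "openin \<T> ?N"
            by (intro open_Edg_image[OF 2(2)] open_Int) (use r in auto)
          moreover have "shrink s' x' \<in> O'" if "s' \<in> {0..1} \<inter> A" "x' \<in> ?N" for s' x'
          proof -
            from \<open>x' \<in> ?N\<close> obtain t' where t': "x' = Edg e t'" "1 - t' \<in> B" "1 - r < t'" "t' < 1"
              by auto
            have "1 - s' * (1 - t') \<in> edge_dom G e \<inter> N"
              using AB(5)[of s' "1 - t'"] dom[of s' t'] t' that by auto
            then have "edge_map G e (1 - s' * (1 - t')) \<in> O'"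
              unfolding N(2)[symmetric] by blast
            then show ?thesis
              using t' r by (simp add: shrink_def)
          qed
          moreover have "x \<in> ?N"
            using AB(4) Edg 2 by simp
          ultimately show ?thesis
            using AB(1,3) by blast
        qed
      qed
      then obtain A N where AT: "open A" "openin \<T> N" "s \<in> A" "x \<in> N"
        "\<And>s' x'. s' \<in> {0..1} \<inter> A \<Longrightarrow> x' \<in> star v r \<inter> N \<Longrightarrow> shrink s' x' \<in> O'"
        by blast
      show "\<exists>U V. openin (top_of_set {0..1}) U \<and> openin ?X V \<and> s \<in> U \<and> x \<in> V \<and>
          U \<times> V \<subseteq> {p \<in> topspace (prod_topology (top_of_set {0..1}) ?X). ?h p \<in> O'}"
      proof (intro exI conjI)
        show "openin (top_of_set {0..1}) ({0..1} \<inter> A)"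
          using AT(1) by (auto intro: openin_open_Int)
        show "openin ?X (star v r \<inter> N)"
          using AT(2) openin_subtopology_Int2 by blast
        show "({0..1} \<inter> A) \<times> (star v r \<inter> N) \<subseteq>
            {p \<in> topspace (prod_topology (top_of_set {0..1}) ?X). ?h p \<in> O'}"
          using AT(5) by (auto simp: top simp del: topspace_subtopology)
      qed (use AT s x in auto)
    qed
  qed
  then have cont: "continuous_map (prod_topology (top_of_set {0..1}) ?X) ?X ?h"
    using shrink_in_star[OF _ _ r] by (auto simp: continuous_map_in_subtopology top)
  have "homotopic_with (\<lambda>x. True) ?X ?X (\<lambda>x. Vtx v) id"
  proof (subst homotopic_with, simp, intro exI conjI ballI)
    fix x assume "x \<in> topspace ?X"
    then have x: "x \<in> star v r" by (simp add: top)
    show "?h (0, x) = Vtx v" "?h (1, x) = id x"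
      using x r by (cases x; auto simp: shrink_def Edg_in_star edge_map_def)+
  qed (use cont in auto)
  then show ?thesis
    unfolding contractible_space_def using homotopic_with_sym by blast
qed

section \<open>Shape of arbitrary sets of the star base\<close>

lemma star_in_star_base:
  assumes "v \<in> verts G" "0 < r" "r \<le> 1/2"
  shows "star v r \<in> star_base G"
  unfolding star_base_def using assms open_star contractible_star by auto

lemma star_baseD:
  assumes "U \<in> star_base G"
  shows "openin \<T> U" "connected_space (subtopology \<T> U)" "contractible_space (subtopology \<T> U)"
    "star_vertex G U \<in> verts G" "Vtx w \<in> U \<longleftrightarrow> w = star_vertex G U"
proof -
  have U: "openin \<T> U" "contractible_space (subtopology \<T> U)" and ex1: "\<exists>!v. v \<in> verts G \<and> Vtx v \<in> U"
    using assms by (auto simp: star_base_def)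
  show "openin \<T> U" "contractible_space (subtopology \<T> U)" "connected_space (subtopology \<T> U)"
    using U contractible_imp_connected_space by auto
  have sv: "star_vertex G U \<in> verts G \<and> Vtx (star_vertex G U) \<in> U"
    unfolding star_vertex_def by (rule theI'[OF ex1])
  then show "star_vertex G U \<in> verts G" by simp
  have "w \<in> verts G" if "Vtx w \<in> U"
    using that U(1) unfolding open_iff using Vtx_in_points by blast
  then show "Vtx w \<in> U \<longleftrightarrow> w = star_vertex G U"
    using ex1 sv by blast
qed

text \<open>A point of U that is cut off from the vertex on both sides would lie in an open interval
  whose trace on U is clopen and misses the vertex, against connectedness of U.\<close>

lemma star_connected_to_vertex:
  assumes U: "U \<in> star_base G" and x: "Edg e t \<in> U"
  defines "v \<equiv> star_vertex G U"
  shows "tgt G e = Some v \<and> (\<forall>t'. t \<le> t' \<and> t' < 1 \<longrightarrow> Edg e t' \<in> U) \<or>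
    src G e = Some v \<and> (\<forall>t'. 0 < t' \<and> t' \<le> t \<longrightarrow> Edg e t' \<in> U)"
proof (rule ccontr)
  assume neg: "\<not> ?thesis"
  note sb = star_baseD[OF U]
  have "Edg e t \<in> graph_points G"
    using sb(1) x open_iff by blast
  then have e: "e \<in> edges G" and t: "0 < t" "t < 1"
    by (auto simp: Edg_in_points)
  \<comment> \<open>If e ends at v, the failure of the first alternative supplies q. Otherwise q = 1
    serves: that end is open, or it is another vertex and hence not in U.\<close>
  have "\<exists>q. t < q \<and> q \<le> 1 \<and> (q \<in> edge_dom G e \<longrightarrow> edge_map G e q \<notin> U)"
  proof (cases "tgt G e = Some v")
    case True
    then obtain q where q: "t \<le> q" "q < 1" "Edg e q \<notin> U"
      using neg by blast
    then have "q \<noteq> t" using x by auto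
    with q t show ?thesis by (intro exI[of _ q]) (auto simp: edge_map_def)
  next
    case False
    then show ?thesis
      using t sb(5) by (intro exI[of _ 1]) (auto simp: edge_map_def edge_dom_def v_def split: if_splits)
  qed
  then obtain q where q: "t < q" "q \<le> 1" "q \<in> edge_dom G e \<Longrightarrow> edge_map G e q \<notin> U"
    by blast
  have "\<exists>p. 0 \<le> p \<and> p < t \<and> (p \<in> edge_dom G e \<longrightarrow> edge_map G e p \<notin> U)"
  proof (cases "src G e = Some v")
    case True
    then obtain p where p: "0 < p" "p \<le> t" "Edg e p \<notin> U"
      using neg by blast
    then have "p \<noteq> t" using x by auto
    with p t show ?thesis by (intro exI[of _ p]) (auto simp: edge_map_def)
  next
    case False
    then show ?thesis
      using t sb(5) by (intro exI[of _ 0]) (auto simp: edge_map_def edge_dom_def v_def split: if_splits)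
  qed
  then obtain p where p: "0 \<le> p" "p < t" "p \<in> edge_dom G e \<Longrightarrow> edge_map G e p \<notin> U"
    by blast
  let ?S = "edge_seg e p q"
  have opS: "openin \<T> ?S"
    by (rule open_edge_seg) (use e p q in auto)
  have opc: "openin \<T> (U - ?S)"
    unfolding open_iff
  proof (intro conjI ballI)
    show "U - ?S \<subseteq> graph_points G"
      using sb(1) open_iff by blast
    fix e' assume e': "e' \<in> edges G"
    \<comment> \<open>Neither p nor q is mapped into U, so removing the open interval is the same as
      removing the closed one, and what remains is open.\<close>
    have "pull e' (U - ?S) = (if e' = e then pull e U \<inter> ({..<p} \<union> {q<..}) else pull e' U)"
    proof (cases "e' = e")
      case True
      have "s \<in> pull e (U - ?S) \<longleftrightarrow> s \<in> pull e U \<inter> ({..<p} \<union> {q<..})" for s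
      proof -
        have "edge_map G e s \<in> ?S \<longleftrightarrow> p < s \<and> s < q" if "s \<in> edge_dom G e"
          using that p q edge_dom_bounds[OF that] by (auto simp: edge_map_def edge_seg_def)
        moreover have "s \<noteq> p" "s \<noteq> q" if "s \<in> pull e U"
          using that p(3) q(3) by auto
        ultimately show ?thesis
          using p q by auto
      qed
      then show ?thesis using True by auto
    qed (auto simp: edge_map_def edge_seg_def)
    moreover have "openin (top_of_set (edge_dom G e'')) (pull e'' U)" if "e'' \<in> edges G" for e''
      using that sb(1) open_iff by blast
    ultimately show "openin (top_of_set (edge_dom G e')) (pull e' (U - ?S))"
      using e e' by (auto intro!: openin_Int_open open_Un)
  qed
  have "openin (subtopology \<T> U) (U \<inter> ?S)" "openin (subtopology \<T> U) (U - ?S)"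
    using opS opc sb(1) by (auto simp: openin_open_subtopology openin_Int)
  moreover have "topspace (subtopology \<T> U) = U"
    using openin_subset[OF sb(1)] by auto
  moreover have "Edg e t \<in> U \<inter> ?S"
    using x p q by (auto simp: edge_seg_def)
  moreover have "Vtx v \<in> U - ?S"
    using sb(5) by (auto simp: edge_seg_def v_def)
  ultimately show False
    using sb(2) unfolding connected_space_def by blast
qed

text \<open>Wrapping the loop around the unit circle and collapsing everything else to 1 is a
  continuous map into the punctured plane. A contraction of U would then deform a circle of winding
  number 1 to a constant. On a self-loop this keeps the incoming and the outgoing part of U
  apart.\<close>

lemma star_no_loop:
  assumes U: "U \<in> star_base G" and e: "e \<in> edges G"
    and loop: "src G e = Some (star_vertex G U)" "tgt G e = Some (star_vertex G U)"
  shows "\<exists>t. 0 < t \<and> t < 1 \<and> Edg e t \<notin> U"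
proof (rule ccontr)
  assume "\<not> ?thesis"
  then have all: "\<And>t. 0 < t \<Longrightarrow> t < 1 \<Longrightarrow> Edg e t \<in> U" by blast
  note sb = star_baseD[OF U]
  let ?X = "subtopology \<T> U"
  have top: "topspace ?X = U"
    using openin_subset[OF sb(1)] by auto
  have dom: "edge_dom G e = {0..1}"
    using loop by (auto simp: edge_dom_def)
  define c where "c = (circlepath 0 1 :: real \<Rightarrow> complex)"
  \<comment> \<open>f winds e once around the circle; both ends of e go to 1, as do all vertices and
    other edges, so f is continuous.\<close>
  define f :: "('v, 'e) point \<Rightarrow> complex" where
    "f x = (case x of Vtx v \<Rightarrow> 1 | Edg e' t \<Rightarrow> if e' = e then c t else 1)" for x
  have c: "c t \<noteq> 0" "c 0 = 1" "c 1 = 1" for t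
    by (auto simp: c_def circlepath)
  have c_cont: "continuous_on {0..1} c"
    unfolding c_def using path_circlepath[of 0 1] by (simp add: path_def)
  have fe: "f (edge_map G e t) = c t" if "t \<in> {0..1}" for t
    using that c by (auto simp: f_def edge_map_def)
  have "continuous_map \<T> (top_of_set (- {0})) f"
  proof (rule continuous_map_from_graph)
    show "f x \<in> topspace (top_of_set (- {0}))" for x
      using c by (auto simp: f_def split: point.splits)
    fix e' assume "e' \<in> edges G"
    show "continuous_map (top_of_set (edge_dom G e')) (top_of_set (- {0})) (\<lambda>t. f (edge_map G e' t))"
    proof (cases "e' = e")
      case True
      have "continuous_map (top_of_set {0..1}) (top_of_set (- {0})) c"
        using c_cont c by auto
      then show ?thesis
        unfolding True dom by (rule continuous_map_eq) (use fe in auto)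
    next
      case False
      then have "(\<lambda>t. f (edge_map G e' t)) = (\<lambda>t. 1)"
        by (auto simp: f_def edge_map_def fun_eq_iff)
      then show ?thesis by auto
    qed
  qed
  then have f_cont: "continuous_map ?X (top_of_set (- {0})) f"
    by (rule continuous_map_from_subtopology)
  have em: "continuous_map (top_of_set {0..1}) ?X (edge_map G e)"
    using continuous_edge_map[OF e] all loop sb(5) unfolding dom
    by (auto simp: continuous_map_in_subtopology edge_map_def)
  obtain a where "homotopic_with (\<lambda>x. True) ?X ?X id (\<lambda>x. a)"
    using sb(3) unfolding contractible_space_def by blast
  then have "\<exists>h. continuous_map (prod_topology (top_of_set {0..1}) ?X) ?X h \<and>
      (\<forall>x. h (0::real, x) = x) \<and> (\<forall>x. h (1, x) = a)"
    by (simp add: homotopic_with_def)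
  then obtain h where h: "continuous_map (prod_topology (top_of_set {0..1}) ?X) ?X h"
    "\<And>x. h (0::real, x) = x" "\<And>x. h (1, x) = a"
    by blast
  let ?g = "\<lambda>p. (fst p, edge_map G e (snd p))"
  have "continuous_map (prod_topology (top_of_set {0..1}) (top_of_set {0..1}))
      (prod_topology (top_of_set {0..1}) ?X) ?g"
    by (intro continuous_map_pairedI continuous_map_compose[OF continuous_map_snd em, unfolded o_def] continuous_map_fst)
  then have "continuous_map (prod_topology (top_of_set {0..1}) (top_of_set {0..1})) (top_of_set (- {0})) (f \<circ> (h \<circ> ?g))"
    using continuous_map_compose[OF continuous_map_compose[OF _ h(1)] f_cont] by blast
  then have H: "continuous_on ({0..1} \<times> {0..1}) (f \<circ> (h \<circ> ?g))" "(f \<circ> (h \<circ> ?g)) \<in> {0..1} \<times> {0..1} \<rightarrow> - {0}"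
    by (auto simp: Pi_iff)
  have aU: "f a \<noteq> 0"
    using c by (auto simp: f_def split: point.splits)
  \<comment> \<open>Moving the loop by the contraction h and applying f is a homotopy from the
    circle to a constant. Each stage is a loop because both ends of e are the same vertex.\<close>
  have "homotopic_loops (- {0}) c (linepath (f a) (f a))"
    unfolding homotopic_loops
  proof (intro exI[of _ "f \<circ> (h \<circ> ?g)"] conjI ballI)
    show "pathfinish ((f \<circ> (h \<circ> ?g)) \<circ> Pair t) = pathstart ((f \<circ> (h \<circ> ?g)) \<circ> Pair t)" for t
      using loop by (simp add: pathfinish_def pathstart_def edge_map_def)
  qed (use H h fe in \<open>auto simp: linepath_def algebra_simps\<close>)
  then have "winding_number c 0 = winding_number (linepath (f a) (f a)) 0"
    by (rule winding_number_homotopic_loops)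
  moreover have "winding_number c 0 = 1"
    unfolding c_def by (rule winding_number_circlepath_centre) simp
  moreover have "winding_number (linepath (f a) (f a)) 0 = 0"
    using aU by simp
  ultimately show False by simp
qed

end

section \<open>The switching sheaf on edges\<close>

lemma lin_ext_add: "lin_ext m g (\<lambda>w. x w + y w) = (\<lambda>w. lin_ext m g x w + lin_ext m g y w)"
  unfolding lin_ext_def by (simp only: distrib_right sum.distrib)

lemma lin_ext_closed: "lin_ext m g x \<in> carrier plane"
proof -
  have "(\<Sum>u | length u = m. x u * T (g u) w) = 0" if "length w \<noteq> 1" for w
    by (rule sum.neutral) (use that in \<open>auto simp: T_def\<close>)
  then show ?thesis
    by (simp add: lin_ext_def tens_def mk_module_def)
qed

lemma tens_add: "x \<oplus>\<^bsub>tens m\<^esub> y = (\<lambda>w. x w + y w)"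
  by (simp add: tens_def mk_module_def)

lemma lin_ext_additive: "additive_map (tens m) plane (lin_ext m' g)"
  unfolding additive_map_def tens_add lin_ext_add using lin_ext_closed by blast

lemma in_part_iff: "Edg e t \<in> in_part U e' \<longleftrightarrow>
    e = e' \<and> 0 < t \<and> t < 1 \<and> (\<forall>t'. t \<le> t' \<and> t' < 1 \<longrightarrow> Edg e t' \<in> U)"
  and out_part_iff: "Edg e t \<in> out_part U e' \<longleftrightarrow>
    e = e' \<and> 0 < t \<and> t < 1 \<and> (\<forall>t'. 0 < t' \<and> t' \<le> t \<longrightarrow> Edg e t' \<in> U)"
  by (auto simp: in_part_def out_part_def)

lemma in_part_mono: "U' \<subseteq> U \<Longrightarrow> in_part U' e \<subseteq> in_part U e"
  and out_part_mono: "U' \<subseteq> U \<Longrightarrow> out_part U' e \<subseteq> out_part U e"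
  by (auto simp: in_part_def out_part_def)

section \<open>The switching data form a presheaf on a base\<close>

context circuit_graph
begin

abbreviation "PS \<equiv> switching_presheaf G"

lemma PS_simps: "opens PS = star_base G \<union> edge_base G"
  "sections PS U = (if U \<in> star_base G then tens (length (ins G (star_vertex G U))) else plane)"
  "restr PS = switching_restr G"
  by (simp_all add: switching_presheaf_def)

lemma edge_baseE:
  assumes "V \<in> edge_base G"
  obtains e where "openin \<T> V" "connectedin \<T> V" "V \<noteq> {}" "e \<in> edges G"
    "\<forall>x\<in>V. \<exists>t. x = Edg e t \<and> 0 < t \<and> t < 1"
proof -
  obtain e where e: "openin \<T> V" "connectedin \<T> V" "V \<noteq> {}" "e \<in> edges G" "V \<subseteq> edge_seg e 0 1"
    using assms unfolding edge_base_def by blast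
  have "\<exists>t. x = Edg e t \<and> 0 < t \<and> t < 1" if "x \<in> V" for x
    using subsetD[OF e(5) that] by (cases x) auto
  then have "\<forall>x\<in>V. \<exists>t. x = Edg e t \<and> 0 < t \<and> t < 1"
    by blast
  then show ?thesis
    by (rule that[OF e(1-4)])
qed

lemma edge_base_subset_not_star:
  assumes "V \<in> edge_base G" "U \<subseteq> V"
  shows "U \<notin> star_base G"
proof
  assume "U \<in> star_base G"
  then have "Vtx (star_vertex G U) \<in> V"
    using star_baseD(5) assms(2) by blast
  then show False
    using edge_baseE[OF assms(1)] by blast
qed

text \<open>A missing parameter u would split V into the two open parts before and after u.\<close>

lemma edge_base_convex:
  assumes V: "V \<in> edge_base G" and st: "Edg e s \<in> V" "Edg e t \<in> V" and u: "s \<le> u" "u \<le> t"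
  shows "Edg e u \<in> V"
proof (rule ccontr)
  assume n: "Edg e u \<notin> V"
  obtain e' where e': "connectedin \<T> V" "e' \<in> edges G" "\<And>x. x \<in> V \<Longrightarrow> \<exists>t. x = Edg e' t \<and> 0 < t \<and> t < 1"
    using edge_baseE[OF V] by metis
  have e: "e' = e" "0 < s" "t < 1"
    using e'(3)[OF st(1)] e'(3)[OF st(2)] by auto
  have "openin \<T> (edge_seg e 0 u)" "openin \<T> (edge_seg e u 1)"
    using e e'(2) u by (auto intro!: open_edge_seg)
  moreover have "V \<subseteq> edge_seg e 0 u \<union> edge_seg e u 1"
  proof
    fix x assume x: "x \<in> V"
    then obtain r where "x = Edg e r" "0 < r" "r < 1"
      using e'(3) e(1) by blast
    then show "x \<in> edge_seg e 0 u \<union> edge_seg e u 1"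
      using n x by (cases r u rule: linorder_cases) auto
  qed
  moreover have "edge_seg e 0 u \<inter> edge_seg e u 1 \<inter> V = {}"
    by (auto simp: edge_seg_def)
  moreover have "Edg e s \<in> edge_seg e 0 u \<inter> V" "Edg e t \<in> edge_seg e u 1 \<inter> V"
    using st u e n by (auto simp: less_le)
  ultimately show False
    using e'(1) unfolding connectedin by blast
qed

lemma edge_seg_in_edge_base:
  assumes "e \<in> edges G" "0 \<le> p" "p < q" "q \<le> 1"
  shows "edge_seg e p q \<in> edge_base G"
proof -
  have sub: "{p<..<q} \<subseteq> edge_dom G e"
    using assms by (auto intro: inner_in_edge_dom)
  have "connectedin (top_of_set (edge_dom G e)) {p<..<q}"
    using sub by (simp add: connectedin_subtopology)
  then have "connectedin \<T> (edge_map G e ` {p<..<q})"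
    by (rule connectedin_continuous_map_image[OF continuous_edge_map[OF assms(1)]])
  moreover have "edge_map G e ` {p<..<q} = edge_seg e p q"
    unfolding edge_seg_def using assms by (intro image_cong) (auto simp: edge_map_inner)
  ultimately show ?thesis
    unfolding edge_base_def using assms open_edge_seg by (auto simp: edge_seg_def intro!: bexI[of _ e])
qed

text \<open>V is an interval inside U, so if one of its points is joined to an end of the edge
  within U, all of them are. This is functoriality for a star set followed by two edge sets.\<close>

lemma part_subset_edge:
  assumes V: "V \<in> edge_base G" "V \<subseteq> U" and W: "W \<noteq> {}" "W \<subseteq> V"
  shows "W \<subseteq> in_part U e \<longleftrightarrow> V \<subseteq> in_part U e" "W \<subseteq> out_part U e \<longleftrightarrow> V \<subseteq> out_part U e"
proof -
  obtain e' where e': "\<And>x. x \<in> V \<Longrightarrow> \<exists>t. x = Edg e' t \<and> 0 < t \<and> t < 1"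
    using edge_baseE[OF V(1)] by metis
  obtain t where t: "Edg e' t \<in> W"
    using W e' by blast
  then have tV: "Edg e' t \<in> V" using W by blast
  have "V \<subseteq> in_part U e" if "W \<subseteq> in_part U e"
  proof
    have inp: "Edg e' t \<in> in_part U e"
      using that t by blast
    fix x assume x: "x \<in> V"
    then obtain s where s: "x = Edg e' s" "0 < s" "s < 1" using e' by blast
    have "Edg e' t' \<in> U" if "s \<le> t'" "t' < 1" for t'
    proof (cases "t \<le> t'")
      case True
      then show ?thesis using inp[unfolded in_part_iff] that by blast
    next
      case False
      then have "Edg e' t' \<in> V"
        using edge_base_convex[OF V(1) x[unfolded s(1)] tV that(1)] by simp
      then show ?thesis using V(2) by blast
    qed
    then show "x \<in> in_part U e"
      using s inp unfolding s(1) in_part_iff by blast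
  qed
  then show "W \<subseteq> in_part U e \<longleftrightarrow> V \<subseteq> in_part U e"
    using W by blast
  have "V \<subseteq> out_part U e" if "W \<subseteq> out_part U e"
  proof
    have inp: "Edg e' t \<in> out_part U e"
      using that t by blast
    fix x assume x: "x \<in> V"
    then obtain s where s: "x = Edg e' s" "0 < s" "s < 1" using e' by blast
    have "Edg e' t' \<in> U" if "0 < t'" "t' \<le> s" for t'
    proof (cases "t' \<le> t")
      case True
      then show ?thesis using inp[unfolded out_part_iff] that by blast
    next
      case False
      then have "Edg e' t' \<in> V"
        using edge_base_convex[OF V(1) tV x[unfolded s(1)] _ that(2)] by simp
      then show ?thesis using V(2) by blast
    qed
    then show "x \<in> out_part U e"
      using s inp unfolding s(1) out_part_iff by blast
  qed
  then show "W \<subseteq> out_part U e \<longleftrightarrow> V \<subseteq> out_part U e"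
    using W by blast
qed

text \<open>A smaller star set could a priori join a point to the vertex only through the other end
  of a self-loop. Then U would contain the whole loop, which \<open>star_no_loop\<close> forbids.
  This is functoriality for two star sets followed by an edge set.\<close>

lemma part_subset_star:
  assumes U: "U \<in> star_base G" "U' \<in> star_base G" "U' \<subseteq> U" and W: "W \<in> edge_base G" "W \<subseteq> U'"
  defines "v \<equiv> star_vertex G U"
  shows "tgt G e = Some v \<Longrightarrow> W \<subseteq> in_part U' e \<longleftrightarrow> W \<subseteq> in_part U e"
    and "src G e = Some v \<Longrightarrow> W \<subseteq> out_part U' e \<longleftrightarrow> W \<subseteq> out_part U e"
proof -
  have v': "star_vertex G U' = v"
    using star_baseD(5)[OF U(1)] star_baseD(5)[OF U(2)] U(3) unfolding v_def by blast
  obtain e' where e': "e' \<in> edges G" "\<And>x. x \<in> W \<Longrightarrow> \<exists>t. x = Edg e' t \<and> 0 < t \<and> t < 1"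
    using edge_baseE[OF W(1)] by metis
  \<comment> \<open>Both halves of a self-loop at the parameter t would together exhaust it.\<close>
  have noloop: False
    if "tgt G e' = Some v" "src G e' = Some v"
      and "\<forall>t'. t \<le> t' \<and> t' < 1 \<longrightarrow> Edg e' t' \<in> U" "\<forall>t'. 0 < t' \<and> t' \<le> t \<longrightarrow> Edg e' t' \<in> U" for t
    using star_no_loop[OF U(1) e'(1)] that unfolding v_def by (meson linear)
  show "W \<subseteq> in_part U' e \<longleftrightarrow> W \<subseteq> in_part U e" if tgt: "tgt G e = Some v"
  proof
    assume L: "W \<subseteq> in_part U e"
    show "W \<subseteq> in_part U' e"
    proof
      fix x assume x: "x \<in> W"
      then obtain t where t: "x = Edg e' t" "0 < t" "t < 1" using e' by blast
      have inU: "e' = e" "\<forall>t'. t \<le> t' \<and> t' < 1 \<longrightarrow> Edg e' t' \<in> U"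
        using subsetD[OF L x] unfolding t(1) in_part_iff by blast+
      have "Edg e' t \<in> U'" using x W(2) t by blast
      from star_connected_to_vertex[OF U(2) this]
      have "\<forall>t'. t \<le> t' \<and> t' < 1 \<longrightarrow> Edg e' t' \<in> U'"
        unfolding v' using noloop[of t] inU tgt U(3) by blast
      then show "x \<in> in_part U' e"
        using t inU by (simp add: in_part_iff)
    qed
  next
    assume "W \<subseteq> in_part U' e"
    then show "W \<subseteq> in_part U e"
      using in_part_mono[OF U(3)] by blast
  qed
  show "W \<subseteq> out_part U' e \<longleftrightarrow> W \<subseteq> out_part U e" if src: "src G e = Some v"
  proof
    assume L: "W \<subseteq> out_part U e"
    show "W \<subseteq> out_part U' e"
    proof
      fix x assume x: "x \<in> W"
      then obtain t where t: "x = Edg e' t" "0 < t" "t < 1" using e' by blast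
      have inU: "e' = e" "\<forall>t'. 0 < t' \<and> t' \<le> t \<longrightarrow> Edg e' t' \<in> U"
        using subsetD[OF L x] unfolding t(1) out_part_iff by blast+
      have "Edg e' t \<in> U'" using x W(2) t by blast
      from star_connected_to_vertex[OF U(2) this]
      have "\<forall>t'. 0 < t' \<and> t' \<le> t \<longrightarrow> Edg e' t' \<in> U'"
        unfolding v' using noloop[of t] inU src U(3) by blast
      then show "x \<in> out_part U' e"
        using t inU by (simp add: out_part_iff)
    qed
  next
    assume "W \<subseteq> out_part U' e"
    then show "W \<subseteq> out_part U e"
      using out_part_mono[OF U(3)] by blast
  qed
qed

lemma tgt_ins: "v \<in> verts G \<Longrightarrow> i < length (ins G v) \<Longrightarrow> tgt G (ins G v ! i) = Some v"
  and src_outs: "v \<in> verts G \<Longrightarrow> i < length (outs G v) \<Longrightarrow> src G (outs G v ! i) = Some v"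
  using circuit nth_mem unfolding logic_circuit_def by blast+

lemma star_vertex_subset: "U \<in> star_base G \<Longrightarrow> V \<in> star_base G \<Longrightarrow> V \<subseteq> U \<Longrightarrow> star_vertex G V = star_vertex G U"
  using star_baseD(5) by blast

lemma star_base_not_edge: "U \<in> star_base G \<Longrightarrow> U \<notin> edge_base G"
  using edge_base_subset_not_star by blast

lemma switching_restr_additive:
  assumes "U \<in> opens PS" "V \<in> opens PS" "V \<subseteq> U"
  shows "additive_map (sections PS U) (sections PS V) (switching_restr G U V)"
proof -
  have id: "additive_map M M (\<lambda>x. x)" for M :: "(bit, tensor) module"
    by (simp add: additive_map_def)
  consider "U \<in> star_base G" "V \<in> star_base G" | "U \<in> star_base G" "V \<in> edge_base G"
    | "U \<in> edge_base G" "V \<in> edge_base G"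
    using assms edge_base_subset_not_star unfolding PS_simps by blast
  then show ?thesis
  proof cases
    case 1
    then have "switching_restr G U V = (\<lambda>x. x)"
      using star_base_not_edge[OF 1(2)] by (simp add: fun_eq_iff switching_restr_def)
    then show ?thesis
      using id 1 star_vertex_subset[OF 1 assms(3)] by (simp add: PS_simps)
  next
    case 2
    have "V \<notin> star_base G"
      using 2(2) star_base_not_edge by blast
    then have "additive_map (sections PS U) (sections PS V) (\<lambda>x. lin_ext m g x)" for m g
      using 2 lin_ext_additive by (simp add: PS_simps)
    then show ?thesis
      unfolding switching_restr_def[abs_def] contraction_def[abs_def] gate_map_def[abs_def] Let_def
      using 2 by (cases "\<exists>i<length (ins G (star_vertex G U)). V \<subseteq> in_part U (ins G (star_vertex G U) ! i)")
        (simp_all only: simp_thms if_True if_False)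
  next
    case 3
    then have n: "U \<notin> star_base G" "V \<notin> star_base G"
      using star_base_not_edge by blast+
    then have "switching_restr G U V = (\<lambda>x. x)"
      by (simp add: fun_eq_iff switching_restr_def)
    then show ?thesis
      using id n by (simp add: PS_simps)
  qed
qed

text \<open>A restriction from a star set to an edge set depends only on the vertex and on which
  legs contain the edge set, so functoriality reduces to comparing legs.\<close>

lemma switching_restr_cong:
  assumes "U \<in> star_base G" "V \<in> edge_base G" "U' \<in> star_base G" "V' \<in> edge_base G"
    and v: "star_vertex G U' = star_vertex G U"
    and "\<And>i. i < length (ins G (star_vertex G U)) \<Longrightarrow>
      V' \<subseteq> in_part U' (ins G (star_vertex G U) ! i) \<longleftrightarrow> V \<subseteq> in_part U (ins G (star_vertex G U) ! i)"
    and "\<And>i. i < length (outs G (star_vertex G U)) \<Longrightarrow>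
      V' \<subseteq> out_part U' (outs G (star_vertex G U) ! i) \<longleftrightarrow> V \<subseteq> out_part U (outs G (star_vertex G U) ! i)"
  shows "switching_restr G U' V' = switching_restr G U V"
proof -
  let ?v = "star_vertex G U"
  have p: "(\<lambda>i. i < length (ins G ?v) \<and> V' \<subseteq> in_part U' (ins G ?v ! i)) =
      (\<lambda>i. i < length (ins G ?v) \<and> V \<subseteq> in_part U (ins G ?v ! i))"
    "(\<lambda>j. j < length (outs G ?v) \<and> V' \<subseteq> out_part U' (outs G ?v ! j)) =
      (\<lambda>j. j < length (outs G ?v) \<and> V \<subseteq> out_part U (outs G ?v ! j))"
    by (rule ext, rule conj_cong[OF refl], rule assms(6), assumption)
      (rule ext, rule conj_cong[OF refl], rule assms(7), assumption)
  show ?thesis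
    unfolding switching_restr_def Let_def v p using assms(1-4) by simp
qed

text \<open>An edge set contains no star set, so four kinds of chains remain. Two consist of
  identities; the others compare legs by \<open>part_subset_star\<close> and
  \<open>part_subset_edge\<close>.\<close>

lemma switching_restr_restr:
  assumes "U \<in> opens PS" "V \<in> opens PS" "W \<in> opens PS" "V \<subseteq> U" "W \<subseteq> V"
  shows "switching_restr G V W (switching_restr G U V a) = switching_restr G U W a"
proof -
  have WU: "W \<subseteq> U" using assms by blast
  have id: "switching_restr G U' V' x = x" if "U' \<notin> star_base G \<or> V' \<notin> edge_base G" for U' V' x
    using that by (auto simp: switching_restr_def)
  consider "U \<in> star_base G" "V \<in> star_base G" "W \<in> star_base G"
    | "U \<in> star_base G" "V \<in> star_base G" "W \<in> edge_base G"
    | "U \<in> star_base G" "V \<in> edge_base G" "W \<in> edge_base G"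
    | "U \<in> edge_base G" "V \<in> edge_base G" "W \<in> edge_base G"
    using assms WU edge_base_subset_not_star unfolding PS_simps by blast
  then show ?thesis
  proof cases
    case 2
    have "switching_restr G U V a = a"
      by (rule id) (use 2 star_base_not_edge in blast)
    moreover have "switching_restr G V W = switching_restr G U W"
    proof (rule switching_restr_cong)
      note part = part_subset_star[OF 2(1,2) assms(4) 2(3) assms(5)]
      note v = star_baseD(4)[OF 2(1)]
      show "star_vertex G V = star_vertex G U"
        by (rule star_vertex_subset[OF 2(1,2) assms(4)])
      show "W \<subseteq> in_part V (ins G (star_vertex G U) ! i) \<longleftrightarrow> W \<subseteq> in_part U (ins G (star_vertex G U) ! i)"
        if "i < length (ins G (star_vertex G U))" for i
        by (rule part(1)[OF tgt_ins[OF v that]])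
      show "W \<subseteq> out_part V (outs G (star_vertex G U) ! i) \<longleftrightarrow> W \<subseteq> out_part U (outs G (star_vertex G U) ! i)"
        if "i < length (outs G (star_vertex G U))" for i
        by (rule part(2)[OF src_outs[OF v that]])
    qed (use 2 in auto)
    ultimately show ?thesis by simp
  next
    case 3
    have "W \<noteq> {}" using 3(3) by (rule edge_baseE)
    have "switching_restr G U W = switching_restr G U V"
      by (rule switching_restr_cong) (use 3 part_subset_edge[OF 3(2) assms(4) \<open>W \<noteq> {}\<close> assms(5)] in auto)
    moreover have "switching_restr G V W x = x" for x
      by (rule id) (use 3 star_base_not_edge in blast)
    ultimately show ?thesis by simp
  next
    case 1
    then show ?thesis
      using id[of V W] id[of U V] id[of U W] star_base_not_edge by simp
  next
    case 4
    then have "U \<notin> star_base G" "V \<notin> star_base G"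
      using star_base_not_edge by blast+
    then show ?thesis
      using id[of V W] id[of U V] id[of U W] by simp
  qed
qed

lemma base_refine:
  assumes U: "openin \<T> U" and x: "x \<in> U"
  shows "\<exists>N\<in>opens PS. x \<in> N \<and> N \<subseteq> U"
proof (cases x)
  case (Vtx v)
  then have "v \<in> verts G"
    using U x unfolding open_iff using Vtx_in_points by blast
  moreover obtain r where "0 < r" "r \<le> 1/2" "star v r \<subseteq> U"
    using star_nbhd[OF U] x Vtx by blast
  ultimately show ?thesis
    using Vtx star_in_star_base[of v r] by (intro bexI[of _ "star v r"]) (auto simp: PS_simps)
next
  case (Edg e t)
  then have "e \<in> edges G"
    using U x unfolding open_iff using Edg_in_points by blast
  moreover obtain r where "0 < r" "0 \<le> t - r" "t + r \<le> 1" "edge_seg e (t - r) (t + r) \<subseteq> U"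
    using edge_seg_nbhd[OF U] x Edg by blast
  ultimately show ?thesis
    using Edg edge_seg_in_edge_base[of e "t - r" "t + r"]
    by (intro bexI[of _ "edge_seg e (t - r) (t + r)"]) (auto simp: PS_simps)
qed

lemma opens_PS_open: "U \<in> opens PS \<Longrightarrow> openin \<T> U"
  using star_baseD(1) by (auto simp: PS_simps elim: edge_baseE)

sublocale PS: base_presheaf PS
proof (rule base_presheaf.intro, goal_cases)
  case (1 U)
  then show ?case using bit_space_tens by (simp add: PS_simps)
next
  case (2 U V)
  then show ?case unfolding PS_simps(3) by (rule switching_restr_additive)
next
  case (3 U V W a)
  then show ?case unfolding PS_simps(3) by (intro switching_restr_restr)
next
  case (4 U V x)
  then show ?case using opens_PS_open by (intro base_refine) auto
qed

section \<open>Sections of the switching sheaf over an interval of an edge\<close>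

abbreviation "S \<equiv> switching_sheaf G"

sublocale S: fun_sheaf S
  unfolding switching_sheaf_def
  by (rule PS.fun_sheaf_sheafify) (use opens_PS_open base_refine in auto)

lemma opens_S: "opens S = {U. openin \<T> U}"
  unfolding switching_sheaf_def PS.sheafify_ops ..

lemma sections_S: "sections S = sections (sheafify {U. openin \<T> U} PS)"
  by (simp add: switching_sheaf_def)

text \<open>Restrictions between edge sets are identities, so nothing is identified in passing to
  germs.\<close>

lemma germ_edge_eq_iff:
  assumes "V \<in> edge_base G" "V' \<in> edge_base G" "x \<in> V" "x \<in> V'" "a \<in> carrier plane" "b \<in> carrier plane"
  shows "germ PS x V a = germ PS x V' b \<longleftrightarrow> a = b"
proof -
  have V: "V \<in> opens PS" "V' \<in> opens PS" "V \<notin> star_base G" "V' \<notin> star_base G"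
    using assms star_base_not_edge by (auto simp: PS_simps)
  have "germ PS x V a = germ PS x V' b \<longleftrightarrow>
      (\<exists>N\<in>opens PS. x \<in> N \<and> N \<subseteq> V \<inter> V' \<and> restr PS V N a = restr PS V' N b)"
    by (rule PS.germ_eq_iff) (use assms V in \<open>auto simp: PS_simps(2)\<close>)
  also have "\<dots> \<longleftrightarrow> (\<exists>N\<in>opens PS. x \<in> N \<and> N \<subseteq> V \<inter> V' \<and> a = b)"
    using V by (simp add: PS_simps(3) switching_restr_def)
  also have "\<dots> \<longleftrightarrow> a = b"
    using PS.base[OF V(1,2) assms(3,4)] by blast
  finally show ?thesis .
qed

context
  fixes e :: 'e and p q :: real
  assumes e: "e \<in> edges G" and pq: "0 \<le> p" "p < q" "q \<le> 1"
begin

lemma seg_base: "edge_seg e p q \<in> edge_base G"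
  by (rule edge_seg_in_edge_base) (use e pq in auto)

lemma seg_opens: "edge_seg e p q \<in> opens PS" "edge_seg e p q \<in> opens S"
  using seg_base opens_PS_open by (auto simp: PS_simps opens_S)

lemma sections_PS_seg: "sections PS (edge_seg e p q) = plane"
  using seg_base star_base_not_edge by (auto simp: PS_simps)

lemma wire_section_apply: "x \<in> edge_seg e p q \<Longrightarrow> wire_section G (edge_seg e p q) a x = germ PS x (edge_seg e p q) a"
  by (simp add: wire_section_def germs_of_def)

lemma wire_section_closed: "a \<in> carrier plane \<Longrightarrow> wire_section G (edge_seg e p q) a \<in> carrier (sections S (edge_seg e p q))"
  unfolding wire_section_def sections_S by (rule PS.germs_of_in_sheafify) (use seg_opens sections_PS_seg in auto)

lemma wire_section_additive: "additive_map plane (sections S (edge_seg e p q)) (wire_section G (edge_seg e p q))"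
proof -
  have "additive_map (sections PS (edge_seg e p q)) (prod_module (edge_seg e p q) (stalk PS)) (germs_of PS (edge_seg e p q))"
    by (rule PS.germs_of_additive) (rule seg_opens)
  then show ?thesis
    unfolding sections_PS_seg wire_section_def[symmetric] additive_map_def
    using wire_section_closed by (simp add: sections_S PS.sheafify_ops prod_module_simps)
qed

lemma wire_section_eq_at:
  assumes "x \<in> edge_seg e p q" "a \<in> carrier plane" "b \<in> carrier plane"
    "wire_section G (edge_seg e p q) a x = wire_section G (edge_seg e p q) b x"
  shows "a = b"
  using assms germ_edge_eq_iff[OF seg_base seg_base] by (simp add: wire_section_apply)

lemma inj_wire_section: "inj_on (wire_section G (edge_seg e p q)) (carrier plane)"
proof (rule inj_onI)
  fix a b assume ab: "a \<in> carrier plane" "b \<in> carrier plane"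
    "wire_section G (edge_seg e p q) a = wire_section G (edge_seg e p q) b"
  have "Edg e ((p + q) / 2) \<in> (edge_seg e p q :: ('v, 'e) point set)"
    using pq by auto
  then show "a = b"
    using wire_section_eq_at ab by metis
qed

lemma wire_value_section: "a \<in> carrier plane \<Longrightarrow> wire_value G (edge_seg e p q) (wire_section G (edge_seg e p q) a) = a"
  unfolding wire_value_def by (rule the_inv_into_f_f[OF inj_wire_section])

text \<open>A section over an interval is locally given by an element of the plane; this element is
  locally constant in the parameter, hence constant by connectedness.\<close>

lemma sections_seg:
  assumes s: "s \<in> carrier (sections S (edge_seg e p q))"
  obtains a where "a \<in> carrier plane" "s = wire_section G (edge_seg e p q) a"
proof -
  let ?V = "edge_seg e p q :: ('v, 'e) point set"
  have loc: "\<exists>N b. N \<in> edge_base G \<and> Edg e t \<in> N \<and> N \<subseteq> ?V \<and> b \<in> carrier plane \<and>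
      (\<forall>y\<in>N. s y = germ PS y ?V b)" if t: "p < t" "t < q" for t
  proof -
    have x: "Edg e t \<in> ?V" using t by simp
    obtain N b where N: "N \<in> opens PS" "Edg e t \<in> N" "N \<subseteq> ?V" "b \<in> carrier (sections PS N)"
      "\<And>y. y \<in> N \<Longrightarrow> s y = germ PS y N b"
      using PS.sheafifyE[OF s[unfolded sections_S] x] by metis
    have NE: "N \<in> edge_base G" "N \<notin> star_base G"
      using N(1) edge_base_subset_not_star[OF seg_base N(3)] by (auto simp: PS_simps)
    then have b: "b \<in> carrier plane"
      using N(4) by (simp add: PS_simps)
    then have "s y = germ PS y ?V b" if "y \<in> N" for y
      using N(5)[OF that] germ_edge_eq_iff[OF NE(1) seg_base that, of b b] that N(3) by auto
    then show ?thesis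
      using N NE b by blast
  qed
  \<comment> \<open>The value of s at the parameter t, read in the plane; \<open>a_eq\<close> shows
    that the choice is unique.\<close>
  define a where "a t = (SOME b. b \<in> carrier plane \<and> s (Edg e t) = germ PS (Edg e t) ?V b)" for t
  have a_eq: "a t = b" if "p < t" "t < q" "b \<in> carrier plane" "s (Edg e t) = germ PS (Edg e t) ?V b" for t b
  proof -
    have a: "a t \<in> carrier plane \<and> s (Edg e t) = germ PS (Edg e t) ?V (a t)"
      unfolding a_def by (rule someI[of _ b]) (use that in blast)
    have x: "Edg e t \<in> ?V" using that by simp
    have "germ PS (Edg e t) ?V (a t) = germ PS (Edg e t) ?V b"
      using a that(4) by (rule trans[OF sym, OF conjunct2])
    then show ?thesis
      by (rule iffD1[OF germ_edge_eq_iff[OF seg_base seg_base x x conjunct1[OF a] that(3)]])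
  qed
  have const: "a t = a t'" if "t \<in> {p<..<q}" "t' \<in> {p<..<q}" for t t'
  proof (rule connected_local_const[OF _ that])
    show "\<forall>t\<in>{p<..<q}. eventually (\<lambda>t'. a t = a t') (at t within {p<..<q})"
    proof
      fix t assume t: "t \<in> {p<..<q}"
      then obtain N b where N: "N \<in> edge_base G" "Edg e t \<in> N" "N \<subseteq> ?V" "b \<in> carrier plane"
        "\<And>y. y \<in> N \<Longrightarrow> s y = germ PS y ?V b"
        using loc[of t] by auto
      have "openin \<T> N" using N(1) by (rule edge_baseE)
      then obtain r where r: "r > 0" "edge_seg e (t - r) (t + r) \<subseteq> N"
        using edge_seg_nbhd N(2) by blast
      have "a t' = b" if "t' \<in> {p<..<q}" "dist t' t < r" for t'
      proof (rule a_eq)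
        have "Edg e t' \<in> (edge_seg e (t - r) (t + r) :: ('v, 'e) point set)"
          using that by (auto simp: dist_real_def)
        then show "s (Edg e t') = germ PS (Edg e t') ?V b"
          using r(2) N(5) by blast
      qed (use that N(4) in auto)
      then show "eventually (\<lambda>t'. a t = a t') (at t within {p<..<q})"
        unfolding eventually_at using r(1) t by (metis dist_self)
    qed
  qed simp
  have m: "(p + q) / 2 \<in> {p<..<q}"
    using pq by auto
  let ?a = "a ((p + q) / 2)"
  have "s x = wire_section G ?V ?a x" if x: "x \<in> ?V" for x
  proof -
    obtain t where t: "x = Edg e t" "p < t" "t < q"
      using x by (auto simp: edge_seg_def)
    then obtain b where "b \<in> carrier plane" "s (Edg e t) = germ PS (Edg e t) ?V b"
      using loc[of t] by blast
    then show ?thesis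
      using a_eq[OF t(2,3)] const[OF m, of t] t x by (simp add: wire_section_apply)
  qed
  moreover have "s \<in> extensional ?V"
    using S.extensional[OF seg_opens(2) s] .
  ultimately have "s = wire_section G ?V ?a"
    by (intro extensionalityI[of _ ?V]) (auto simp: wire_section_def germs_of_def)
  moreover have "?a \<in> carrier plane"
    using loc[of "(p + q) / 2"] a_eq[of "(p + q) / 2"] m by fastforce
  ultimately show ?thesis
    using that by blast
qed

lemma restrict_wire_section:
  assumes "p \<le> p'" "p' < q'" "q' \<le> q" "a \<in> carrier plane"
  shows "restrict (wire_section G (edge_seg e p q) a) (edge_seg e p' q') = wire_section G (edge_seg e p' q') a"
proof -
  have V': "edge_seg e p' q' \<in> edge_base G"
    using edge_seg_in_edge_base e pq assms by simp
  have "germ PS x (edge_seg e p q) a = germ PS x (edge_seg e p' q') a" if "x \<in> edge_seg e p' q'" for x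
  proof -
    have "x \<in> edge_seg e p q"
      using that assms by (auto simp: edge_seg_def)
    then show ?thesis
      using germ_edge_eq_iff[OF seg_base V'] that assms(4) by simp
  qed
  moreover have "edge_seg e p' q' \<subseteq> (edge_seg e p q :: ('v, 'e) point set)"
    using assms by (auto simp: edge_seg_def)
  ultimately show ?thesis
    by (auto simp: wire_section_def germs_of_def restrict_def fun_eq_iff)
qed

end

end

text \<open>Both X and A are regions, so their cohomology is counted by one argument.\<close>

locale circuit_region = circuit_graph G for G :: "('v, 'e) circuit" +
  fixes R :: "('v, 'e) point set"
  assumes R_open: "openin \<T> R"
begin

abbreviation "SR \<equiv> restrict_sheaf S R"

sublocale SR: fun_sheaf SR
  by (rule fun_sheaf_restrict_sheaf) (use R_open S.fun_sheaf_axioms in \<open>auto simp: opens_S\<close>)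

lemma opens_SR: "opens SR = {U. openin \<T> U \<and> U \<subseteq> R}"
  by (auto simp: restrict_sheaf_def opens_S)

lemma sections_SR: "sections SR = sections S"
  by (simp add: restrict_sheaf_def)

lemma SR_space: "SR.Y = R"
  using R_open by (auto simp: opens_SR)

text \<open>Sections over an interval are constant and therefore extend. This is the extension
  hypothesis of \<open>SR.sol_Un\<close>.\<close>

lemma E_seg_extend:
  assumes e: "e \<in> edges G" "0 \<le> p" "q \<le> 1" "edge_seg e p q \<subseteq> R" and pq: "p \<le> p'" "p' < q'" "q' \<le> q"
    and f: "f \<in> SR.E (edge_seg e p' q')"
  shows "\<exists>g\<in>SR.E (edge_seg e p q). restrict g (edge_seg e p' q') = f"
proof -
  have sub: "edge_seg e p' q' \<subseteq> (edge_seg e p q :: ('v, 'e) point set)"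
    using pq by (auto simp: edge_seg_def)
  have op: "edge_seg e p q \<in> opens SR" "edge_seg e p' q' \<in> opens SR"
    using e pq sub by (auto simp: opens_SR intro!: open_edge_seg)
  obtain s where s: "s \<in> carrier (sections S (edge_seg e p' q'))" "f = germs_of SR (edge_seg e p' q') s"
    using f by (auto simp: SR.E_def sections_SR)
  obtain a where a: "a \<in> carrier plane" "s = wire_section G (edge_seg e p' q') a"
    using sections_seg[OF e(1) _ pq(2) _ s(1)] e pq by auto
  have w: "wire_section G (edge_seg e p q) a \<in> carrier (sections SR (edge_seg e p q))"
    unfolding sections_SR by (rule wire_section_closed) (use e pq a in auto)
  have "restrict (germs_of SR (edge_seg e p q) (wire_section G (edge_seg e p q) a)) (edge_seg e p' q') = f"
    unfolding s(2) a(2) SR.restrict_germs_of[OF op sub w]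
    using restrict_wire_section[OF e(1,2) _ e(3) pq a(1)] pq by simp
  with w show ?thesis
    unfolding SR.E_def by blast
qed

lemma E_seg_unique:
  assumes e: "e \<in> edges G" "0 \<le> p" "q \<le> 1" "edge_seg e p q \<subseteq> R"
    and fg: "f \<in> SR.E (edge_seg e p q)" "g \<in> SR.E (edge_seg e p q)"
    and m: "p < m" "m < q" "f (Edg e m) = g (Edg e m)"
  shows "f = g"
proof -
  have pq: "p < q" using m by simp
  have op: "edge_seg e p q \<in> opens SR"
    using e by (auto simp: opens_SR intro!: open_edge_seg)
  have x: "Edg e m \<in> (edge_seg e p q :: ('v, 'e) point set)"
    using m by simp
  obtain s where s: "s \<in> carrier (sections S (edge_seg e p q))" "f = germs_of SR (edge_seg e p q) s"
    using fg by (auto simp: SR.E_def sections_SR)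
  obtain t where t: "t \<in> carrier (sections S (edge_seg e p q))" "g = germs_of SR (edge_seg e p q) t"
    using fg by (auto simp: SR.E_def sections_SR)
  obtain a where a: "a \<in> carrier plane" "s = wire_section G (edge_seg e p q) a"
    using sections_seg[OF e(1,2) pq e(3) s(1)] .
  obtain b where b: "b \<in> carrier plane" "t = wire_section G (edge_seg e p q) b"
    using sections_seg[OF e(1,2) pq e(3) t(1)] .
  have "s (Edg e m) = t (Edg e m)"
    by (rule SR.germ_eq_imp[OF op x _ op x]) (use s t m(3) x in \<open>auto simp: sections_SR germs_of_def\<close>)
  then have "a = b"
    using wire_section_eq_at[OF e(1,2) pq e(3) x a(1) b(1)] a b by simp
  then show ?thesis
    using s t a b by simp
qed

lemma seg_Int: "edge_seg e p q \<inter> edge_seg e p' q' = edge_seg e (max p p') (min q q')"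
  by (auto simp: edge_seg_def)

text \<open>The overlap of the two intervals is an interval, and there the difference of the
  primitives is a section vanishing at m, hence zero.\<close>

lemma sol_seg_unique:
  assumes e: "e \<in> edges G" "0 \<le> p" "q \<le> 1" "0 \<le> p'" "q' \<le> 1"
    and s: "SR.sol \<sigma> (edge_seg e p q) s" and s': "SR.sol \<sigma> (edge_seg e p' q') s'"
    and m: "p < m" "m < q" "p' < m" "m < q'" "s (Edg e m) = s' (Edg e m)"
    and t: "p < t" "t < q" "p' < t" "t < q'"
  shows "s (Edg e t) = s' (Edg e t)"
proof -
  let ?P = "max p p'" and ?Q = "min q q'"
  let ?J = "edge_seg e ?P ?Q"
  have op: "edge_seg e p q \<in> opens SR" "edge_seg e p' q' \<in> opens SR"
    using s s' by (auto simp: SR.sol_def)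
  have J: "?J \<in> opens SR" "?J \<subseteq> edge_seg e p q" "?J \<subseteq> edge_seg e p' q'"
    using SR.open_Int[OF op] unfolding seg_Int by (auto simp: edge_seg_def)
  have mt: "Edg e m \<in> ?J" "Edg e t \<in> ?J" using m t by auto
  have r: "SR.sol \<sigma> ?J (restrict s ?J)" "SR.sol \<sigma> ?J (restrict s' ?J)"
    using SR.sol_restrict s s' J by auto
  then have c: "restrict s ?J \<in> carrier (SR.C0 ?J)" "restrict s' ?J \<in> carrier (SR.C0 ?J)"
    by (auto simp: SR.sol_def)
  interpret EJ: bit_subspace "SR.C0 ?J" "SR.E ?J" by (rule SR.E_subspace[OF J(1)])
  have st: "bit_space (stalk SR x)" if "x \<in> ?J" for x
    using SR.bit_space_stalk that J(1) by blast
  have "restrict s ?J \<oplus>\<^bsub>SR.C0 ?J\<^esub> restrict s' ?J = \<zero>\<^bsub>SR.C0 ?J\<^esub>"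
  proof (rule E_seg_unique[where m = m and e = e])
    show "restrict s ?J \<oplus>\<^bsub>SR.C0 ?J\<^esub> restrict s' ?J \<in> SR.E ?J"
      by (rule SR.sol_diff[OF r])
    interpret S: bit_space "stalk SR (Edg e m)" by (rule st[OF mt(1)])
    have "s' (Edg e m) \<in> carrier (stalk SR (Edg e m))"
      using c(2) mt(1) by (auto simp: prod_module_simps PiE_iff)
    then show "(restrict s ?J \<oplus>\<^bsub>SR.C0 ?J\<^esub> restrict s' ?J) (Edg e m) = \<zero>\<^bsub>SR.C0 ?J\<^esub> (Edg e m)"
      using mt(1) m(5) by (simp add: prod_module_simps S.add_self)
    show "?J \<subseteq> R" using J(1) by (simp add: opens_SR)
  qed (use e m EJ.zero_mem in auto)
  then have "restrict s ?J = restrict s' ?J"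
    using EJ.add_eq_zero[OF c] by simp
  then show ?thesis
    using mt(2) by (metis restrict_apply')
qed

text \<open>Bisection: a primitive exists near every point, and primitives on neighbourhoods of two
  consecutive closed intervals combine. Asking for an open interval strictly around the closed one
  makes consecutive ones overlap.\<close>

lemma sol_compact:
  assumes \<sigma>: "\<sigma> \<in> carrier SR.Z1" and e: "e \<in> edges G" "0 \<le> p" "q \<le> 1" "edge_seg e p q \<subseteq> R"
    and xy: "p < x" "x \<le> y" "y < q"
  shows "\<exists>\<alpha> \<beta> s. p \<le> \<alpha> \<and> \<alpha> < x \<and> y < \<beta> \<and> \<beta> \<le> q \<and> SR.sol \<sigma> (edge_seg e \<alpha> \<beta>) s"
  using xy(2)
proof (induction rule: Bolzano)
  case (trans a b c)
  then obtain \<alpha> \<beta> s \<alpha>' \<beta>' s' where s: "p \<le> \<alpha>" "\<alpha> < a" "b < \<beta>" "\<beta> \<le> q" "SR.sol \<sigma> (edge_seg e \<alpha> \<beta>) s"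
    and s': "p \<le> \<alpha>'" "\<alpha>' < b" "c < \<beta>'" "\<beta>' \<le> q" "SR.sol \<sigma> (edge_seg e \<alpha>' \<beta>') s'"
    by blast
  \<comment> \<open>As \<alpha>' < b < \<beta>, the overlap is a nonempty interval, from which the
    correcting section extends to the second interval.\<close>
  have "\<exists>u. SR.sol \<sigma> (edge_seg e \<alpha> \<beta> \<union> edge_seg e \<alpha>' \<beta>') u"
  proof (rule SR.sol_Un[OF s(5) s'(5)])
    fix f assume "f \<in> SR.E (edge_seg e \<alpha> \<beta> \<inter> edge_seg e \<alpha>' \<beta>')"
    then show "\<exists>g\<in>SR.E (edge_seg e \<alpha>' \<beta>'). restrict g (edge_seg e \<alpha> \<beta> \<inter> edge_seg e \<alpha>' \<beta>') = f"
      unfolding seg_Int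
    proof (intro E_seg_extend)
      show "edge_seg e \<alpha>' \<beta>' \<subseteq> R"
        using s'(5) by (simp add: SR.sol_def opens_SR)
    qed (use e s s' trans in auto)
  qed
  moreover have "edge_seg e \<alpha> \<beta> \<union> edge_seg e \<alpha>' \<beta>' = (edge_seg e (min \<alpha> \<alpha>') (max \<beta> \<beta>') :: ('v, 'e) point set)"
  proof (intro equalityI subsetI)
    fix x :: "('v, 'e) point" assume "x \<in> edge_seg e (min \<alpha> \<alpha>') (max \<beta> \<beta>')"
    then show "x \<in> edge_seg e \<alpha> \<beta> \<union> edge_seg e \<alpha>' \<beta>'"
      using s s' trans(3,4) by (cases x) auto
  next
    fix x :: "('v, 'e) point" assume "x \<in> edge_seg e \<alpha> \<beta> \<union> edge_seg e \<alpha>' \<beta>'"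
    then show "x \<in> edge_seg e (min \<alpha> \<alpha>') (max \<beta> \<beta>')"
      by (cases x) auto
  qed
  ultimately show ?case
    using s s' by (intro exI[of _ "min \<alpha> \<alpha>'"] exI[of _ "max \<beta> \<beta>'"]) auto
next
  case (local z)
  have z: "p < z" "z < q" using local xy by auto
  then have "Edg e z \<in> R" using e(4) by auto
  then obtain N s where N: "Edg e z \<in> N" "SR.sol \<sigma> N s"
    using SR.Z1_local[OF \<sigma>] unfolding SR_space by blast
  then have "openin \<T> N" by (simp add: SR.sol_def opens_SR)
  then obtain r where r: "r > 0" "edge_seg e (z - r) (z + r) \<subseteq> N"
    using edge_seg_nbhd N(1) by blast
  let ?r = "min r (min (z - p) (q - z))"
  have sub: "edge_seg e (z - ?r) (z + ?r) \<subseteq> N"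
  proof
    fix x :: "('v, 'e) point" assume "x \<in> edge_seg e (z - ?r) (z + ?r)"
    then have "x \<in> edge_seg e (z - r) (z + r)"
      by (cases x) auto
    then show "x \<in> N" using r(2) by blast
  qed
  have op: "edge_seg e (z - ?r) (z + ?r) \<in> opens SR"
    using sub N(2) e z by (auto simp: opens_SR SR.sol_def intro!: open_edge_seg)
  have "SR.sol \<sigma> (edge_seg e (z - ?r) (z + ?r)) (restrict s (edge_seg e (z - ?r) (z + ?r)))"
    by (rule SR.sol_restrict[OF N(2) op sub])
  then have "\<exists>\<alpha> \<beta> s. p \<le> \<alpha> \<and> \<alpha> < a \<and> b < \<beta> \<and> \<beta> \<le> q \<and> SR.sol \<sigma> (edge_seg e \<alpha> \<beta>) s"
    if "a \<le> z" "z \<le> b" "b - a < ?r" for a b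
    using that by (intro exI[of _ "z - ?r"] exI[of _ "z + ?r"]
        exI[of _ "restrict s (edge_seg e (z - ?r) (z + ?r))"] conjI) auto
  moreover have "?r > 0" using r z by simp
  ultimately show ?case by blast
qed

text \<open>
  Solutions near the midpoint are normalised to a common value there; any two then agree
  wherever both are defined, so they glue to the whole open interval.
\<close>

lemma sol_seg:
  assumes \<sigma>: "\<sigma> \<in> carrier SR.Z1" and e: "e \<in> edges G" "0 \<le> p" "p < q" "q \<le> 1" "edge_seg e p q \<subseteq> R"
  shows "\<exists>s. SR.sol \<sigma> (edge_seg e p q) s"
proof -
  let ?m = "(p + q) / 2"
  let ?x = "Edg e ?m :: ('v, 'e) point"
  have m: "p < ?m" "?m < q" using e by auto
  obtain \<alpha>0 \<beta>0 s0 where s0: "p \<le> \<alpha>0" "\<alpha>0 < ?m" "?m < \<beta>0" "\<beta>0 \<le> q" "SR.sol \<sigma> (edge_seg e \<alpha>0 \<beta>0) s0"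
    using sol_compact[OF \<sigma> e(1,2,4,5) m(1) order_refl m(2)] by blast
  define P where "P t \<alpha> \<beta> s \<longleftrightarrow> p \<le> \<alpha> \<and> \<alpha> < t \<and> \<alpha> < ?m \<and> t < \<beta> \<and> ?m < \<beta> \<and> \<beta> \<le> q \<and>
    SR.sol \<sigma> (edge_seg e \<alpha> \<beta>) s \<and> s ?x = s0 ?x" for t \<alpha> \<beta> s
  have "\<exists>\<alpha> \<beta> s. P t \<alpha> \<beta> s" if t: "p < t" "t < q" for t
  proof -
    have "p < min t ?m" "min t ?m \<le> max t ?m" "max t ?m < q" using t m by auto
    then obtain \<alpha> \<beta> s where s: "p \<le> \<alpha>" "\<alpha> < min t ?m" "max t ?m < \<beta>" "\<beta> \<le> q" "SR.sol \<sigma> (edge_seg e \<alpha> \<beta>) s"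
      using sol_compact[OF \<sigma> e(1,2,4,5)] by blast
    let ?V = "edge_seg e \<alpha> \<beta>" and ?J = "edge_seg e (max \<alpha> \<alpha>0) (min \<beta> \<beta>0)"
    have op: "?V \<in> opens SR" "edge_seg e \<alpha>0 \<beta>0 \<in> opens SR"
      using s s0 by (auto simp: SR.sol_def)
    have J: "?J \<in> opens SR" "?J \<subseteq> ?V" "?J \<subseteq> edge_seg e \<alpha>0 \<beta>0"
      using SR.open_Int[OF op] unfolding seg_Int by (auto simp: edge_seg_def)
    have r: "SR.sol \<sigma> ?J (restrict s ?J)" "SR.sol \<sigma> ?J (restrict s0 ?J)"
      using SR.sol_restrict s(5) s0(5) J by auto
    have "\<exists>g\<in>SR.E ?V. restrict g ?J = restrict s ?J \<oplus>\<^bsub>SR.C0 ?J\<^esub> restrict s0 ?J"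
      by (rule E_seg_extend[OF e(1) _ _ _ _ _ _ SR.sol_diff[OF r]]) (use op e s s0 in \<open>auto simp: opens_SR\<close>)
    then obtain g where g: "g \<in> SR.E ?V" "restrict g ?J = restrict s ?J \<oplus>\<^bsub>SR.C0 ?J\<^esub> restrict s0 ?J" ..
    have xJ: "?x \<in> ?J" using s s0 by auto
    have xV: "?x \<in> ?V" using s by auto
    interpret st: bit_space "stalk SR ?x" by (rule SR.bit_space_stalk) (use op xV in blast)
    have c: "s ?x \<in> carrier (stalk SR ?x)" "s0 ?x \<in> carrier (stalk SR ?x)"
      using s(5) s0 xV by (auto simp: SR.sol_def prod_module_simps PiE_iff)
    have "g ?x = s ?x \<oplus>\<^bsub>stalk SR ?x\<^esub> s0 ?x"
      using fun_cong[OF g(2), of ?x] xJ by (simp add: prod_module_simps)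
    then have "(s \<oplus>\<^bsub>SR.C0 ?V\<^esub> g) ?x = s0 ?x"
      using xV c by (simp add: SR.C0_add_apply st.add_add_self)
    then show ?thesis
      unfolding P_def using SR.sol_add_E[OF s(5) g(1)] s
      by (intro exI[of _ \<alpha>] exI[of _ \<beta>] exI[of _ "s \<oplus>\<^bsub>SR.C0 ?V\<^esub> g"] conjI) auto
  qed
  then obtain \<alpha> \<beta> s where P: "\<And>t. p < t \<Longrightarrow> t < q \<Longrightarrow> P t (\<alpha> t) (\<beta> t) (s t)"
    by metis
  have s: "\<And>t. p < t \<Longrightarrow> t < q \<Longrightarrow> p \<le> \<alpha> t" "\<And>t. p < t \<Longrightarrow> t < q \<Longrightarrow> \<alpha> t < t"
    "\<And>t. p < t \<Longrightarrow> t < q \<Longrightarrow> \<alpha> t < ?m" "\<And>t. p < t \<Longrightarrow> t < q \<Longrightarrow> t < \<beta> t"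
    "\<And>t. p < t \<Longrightarrow> t < q \<Longrightarrow> ?m < \<beta> t" "\<And>t. p < t \<Longrightarrow> t < q \<Longrightarrow> \<beta> t \<le> q"
    "\<And>t. p < t \<Longrightarrow> t < q \<Longrightarrow> SR.sol \<sigma> (edge_seg e (\<alpha> t) (\<beta> t)) (s t)"
    "\<And>t. p < t \<Longrightarrow> t < q \<Longrightarrow> s t ?x = s0 ?x"
    using P unfolding P_def by blast+
  define u where "u = (\<lambda>x\<in>edge_seg e p q. case x of Edg e' t \<Rightarrow> s t x | Vtx v \<Rightarrow> undefined)"
  have "SR.sol \<sigma> (edge_seg e p q) u"
  proof (rule SR.sol_local)
    show "edge_seg e p q \<in> opens SR"
      using e by (auto simp: opens_SR intro!: open_edge_seg)
    fix x :: "('v, 'e) point" assume "x \<in> edge_seg e p q"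
    then obtain t where t: "x = Edg e t" "p < t" "t < q"
      by (auto simp: edge_seg_def)
    note st = s[OF t(2,3)]
    have "u y = s t y" if "y \<in> edge_seg e (\<alpha> t) (\<beta> t)" for y
    proof -
      from that obtain t' where t': "y = Edg e t'" "\<alpha> t < t'" "t' < \<beta> t"
        by (auto simp: edge_seg_def)
      then have pq: "p < t'" "t' < q" using st by auto
      note st' = s[OF pq]
      have "s t' (Edg e t') = s t (Edg e t')"
        by (rule sol_seg_unique[where m = ?m, OF e(1) _ _ _ _ st'(7) st(7)]) (use e st st' t' in auto)
      then show ?thesis
        using t' pq by (simp add: u_def)
    qed
    moreover have "edge_seg e (\<alpha> t) (\<beta> t) \<subseteq> (edge_seg e p q :: ('v, 'e) point set)"
      using st by (auto simp: edge_seg_def)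
    ultimately show "\<exists>N r. x \<in> N \<and> N \<subseteq> edge_seg e p q \<and> SR.sol \<sigma> N r \<and> (\<forall>y\<in>N. u y = r y)"
      using st t by (intro exI[of _ "edge_seg e (\<alpha> t) (\<beta> t)"] exI[of _ "s t"]) auto
  qed (simp add: u_def)
  then show ?thesis by blast
qed

end

section \<open>Stars and legs\<close>

lemma card_tens: "card (carrier (tens m)) = 2 ^ 2 ^ m"
proof -
  let ?W = "{u :: bit list. length u = m}"
  have "bij_betw (\<lambda>x. restrict x ?W) (carrier (tens m)) (?W \<rightarrow>\<^sub>E UNIV)"
    by (rule bij_betwI[where g = "\<lambda>y w. if length w = m then y w else 0"])
      (auto simp: tens_def mk_module_def fun_eq_iff PiE_iff extensional_def)
  then have "card (carrier (tens m)) = card (?W \<rightarrow>\<^sub>E (UNIV :: bit set))"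
    by (rule bij_betw_same_card)
  moreover have "card ?W = 2 ^ m"
    using card_lists_length_eq[of "UNIV :: bit set" m] card_bit by simp
  ultimately show ?thesis
    by (simp add: card_bit_funs finite_words)
qed

lemma finite_tens: "finite (carrier (tens m))"
  by (rule card_ge_0_finite) (simp add: card_tens)

lemma card_plane: "card (carrier plane) = 4"
  using card_tens[of 1] by simp

context fun_sheaf
begin

lemma bij_sections_disjoint:
  assumes U: "\<And>j. j \<in> J \<Longrightarrow> U j \<in> opens F"
    and disj: "\<And>i j. i \<in> J \<Longrightarrow> j \<in> J \<Longrightarrow> i \<noteq> j \<Longrightarrow> U i \<inter> U j = {}"
  shows "bij_betw (\<lambda>s. \<lambda>j\<in>J. restrict s (U j)) (carrier (sections F (\<Union>j\<in>J. U j)))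
    (\<Pi>\<^sub>E j\<in>J. carrier (sections F (U j)))"
proof -
  let ?V = "\<Union>j\<in>J. U j"
  have V: "?V \<in> opens F"
    using U by (intro open_Union) auto
  show ?thesis
    unfolding bij_betw_def
  proof
    show "inj_on (\<lambda>s. \<lambda>j\<in>J. restrict s (U j)) (carrier (sections F ?V))"
    proof (rule inj_onI)
      fix s t assume st: "s \<in> carrier (sections F ?V)" "t \<in> carrier (sections F ?V)"
        and eq: "(\<lambda>j\<in>J. restrict s (U j)) = (\<lambda>j\<in>J. restrict t (U j))"
      show "s = t"
      proof (rule extensionalityI[OF extensional[OF V st(1)] extensional[OF V st(2)]])
        fix x assume "x \<in> ?V"
        then obtain j where j: "j \<in> J" "x \<in> U j" by blast
        then have "restrict s (U j) = restrict t (U j)"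
          using fun_cong[OF eq, of j] by simp
        then show "s x = t x"
          using j(2) by (metis restrict_apply')
      qed
    qed
    show "(\<lambda>s. \<lambda>j\<in>J. restrict s (U j)) ` carrier (sections F ?V) = (\<Pi>\<^sub>E j\<in>J. carrier (sections F (U j)))"
    proof (intro equalityI subsetI)
      fix c assume "c \<in> (\<lambda>s. \<lambda>j\<in>J. restrict s (U j)) ` carrier (sections F ?V)"
      then obtain s where s: "c = (\<lambda>j\<in>J. restrict s (U j))" "s \<in> carrier (sections F ?V)"
        by blast
      have "restrict s (U j) \<in> carrier (sections F (U j))" if "j \<in> J" for j
        using that by (intro restrict_closed[OF V U _ s(2)]) auto
      then show "c \<in> (\<Pi>\<^sub>E j\<in>J. carrier (sections F (U j)))"
        unfolding s by simp
    next
      fix c assume c: "c \<in> (\<Pi>\<^sub>E j\<in>J. carrier (sections F (U j)))"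
      define s where "s = (\<lambda>x\<in>?V. c (THE j. j \<in> J \<and> x \<in> U j) x)"
      have the: "(THE j. j \<in> J \<and> x \<in> U j) = j" if "j \<in> J" "x \<in> U j" for x j
        using that disj by (intro the_equality) blast+
      have res: "restrict s (U j) = c j" if j: "j \<in> J" for j
      proof (rule extensionalityI[of _ "U j"])
        show "c j \<in> extensional (U j)"
          using extensional[OF U[OF j]] c j by blast
        show "restrict s (U j) x = c j x" if "x \<in> U j" for x
          using the[OF j that] that j by (auto simp: s_def)
      qed simp
      have "s \<in> carrier (sections F ?V)"
      proof (rule glue[OF V])
        fix x assume "x \<in> ?V"
        then obtain j where j: "j \<in> J" "x \<in> U j" by blast
        moreover have "restrict s (U j) \<in> carrier (sections F (U j))"
          unfolding res[OF j(1)] using c j(1) by blast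
        ultimately show "\<exists>N\<in>opens F. x \<in> N \<and> N \<subseteq> ?V \<and> restrict s N \<in> carrier (sections F N)"
          using U[OF j(1)] by (intro bexI[of _ "U j"]) auto
      qed (simp add: s_def)
      moreover have "(\<lambda>j\<in>J. restrict s (U j)) = c"
        using c res by (intro extensionalityI[of _ J]) (auto simp: PiE_def)
      ultimately show "c \<in> (\<lambda>s. \<lambda>j\<in>J. restrict s (U j)) ` carrier (sections F ?V)"
        by blast
    qed
  qed
qed

text \<open>Extends a section from all short legs to all long legs simultaneously.\<close>

lemma E_extend_disjoint:
  assumes U: "\<And>j. j \<in> J \<Longrightarrow> U j \<in> opens F" and V: "\<And>j. j \<in> J \<Longrightarrow> V j \<in> opens F"
    and UV: "\<And>j. j \<in> J \<Longrightarrow> U j \<subseteq> V j"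
    and disj: "\<And>i j. i \<in> J \<Longrightarrow> j \<in> J \<Longrightarrow> i \<noteq> j \<Longrightarrow> V i \<inter> V j = {}"
    and ext: "\<And>j f. j \<in> J \<Longrightarrow> f \<in> E (U j) \<Longrightarrow> \<exists>g\<in>E (V j). restrict g (U j) = f"
    and f: "f \<in> E (\<Union>j\<in>J. U j)"
  shows "\<exists>g\<in>E (\<Union>j\<in>J. V j). restrict g (\<Union>j\<in>J. U j) = f"
proof -
  have op: "(\<Union>j\<in>J. U j) \<in> opens F" "(\<Union>j\<in>J. V j) \<in> opens F"
    using U V by (auto intro!: open_Union)
  have "\<exists>g\<in>E (V j). restrict g (U j) = restrict f (U j)" if "j \<in> J" for j
    using that by (intro ext E_restrict[OF op(1) U _ f]) auto
  then obtain g where g: "\<And>j. j \<in> J \<Longrightarrow> g j \<in> E (V j)" "\<And>j. j \<in> J \<Longrightarrow> restrict (g j) (U j) = restrict f (U j)"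
    by metis
  define h where "h = (\<lambda>x\<in>\<Union>j\<in>J. V j. g (THE j. j \<in> J \<and> x \<in> V j) x)"
  have hg: "h x = g j x" if "j \<in> J" "x \<in> V j" for x j
  proof -
    have "(THE j. j \<in> J \<and> x \<in> V j) = j"
      using that disj by (intro the_equality) blast+
    then show ?thesis
      using that by (auto simp: h_def)
  qed
  have "h \<in> E (\<Union>j\<in>J. V j)"
  proof (rule E_local[OF op(2)])
    fix x assume "x \<in> (\<Union>j\<in>J. V j)"
    then obtain j where j: "j \<in> J" "x \<in> V j" by blast
    have "g j \<in> extensional (V j)"
      using g(1)[OF j(1)] by (auto simp: E_def germs_of_def)
    then have "restrict h (V j) = g j"
      using hg j(1) by (intro extensionalityI[of _ "V j"]) auto
    then show "\<exists>N\<in>opens F. x \<in> N \<and> N \<subseteq> (\<Union>j\<in>J. V j) \<and> restrict h N \<in> E N"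
      using g(1)[OF j(1)] j V[OF j(1)] by (intro bexI[of _ "V j"]) auto
  qed (simp add: h_def)
  moreover have "restrict h (\<Union>j\<in>J. U j) = f"
  proof (rule extensionalityI[of _ "\<Union>j\<in>J. U j"])
    show "f \<in> extensional (\<Union>j\<in>J. U j)"
      using f by (auto simp: E_def germs_of_def)
    fix x assume x: "x \<in> (\<Union>j\<in>J. U j)"
    then obtain j where j: "j \<in> J" "x \<in> U j" by blast
    have "g j x = f x"
      using fun_cong[OF g(2)[OF j(1)], of x] j(2) by simp
    then show "restrict h (\<Union>j\<in>J. U j) x = f x"
      using x hg[OF j(1)] UV[OF j(1)] j(2) by auto
  qed simp
  ultimately show ?thesis by blast
qed

end

context circuit_graph
begin

definition stars :: "real \<Rightarrow> ('v, 'e) point set" where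
  "stars r = (\<Union>v\<in>verts G. star v r)"

text \<open>\<open>True\<close> marks the end at the target.\<close>

definition ends :: "('e \<times> bool) set" where
  "ends = {(e, b). e \<in> edges G \<and> (if b then tgt G e \<noteq> None else src G e \<noteq> None)}"

definition leg :: "real \<Rightarrow> 'e \<times> bool \<Rightarrow> ('v, 'e) point set" where
  "leg r = (\<lambda>(e, b). if b then edge_seg e (1 - r) 1 else edge_seg e 0 r)"

definition legs :: "real \<Rightarrow> ('v, 'e) point set" where
  "legs r = (\<Union>j\<in>ends. leg r j)"

lemma Vtx_in_stars [simp]: "Vtx v \<in> stars r \<longleftrightarrow> v \<in> verts G"
  by (auto simp: stars_def)

lemma Edg_in_legs: "Edg e t \<in> legs r \<longleftrightarrow>
    e \<in> edges G \<and> (src G e \<noteq> None \<and> 0 < t \<and> t < r \<or> tgt G e \<noteq> None \<and> 1 - r < t \<and> t < 1)"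
  by (force simp: legs_def ends_def leg_def split: if_splits)

lemma Vtx_notin_legs [simp]: "Vtx v \<notin> legs r"
  by (auto simp: legs_def leg_def split: if_splits)

lemma Edg_in_stars: "Edg e t \<in> stars r \<longleftrightarrow> Edg e t \<in> legs r"
  unfolding Edg_in_legs stars_def using src_in_verts tgt_in_verts by (auto simp: Edg_in_star)

lemma open_stars: "0 < r \<Longrightarrow> r \<le> 1 \<Longrightarrow> openin \<T> (stars r)"
  unfolding stars_def using open_star by auto

text \<open>Long stars arise from short ones by attaching the long legs along the short legs.
  Sections extend from short to long legs, so primitives extend as well.\<close>

lemma stars_decomp:
  assumes "\<delta> \<le> r"
  shows "stars r = stars \<delta> \<union> legs r" "stars \<delta> \<inter> legs r = legs \<delta>"
proof -
  have "x \<in> stars r \<longleftrightarrow> x \<in> stars \<delta> \<union> legs r" "x \<in> stars \<delta> \<inter> legs r \<longleftrightarrow> x \<in> legs \<delta>" for x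
    using assms by (cases x; auto simp: Edg_in_stars Edg_in_legs)+
  then show "stars r = stars \<delta> \<union> legs r" "stars \<delta> \<inter> legs r = legs \<delta>" by blast+
qed

lemma finite_ends: "finite ends"
  by (rule finite_subset[of _ "edges G \<times> UNIV"]) (use finite_edges in \<open>auto simp: ends_def\<close>)

lemma leg_disjoint:
  assumes "r \<le> 1/2" "i \<noteq> j"
  shows "leg r i \<inter> leg r j = {}"
proof -
  have "x \<notin> leg r i \<inter> leg r j" for x
    using assms by (cases x; cases i; cases j) (auto simp: leg_def split: if_splits)
  then show ?thesis by blast
qed

lemma star_disjoint:
  assumes "r \<le> 1/2" "v \<noteq> w"
  shows "star v r \<inter> star w r = {}"
proof -
  have "x \<notin> star v r \<inter> star w r" for x
    using assms by (cases x) (auto simp: Edg_in_star)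
  then show ?thesis by blast
qed

lemma Vtx_notin_edge_base:
  assumes "V \<in> edge_base G"
  shows "Vtx v \<notin> V"
proof -
  obtain e where "\<forall>x\<in>V. \<exists>t. x = Edg e t \<and> 0 < t \<and> t < 1"
    using edge_baseE[OF assms] by metis
  then show ?thesis by auto
qed

text \<open>Restrictions between star sets of one vertex are identities, so every germ is already
  represented on the star of radius 1/2.\<close>

lemma finite_stalk_vertex:
  assumes v: "v \<in> verts G"
  shows "finite (carrier (stalk PS (Vtx v)))"
proof -
  let ?U = "star v (1/2)"
  have U: "?U \<in> star_base G" by (rule star_in_star_base) (use v in auto)
  have "carrier (stalk PS (Vtx v)) \<subseteq> germ PS (Vtx v) ?U ` carrier (sections PS ?U)"
  proof
    fix g assume "g \<in> carrier (stalk PS (Vtx v))"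
    then obtain V a where V: "V \<in> opens PS" "Vtx v \<in> V" "a \<in> carrier (sections PS V)" "g = germ PS (Vtx v) V a"
      unfolding PS.carrier_stalk by blast
    have VS: "V \<in> star_base G"
      using V(1,2) Vtx_notin_edge_base unfolding PS_simps by blast
    have "star_vertex G V = v" "star_vertex G ?U = v"
      using star_baseD(5)[OF VS, of v] star_baseD(5)[OF U, of v] V(2) by simp_all
    then have a: "a \<in> carrier (sections PS ?U)"
      using V(3) VS U by (simp add: PS_simps)
    have Uo: "?U \<in> opens PS" using U by (simp add: PS_simps)
    obtain N where N: "N \<in> opens PS" "Vtx v \<in> N" "N \<subseteq> V \<inter> ?U"
      using PS.base[OF V(1) Uo V(2)] by auto
    have "N \<notin> edge_base G"
      using N(2) Vtx_notin_edge_base by blast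
    then have "restr PS V N a = restr PS ?U N a"
      by (simp add: PS_simps(3) switching_restr_def)
    then have "g = germ PS (Vtx v) ?U a"
      unfolding V(4) using N V Uo a by (subst PS.germ_eq_iff) auto
    then show "g \<in> germ PS (Vtx v) ?U ` carrier (sections PS ?U)"
      using a by blast
  qed
  moreover have "finite (carrier (sections PS ?U))"
    by (simp add: PS_simps finite_tens)
  ultimately show ?thesis
    using finite_surj by blast
qed

text \<open>A section is determined by its restriction to the legs and its germs at the vertices.
  Finiteness is all that is wanted, because the size of this space cancels between X and A.\<close>

lemma finite_sections_stars:
  assumes r: "0 < r" "r \<le> 1/2" and fin: "finite (carrier (sections S (legs r)))"
  shows "finite (carrier (sections S (stars r)))"
proof -
  have op: "stars r \<in> opens S" "legs r \<in> opens S"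
  proof -
    show "stars r \<in> opens S" using open_stars r by (simp add: opens_S)
    have "openin \<T> (leg r j)" if "j \<in> ends" for j
      using that r by (auto simp: ends_def leg_def intro!: open_edge_seg split: if_splits)
    then show "legs r \<in> opens S"
      unfolding legs_def opens_S by auto
  qed
  have sub: "legs r \<subseteq> stars r"
    using stars_decomp[of r r] by blast
  let ?f = "\<lambda>s. (restrict s (legs r), \<lambda>v\<in>verts G. s (Vtx v))"
  have "inj_on ?f (carrier (sections S (stars r)))"
  proof (rule inj_onI)
    fix s t assume st: "s \<in> carrier (sections S (stars r))" "t \<in> carrier (sections S (stars r))" and "?f s = ?f t"
    then have eq: "restrict s (legs r) = restrict t (legs r)" "(\<lambda>v\<in>verts G. s (Vtx v)) = (\<lambda>v\<in>verts G. t (Vtx v))"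
      by blast+
    show "s = t"
    proof (rule extensionalityI[OF S.extensional[OF op(1) st(1)] S.extensional[OF op(1) st(2)]])
      fix x assume x: "x \<in> stars r"
      show "s x = t x"
      proof (cases x)
        case (Vtx v)
        then show ?thesis using x fun_cong[OF eq(2), of v] by simp
      next
        case (Edg e u)
        then have "x \<in> legs r" using x Edg_in_stars by simp
        then show ?thesis using fun_cong[OF eq(1), of x] by simp
      qed
    qed
  qed
  moreover have "?f ` carrier (sections S (stars r)) \<subseteq>
      carrier (sections S (legs r)) \<times> (\<Pi>\<^sub>E v\<in>verts G. carrier (stalk PS (Vtx v)))"
  proof
    fix y assume "y \<in> ?f ` carrier (sections S (stars r))"
    then obtain s where s: "y = ?f s" "s \<in> carrier (sections S (stars r))" by (rule imageE)
    from s(2) have "s \<in> (\<Pi>\<^sub>E x\<in>stars r. carrier (stalk PS x))"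
      unfolding sections_S PS.carrier_sheafify by blast
    then have "s (Vtx v) \<in> carrier (stalk PS (Vtx v))" if "v \<in> verts G" for v
      using PiE_mem[of s "stars r" "\<lambda>x. carrier (stalk PS x)" "Vtx v"] that by simp
    then show "y \<in> carrier (sections S (legs r)) \<times> (\<Pi>\<^sub>E v\<in>verts G. carrier (stalk PS (Vtx v)))"
      unfolding s(1) using S.restrict_closed[OF op sub s(2)] by simp
  qed
  moreover have "finite (\<Pi>\<^sub>E v\<in>verts G. carrier (stalk PS (Vtx v)))"
    by (rule finite_PiE) (use finite_verts finite_stalk_vertex in auto)
  ultimately show ?thesis
    using fin by (meson finite_SigmaI finite_imageD finite_subset)
qed

lemma sections_seg_eq:
  assumes "e \<in> edges G" "0 \<le> p" "p < q" "q \<le> 1"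
  shows "carrier (sections S (edge_seg e p q)) = wire_section G (edge_seg e p q) ` carrier plane"
  using sections_seg[OF assms] wire_section_closed[OF assms] by blast

lemma card_sections_segs:
  assumes J: "finite J"
    and seg: "\<And>j. j \<in> J \<Longrightarrow> \<exists>e p q. e \<in> edges G \<and> 0 \<le> p \<and> p < q \<and> q \<le> 1 \<and> U j = edge_seg e p q"
    and disj: "\<And>i j. i \<in> J \<Longrightarrow> j \<in> J \<Longrightarrow> i \<noteq> j \<Longrightarrow> U i \<inter> U j = {}"
  shows "card (carrier (sections S (\<Union>j\<in>J. U j))) = 4 ^ card J"
proof -
  have c: "U j \<in> opens S \<and> card (carrier (sections S (U j))) = 4" if j: "j \<in> J" for j
  proof -
    obtain e p q where e: "e \<in> edges G" "0 \<le> p" "p < q" "q \<le> 1" "U j = edge_seg e p q"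
      using seg[OF j] by blast
    show ?thesis
      unfolding e(5) sections_seg_eq[OF e(1-4)] card_image[OF inj_wire_section[OF e(1-4)]]
      using seg_opens[OF e(1-4)] by (simp add: card_plane del: One_nat_def)
  qed
  have "bij_betw (\<lambda>s. \<lambda>j\<in>J. restrict s (U j)) (carrier (sections S (\<Union>j\<in>J. U j)))
      (\<Pi>\<^sub>E j\<in>J. carrier (sections S (U j)))"
    by (rule S.bij_sections_disjoint) (use c disj in auto)
  then have "card (carrier (sections S (\<Union>j\<in>J. U j))) = card (\<Pi>\<^sub>E j\<in>J. carrier (sections S (U j)))"
    by (rule bij_betw_same_card)
  then show ?thesis
    using J c by (simp add: card_PiE)
qed

lemma leg_is_seg:
  assumes "0 < r" "r \<le> 1" "j \<in> ends"
  shows "\<exists>e p q. e \<in> edges G \<and> 0 \<le> p \<and> p < q \<and> q \<le> 1 \<and> leg r j = edge_seg e p q"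
proof -
  obtain e b where j: "j = (e, b)" by (cases j)
  show ?thesis
  proof (cases b)
    case True
    then show ?thesis
      using assms j by (intro exI[of _ e] exI[of _ "1 - r"] exI[of _ 1]) (auto simp: ends_def leg_def)
  next
    case False
    then show ?thesis
      using assms j by (intro exI[of _ e] exI[of _ 0] exI[of _ r]) (auto simp: ends_def leg_def)
  qed
qed

lemma card_sections_legs:
  assumes "0 < r" "r \<le> 1/2"
  shows "card (carrier (sections S (legs r))) = 4 ^ card ends"
  unfolding legs_def
  by (rule card_sections_segs[OF finite_ends leg_is_seg leg_disjoint]) (use assms in auto)

end

section \<open>Primitives on stars, and the count of H^1 of a region\<close>

context circuit_region
begin

lemma sol_segs:
  assumes \<sigma>: "\<sigma> \<in> carrier SR.Z1"
    and seg: "\<And>j. j \<in> J \<Longrightarrow> \<exists>e p q. e \<in> edges G \<and> 0 \<le> p \<and> p < q \<and> q \<le> 1 \<and> U j = edge_seg e p q"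
    and disj: "\<And>i j. i \<in> J \<Longrightarrow> j \<in> J \<Longrightarrow> i \<noteq> j \<Longrightarrow> U i \<inter> U j = {}"
    and sub: "(\<Union>j\<in>J. U j) \<subseteq> R"
  shows "\<exists>s. SR.sol \<sigma> (\<Union>j\<in>J. U j) s"
proof -
  have "\<exists>s. SR.sol \<sigma> (U j) s" if j: "j \<in> J" for j
  proof -
    obtain e p q where e: "e \<in> edges G" "0 \<le> p" "p < q" "q \<le> 1" "U j = edge_seg e p q"
      using seg[OF j] by blast
    show ?thesis
      unfolding e(5) by (rule sol_seg[OF \<sigma> e(1-4)]) (use sub j e(5) in blast)
  qed
  then obtain s where "\<And>j. j \<in> J \<Longrightarrow> SR.sol \<sigma> (U j) (s j)"
    by metis
  then show ?thesis
    using disj by (rule SR.sol_disjoint_UN)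
qed

text \<open>Near each vertex there is a primitive on some small star whose radius depends on
  \<sigma>. A common radius \<mu> gives one on all short stars, and \<open>SR.sol_Un\<close> with
  \<open>stars_decomp\<close> carries it out to radius r.\<close>

lemma sol_stars:
  assumes \<sigma>: "\<sigma> \<in> carrier SR.Z1" and r: "0 < r" "r \<le> 1/2" and sub: "stars r \<subseteq> R"
  shows "\<exists>s. SR.sol \<sigma> (stars r) s"
proof -
  have "\<exists>\<delta> s. 0 < \<delta> \<and> \<delta> \<le> r \<and> SR.sol \<sigma> (star v \<delta>) s" if v: "v \<in> verts G" for v
  proof -
    have "Vtx v \<in> R" using sub v by auto
    then obtain N s where N: "Vtx v \<in> N" "SR.sol \<sigma> N s"
      using SR.Z1_local[OF \<sigma>] unfolding SR_space by blast
    then have No: "openin \<T> N" by (simp add: SR.sol_def opens_SR)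
    obtain \<delta> where \<delta>: "0 < \<delta>" "\<delta> \<le> 1/2" "star v \<delta> \<subseteq> N"
      using star_nbhd[OF No N(1)] by blast
    let ?\<delta> = "min \<delta> r"
    have sN: "star v ?\<delta> \<subseteq> N"
      using \<delta>(3) star_mono[of ?\<delta> \<delta> v] by simp
    have "star v ?\<delta> \<in> opens SR"
      using sN N(2) \<delta> r v open_star[of v ?\<delta>] by (auto simp: opens_SR SR.sol_def)
    then have "SR.sol \<sigma> (star v ?\<delta>) (restrict s (star v ?\<delta>))"
      by (rule SR.sol_restrict[OF N(2) _ sN])
    then show ?thesis
      using \<delta> r by (intro exI[of _ ?\<delta>] exI[of _ "restrict s (star v ?\<delta>)"]) auto
  qed
  then obtain \<delta> s where \<delta>: "\<And>v. v \<in> verts G \<Longrightarrow> 0 < \<delta> v" "\<And>v. v \<in> verts G \<Longrightarrow> \<delta> v \<le> r"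
    "\<And>v. v \<in> verts G \<Longrightarrow> SR.sol \<sigma> (star v (\<delta> v)) (s v)"
    by metis
  \<comment> \<open>The entry r keeps the set nonempty when there are no vertices.\<close>
  define \<mu> where "\<mu> = Min (insert r (\<delta> ` verts G))"
  have fin: "finite (insert r (\<delta> ` verts G))"
    using finite_verts by simp
  have \<mu>r: "\<mu> \<le> r"
    unfolding \<mu>_def by (rule Min_le[OF fin]) blast
  have \<mu>\<delta>: "\<mu> \<le> \<delta> v" if "v \<in> verts G" for v
    unfolding \<mu>_def by (rule Min_le[OF fin]) (use that in blast)
  have "\<mu> \<in> insert r (\<delta> ` verts G)"
    unfolding \<mu>_def by (rule Min_in[OF fin]) blast
  then have \<mu>0: "0 < \<mu>"
    using \<delta>(1) r by auto
  have "SR.sol \<sigma> (star v \<mu>) (restrict (s v) (star v \<mu>))" if v: "v \<in> verts G" for v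
  proof (rule SR.sol_restrict[OF \<delta>(3)[OF v]])
    show "star v \<mu> \<subseteq> star v (\<delta> v)"
      by (rule star_mono[OF \<mu>\<delta>[OF v]])
    then show "star v \<mu> \<in> opens SR"
      using \<delta>(3)[OF v] open_star[OF v \<mu>0] \<mu>r r by (auto simp: opens_SR SR.sol_def)
  qed
  then have "\<exists>u. SR.sol \<sigma> (stars \<mu>) u"
    unfolding stars_def by (rule SR.sol_disjoint_UN) (use star_disjoint[of \<mu>] \<mu>r r in auto)
  then obtain u where u: "SR.sol \<sigma> (stars \<mu>) u" by blast
  have legsR: "legs r \<subseteq> R"
    using sub stars_decomp(1)[of r r] by blast
  have "\<exists>w. SR.sol \<sigma> (legs r) w"
    unfolding legs_def
    by (rule sol_segs[OF \<sigma> leg_is_seg leg_disjoint]) (use r legsR in \<open>auto simp: legs_def\<close>)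
  then obtain w where w: "SR.sol \<sigma> (legs r) w" by blast
  have "\<exists>u. SR.sol \<sigma> (stars \<mu> \<union> legs r) u"
  proof (rule SR.sol_Un[OF u w])
    have leg_open: "leg r' j \<in> opens SR" if j: "j \<in> ends" "0 < r'" "r' \<le> r" for j r'
    proof -
      have "legs r' \<subseteq> legs r"
        using j(3) stars_decomp(2)[OF j(3)] by blast
      then have "leg r' j \<subseteq> R"
        using legsR j(1) unfolding legs_def by blast
      moreover obtain e p q where "e \<in> edges G" "0 \<le> p" "q \<le> 1" "leg r' j = edge_seg e p q"
        using leg_is_seg[of r' j] j r by force
      ultimately show ?thesis
        by (auto simp: opens_SR intro!: open_edge_seg)
    qed
    fix f assume "f \<in> SR.E (stars \<mu> \<inter> legs r)"
    then have f: "f \<in> SR.E (\<Union>j\<in>ends. leg \<mu> j)"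
      by (simp only: stars_decomp(2)[OF \<mu>r] legs_def[of \<mu>])
    show "\<exists>g\<in>SR.E (legs r). restrict g (stars \<mu> \<inter> legs r) = f"
      unfolding stars_decomp(2)[OF \<mu>r] unfolding legs_def
    proof (rule SR.E_extend_disjoint[OF _ _ _ _ _ f])
      fix j assume j: "j \<in> ends"
      show lo: "leg \<mu> j \<in> opens SR" "leg r j \<in> opens SR"
        using leg_open[OF j] \<mu>0 \<mu>r r by auto
      obtain e b where eb: "j = (e, b)" by (cases j)
      show "leg \<mu> j \<subseteq> leg r j"
      proof
        fix x assume "x \<in> leg \<mu> j"
        then show "x \<in> leg r j"
          using \<mu>r unfolding eb by (cases x) (auto simp: leg_def split: if_splits)
      qed
      fix f assume f: "f \<in> SR.E (leg \<mu> j)"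
      have e: "e \<in> edges G" using j eb by (simp add: ends_def)
      have R: "leg r j \<subseteq> R" using lo by (simp add: opens_SR)
      show "\<exists>g\<in>SR.E (leg r j). restrict g (leg \<mu> j) = f"
      proof (cases b)
        case True
        have "\<exists>g\<in>SR.E (edge_seg e (1 - r) 1). restrict g (edge_seg e (1 - \<mu>) 1) = f"
          by (rule E_seg_extend) (use True e eb R f r \<mu>0 \<mu>r in \<open>auto simp: leg_def\<close>)
        then show ?thesis using True eb by (simp add: leg_def)
      next
        case False
        have "\<exists>g\<in>SR.E (edge_seg e 0 r). restrict g (edge_seg e 0 \<mu>) = f"
          by (rule E_seg_extend) (use False e eb R f r \<mu>0 \<mu>r in \<open>auto simp: leg_def\<close>)
        then show ?thesis using False eb by (simp add: leg_def)
      qed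
    qed (use leg_disjoint r leg_open \<mu>0 \<mu>r in auto)
  qed
  then show ?thesis
    unfolding stars_decomp(1)[OF \<mu>r, symmetric] .
qed

text \<open>The Euler characteristic of the region, in multiplicative form.\<close>

lemma card_H1_region:
  assumes r: "0 < r" "r \<le> 1/2" and J: "finite J"
    and seg: "\<And>j. j \<in> J \<Longrightarrow> \<exists>e p q. e \<in> edges G \<and> 0 \<le> p \<and> p < q \<and> q \<le> 1 \<and> U j = edge_seg e p q"
    and disj: "\<And>i j. i \<in> J \<Longrightarrow> j \<in> J \<Longrightarrow> i \<noteq> j \<Longrightarrow> U i \<inter> U j = {}"
    and R: "R = stars r \<union> (\<Union>j\<in>J. U j)" and Int: "stars r \<inter> (\<Union>j\<in>J. U j) = legs r"
  shows "finite (carrier (H1 SR))" "finite (carrier (sections S R))"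
    and "card (carrier (H1 SR)) * (card (carrier (sections S (stars r))) * 4 ^ card J) =
      card (carrier (sections S R)) * 4 ^ card ends"
    and "card (carrier (sections S (stars r))) > 0"
proof -
  let ?C = "\<Union>j\<in>J. U j"
  have cL: "card (carrier (sections S (legs r))) = 4 ^ card ends"
    by (rule card_sections_legs[OF r])
  have cC: "card (carrier (sections S ?C)) = 4 ^ card J"
    by (rule card_sections_segs[OF J seg disj])
  have finL: "finite (carrier (sections S (legs r)))"
    by (rule card_ge_0_finite) (simp add: cL)
  have finC: "finite (carrier (sections S ?C))"
    by (rule card_ge_0_finite) (simp add: cC)
  have finB: "finite (carrier (sections S (stars r)))"
    by (rule finite_sections_stars[OF r finL])
  have openU: "openin \<T> (U j)" if "j \<in> J" for j
    using seg[OF that] open_edge_seg by auto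
  have B: "stars r \<in> opens SR"
  proof -
    have "stars r \<subseteq> R" using R by blast
    then show ?thesis using open_stars[of r] r by (simp add: opens_SR)
  qed
  have C: "?C \<in> opens SR"
  proof -
    have "?C \<subseteq> R" using R by blast
    then show ?thesis using openU by (auto simp: opens_SR)
  qed
  interpret BS: bit_space "sections S (stars r)"
    using SR.space[OF B] by (simp add: sections_SR)
  show Bpos: "card (carrier (sections S (stars r))) > 0"
    using finB BS.zero_closed by (auto simp: card_gt_0_iff)
  have cover: "stars r \<union> ?C = SR.Y"
    unfolding SR_space using R by simp
  have fin: "finite (carrier (sections SR (stars r)))" "finite (carrier (sections SR ?C))"
    "finite (carrier (sections SR (stars r \<inter> ?C)))"
    unfolding Int sections_SR using finB finC finL by simp_all
  have solB: "\<exists>s. SR.sol \<sigma> (stars r) s" if "\<sigma> \<in> carrier SR.Z1" for \<sigma>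
    by (rule sol_stars[OF that r]) (use R in blast)
  have solC: "\<exists>s. SR.sol \<sigma> ?C s" if "\<sigma> \<in> carrier SR.Z1" for \<sigma>
    by (rule sol_segs[OF that seg disj]) (use R in auto)
  note H1 = SR.card_H1[OF B C cover solB solC fin]
  show fH: "finite (carrier (H1 SR))" by (rule H1(1))
  show eq: "card (carrier (H1 SR)) * (card (carrier (sections S (stars r))) * 4 ^ card J) =
      card (carrier (sections S R)) * 4 ^ card ends"
    using H1(2) unfolding Int sections_SR SR_space cC cL .
  interpret H: bit_space "H1 SR" by (rule SR.bit_space_H1)
  have "card (carrier (H1 SR)) > 0"
    using fH H.zero_closed by (auto simp: card_gt_0_iff)
  \<comment> \<open>An infinite set has \<open>card\<close> 0, so positivity carries finiteness; the
    left side of \<open>eq\<close> is a product of positive numbers.\<close>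
  then have "card (carrier (sections S R)) > 0"
    using eq Bpos by (metis gr0I mult_is_0 power_not_zero zero_neq_numeral)
  then show "finite (carrier (sections S R))"
    by (rule card_ge_0_finite)
qed

end

section \<open>Cutting a wire\<close>

context circuit_graph
begin

lemma seg_value:
  assumes "e \<in> edges G" "0 \<le> p" "p < q" "q \<le> 1" and s: "s \<in> carrier (sections S (edge_seg e p q))"
  shows "wire_value G (edge_seg e p q) s \<in> carrier plane"
    and "wire_section G (edge_seg e p q) (wire_value G (edge_seg e p q) s) = s"
proof -
  obtain a where "a \<in> carrier plane" "s = wire_section G (edge_seg e p q) a"
    using sections_seg[OF assms] .
  then show "wire_value G (edge_seg e p q) s \<in> carrier plane"
    "wire_section G (edge_seg e p q) (wire_value G (edge_seg e p q) s) = s"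
    using wire_value_section[OF assms(1-4)] by simp_all
qed

lemma seg_value_additive:
  assumes "e \<in> edges G" "0 \<le> p" "p < q" "q \<le> 1"
  shows "additive_map (sections S (edge_seg e p q)) plane (wire_value G (edge_seg e p q))"
  unfolding additive_map_def
proof (intro conjI ballI funcsetI)
  fix s t assume s: "s \<in> carrier (sections S (edge_seg e p q))" and t: "t \<in> carrier (sections S (edge_seg e p q))"
  let ?w = "wire_section G (edge_seg e p q)" and ?v = "wire_value G (edge_seg e p q)"
  note vs = seg_value[OF assms s] and vt = seg_value[OF assms t]
  interpret bit_space plane by (rule bit_space_tens)
  have "s \<oplus>\<^bsub>sections S (edge_seg e p q)\<^esub> t = ?w (?v s \<oplus>\<^bsub>plane\<^esub> ?v t)"
    using additive_add[OF wire_section_additive[OF assms] vs(1) vt(1)] vs vt by simp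
  then show "?v (s \<oplus>\<^bsub>sections S (edge_seg e p q)\<^esub> t) = ?v s \<oplus>\<^bsub>plane\<^esub> ?v t"
    using wire_value_section[OF assms a_closed[OF vs(1) vt(1)]] by simp
qed (rule seg_value[OF assms])

text \<open>Lets X itself be treated as a region.\<close>

lemma restrict_sheaf_points: "restrict_sheaf S (graph_points G) = S"
proof -
  have "{U \<in> opens S. U \<subseteq> graph_points G} = opens S"
    using open_iff by (auto simp: opens_S)
  then show ?thesis
    by (simp add: restrict_sheaf_def)
qed

end

locale cut_circuit = circuit_graph G for G :: "('v, 'e) circuit" +
  fixes e :: 'e and a b c d :: real
  assumes e: "e \<in> edges G" and bounds: "0 \<le> a" "a < c" "c \<le> d" "d < b" "b \<le> 1"
begin

abbreviation "X \<equiv> graph_points G"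
abbreviation "W \<equiv> edge_seg e a b :: ('v, 'e) point set"
abbreviation "A \<equiv> graph_points G - Edg e ` {c..d}"
abbreviation "I \<equiv> edge_seg e d b :: ('v, 'e) point set"
abbreviation "J \<equiv> edge_seg e a c :: ('v, 'e) point set"

text \<open>Small enough that the legs on e stop short of the removed interval, so the same stars
  and legs serve for X and for A.\<close>

definition "r = min (1/2) (min c (1 - d))"

lemma r: "0 < r" "r \<le> 1/2" "r \<le> c" "r \<le> 1 - d"
  unfolding r_def using bounds by (simp_all add: min_def)

text \<open>One interval per edge, tagged \<open>False\<close>; cutting e leaves its initial part
  under that tag and adds the final part as \<open>(e, True)\<close>.\<close>

definition pieces :: "('e \<times> bool) set" where "pieces = insert (e, True) (edges G \<times> {False})"

definition piece :: "'e \<times> bool \<Rightarrow> ('v, 'e) point set" where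
  "piece = (\<lambda>(e', u). if e' = e then if u then edge_seg e d 1 else edge_seg e 0 c else edge_seg e' 0 1)"

lemma X_cover: "X = stars r \<union> (\<Union>e\<in>edges G. edge_seg e 0 1)" "stars r \<inter> (\<Union>e\<in>edges G. edge_seg e 0 1) = legs r"
proof -
  have "x \<in> X \<longleftrightarrow> x \<in> stars r \<union> (\<Union>e\<in>edges G. edge_seg e 0 1)"
    "x \<in> stars r \<inter> (\<Union>e\<in>edges G. edge_seg e 0 1) \<longleftrightarrow> x \<in> legs r" for x
    using r by (cases x; auto simp: Edg_in_stars Edg_in_legs Edg_in_points Vtx_in_points)+
  then show "X = stars r \<union> (\<Union>e\<in>edges G. edge_seg e 0 1)" "stars r \<inter> (\<Union>e\<in>edges G. edge_seg e 0 1) = legs r"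
    by blast+
qed

lemma A_cover: "A = stars r \<union> (\<Union>j\<in>pieces. piece j)" "stars r \<inter> (\<Union>j\<in>pieces. piece j) = legs r"
proof -
  have P: "Edg e' t \<in> (\<Union>j\<in>pieces. piece j) \<longleftrightarrow> e' \<in> edges G \<and> 0 < t \<and> t < 1 \<and> \<not> (e' = e \<and> c \<le> t \<and> t \<le> d)" for e' t
    using e bounds by (cases "e' = e") (auto simp: pieces_def piece_def split: if_splits)
  have V: "Vtx v \<notin> (\<Union>j\<in>pieces. piece j)" for v
    by (auto simp: piece_def split: if_splits)
  have "x \<in> A \<longleftrightarrow> x \<in> stars r \<union> (\<Union>j\<in>pieces. piece j)" "x \<in> stars r \<inter> (\<Union>j\<in>pieces. piece j) \<longleftrightarrow> x \<in> legs r" for x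
    using r V P by (cases x; auto simp: Edg_in_stars Edg_in_legs Edg_in_points Vtx_in_points)+
  then show "A = stars r \<union> (\<Union>j\<in>pieces. piece j)" "stars r \<inter> (\<Union>j\<in>pieces. piece j) = legs r"
    by blast+
qed

lemma piece_is_seg: "j \<in> pieces \<Longrightarrow> \<exists>e p q. e \<in> edges G \<and> 0 \<le> p \<and> p < q \<and> q \<le> 1 \<and> piece j = edge_seg e p q"
proof -
  assume j: "j \<in> pieces"
  obtain e' u where eu: "j = (e', u)" by (cases j)
  have "0 < c" "c \<le> 1" "0 \<le> d" "d < 1" using bounds by auto
  have "e' \<in> edges G" using j e eu by (auto simp: pieces_def)
  consider "e' = e" u | "e' = e" "\<not> u" | "e' \<noteq> e" by blast
  then show ?thesis
  proof cases
    case 1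
    then show ?thesis
      using e \<open>0 \<le> d\<close> \<open>d < 1\<close> by (intro exI[of _ e] exI[of _ d] exI[of _ 1]) (simp add: eu piece_def)
  next
    case 2
    then show ?thesis
      using e \<open>0 < c\<close> \<open>c \<le> 1\<close> by (intro exI[of _ e] exI[of _ 0] exI[of _ c]) (simp add: eu piece_def)
  next
    case 3
    then show ?thesis
      using \<open>e' \<in> edges G\<close> by (intro exI[of _ e'] exI[of _ 0] exI[of _ 1]) (simp add: eu piece_def)
  qed
qed

lemma piece_disjoint: "i \<in> pieces \<Longrightarrow> j \<in> pieces \<Longrightarrow> i \<noteq> j \<Longrightarrow> piece i \<inter> piece j = {}"
  using bounds by (fastforce simp: pieces_def piece_def edge_seg_def split: if_splits)

lemma open_A: "openin \<T> A"
proof -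
  have "openin \<T> (piece j)" if j: "j \<in> pieces" for j
    using piece_is_seg[OF j] open_edge_seg by auto
  then show ?thesis
    unfolding A_cover(1) using open_stars[of r] r by (intro openin_Un openin_Union) auto
qed

lemma card_pieces: "card pieces = Suc (card (edges G))" "finite pieces"
  using finite_edges by (auto simp: pieces_def card_cartesian_product)

text \<open>\<open>card_H1_region\<close> for X and for A involves the same stars and legs, so those
  counts cancel and only the extra interval of A remains.\<close>

lemma H1_finite: "finite (carrier (H1 S))" "finite (carrier (H1 (restrict_sheaf S A)))"
  and H0_finite: "finite (carrier (sections S X))" "finite (carrier (sections S A))"
  and H1_card: "card (carrier (H1 S)) * card (carrier (sections S A)) =
    4 * card (carrier (H1 (restrict_sheaf S A))) * card (carrier (sections S X))"
  and H1_bit_space: "bit_space (H1 S)" "bit_space (H1 (restrict_sheaf S A))"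
proof -
  interpret RX: circuit_region G X by unfold_locales (rule open_points)
  interpret RA: circuit_region G A by unfold_locales (rule open_A)
  have "\<exists>e p q. e \<in> edges G \<and> 0 \<le> p \<and> p < q \<and> q \<le> 1 \<and>
      (edge_seg e' 0 1 :: ('v, 'e) point set) = edge_seg e p q" if "e' \<in> edges G" for e'
    using that by (intro exI[of _ e'] exI[of _ 0] exI[of _ 1]) auto
  moreover have "(edge_seg e' 0 1 :: ('v, 'e) point set) \<inter> edge_seg e'' 0 1 = {}" if "e' \<noteq> e''" for e' e''
    using that by (auto simp: edge_seg_def)
  ultimately have HX: "finite (carrier (H1 RX.SR))" "finite (carrier (sections S X))"
    "card (carrier (H1 RX.SR)) * (card (carrier (sections S (stars r))) * 4 ^ card (edges G)) =
      card (carrier (sections S X)) * 4 ^ card ends"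
    "card (carrier (sections S (stars r))) > 0"
    using RX.card_H1_region[OF r(1,2) finite_edges _ _ X_cover] by blast+
  have HA: "finite (carrier (H1 RA.SR))" "finite (carrier (sections S A))"
    "card (carrier (H1 RA.SR)) * (card (carrier (sections S (stars r))) * 4 ^ card pieces) =
      card (carrier (sections S A)) * 4 ^ card ends"
    using RA.card_H1_region[OF r(1,2) card_pieces(2) piece_is_seg piece_disjoint A_cover] by blast+
  show "finite (carrier (H1 S))" "finite (carrier (H1 (restrict_sheaf S A)))"
    "finite (carrier (sections S X))" "finite (carrier (sections S A))"
    using HX HA by (simp_all add: restrict_sheaf_points)
  show "bit_space (H1 S)" "bit_space (H1 (restrict_sheaf S A))"
    using RX.SR.bit_space_H1 RA.SR.bit_space_H1 by (simp_all add: restrict_sheaf_points)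
  let ?B = "card (carrier (sections S (stars r)))" and ?E = "4 ^ card (edges G) :: nat" and ?L = "4 ^ card ends :: nat"
  let ?hX = "card (carrier (H1 S))" and ?hA = "card (carrier (H1 (restrict_sheaf S A)))"
    and ?sX = "card (carrier (sections S X))" and ?sA = "card (carrier (sections S A))"
  have 1: "?hX * (?B * ?E) = ?sX * ?L"
    using HX(3) by (simp add: restrict_sheaf_points)
  have 2: "?hA * (?B * (4 * ?E)) = ?sA * ?L"
    using HA(3) by (simp add: card_pieces)
  \<comment> \<open>Both equations are brought to a common positive factor, which then cancels; the
    remaining 4 is the order of the plane on the extra interval.\<close>
  have "(?hX * ?sA) * (?B * ?E * ?L) = (?hX * (?B * ?E)) * (?sA * ?L)"
    by (simp add: algebra_simps)
  also have "\<dots> = (4 * ?hA * ?sX) * (?B * ?E * ?L)"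
    unfolding 1 2[symmetric] by (simp add: algebra_simps)
  finally show "?hX * ?sA = 4 * ?hA * ?sX"
    using HX(4) by simp
qed

lemma eI: "0 \<le> d" "d < b" "b \<le> 1" and eJ: "0 \<le> a" "a < c" "c \<le> 1" and eW: "0 \<le> a" "a < b" "b \<le> 1"
  using bounds by auto

lemma opens_W: "X \<in> opens S" "A \<in> opens S" "W \<in> opens S" "I \<in> opens S" "J \<in> opens S" "A \<inter> W \<in> opens S"
proof -
  show "X \<in> opens S" "A \<in> opens S" "W \<in> opens S" "I \<in> opens S" "J \<in> opens S"
    using open_points open_A open_edge_seg[OF e] eI eJ eW by (auto simp: opens_S)
  then show "A \<inter> W \<in> opens S"
    by (intro S.open_Int)
qed

lemma AW: "A \<inter> W = I \<union> J" "A \<union> W = X"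
proof -
  have "x \<in> A \<inter> W \<longleftrightarrow> x \<in> I \<union> J" "x \<in> A \<union> W \<longleftrightarrow> x \<in> X" for x
    using e bounds by (cases x; auto simp: Edg_in_points Vtx_in_points)+
  then show "A \<inter> W = I \<union> J" "A \<union> W = X" by blast+
qed

lemma subsets: "I \<subseteq> A" "J \<subseteq> A" "I \<subseteq> W" "J \<subseteq> W" "W \<subseteq> X" "I \<subseteq> A \<inter> W" "J \<subseteq> A \<inter> W"
  using AW by blast+

section \<open>The restrictions to the two ends of the wire and the difference map\<close>

definition "P s = wire_value G I (restrict s I)"
definition "Q s = wire_value G J (restrict s J)"

lemma P_section:
  assumes "s \<in> carrier (sections S A)"
  shows "P s \<in> carrier plane" "wire_section G I (P s) = restrict s I"
  using seg_value[OF e eI S.restrict_closed[OF opens_W(2,4) subsets(1) assms]] by (simp_all add: P_def)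

lemma Q_section:
  assumes "s \<in> carrier (sections S A)"
  shows "Q s \<in> carrier plane" "wire_section G J (Q s) = restrict s J"
  using seg_value[OF e eJ S.restrict_closed[OF opens_W(2,5) subsets(2) assms]] by (simp_all add: Q_def)

lemma restrict_additive: "U \<in> opens S \<Longrightarrow> V \<in> opens S \<Longrightarrow> V \<subseteq> U \<Longrightarrow>
    additive_map (sections S U) (sections S V) (\<lambda>s. restrict s V)"
  using S.restr_additive[of U V] unfolding S.restr_eq .

lemma additive_comp: "additive_map M N f \<Longrightarrow> additive_map N K g \<Longrightarrow> additive_map M K (\<lambda>x. g (f x))"
  by (auto simp: additive_map_def Pi_iff)

lemma P_additive: "additive_map (sections S A) plane P" and Q_additive: "additive_map (sections S A) plane Q"
  unfolding P_def[abs_def] Q_def[abs_def]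
  by (rule additive_comp[OF restrict_additive[OF opens_W(2,4) subsets(1)] seg_value_additive[OF e eI]],
      rule additive_comp[OF restrict_additive[OF opens_W(2,5) subsets(2)] seg_value_additive[OF e eJ]])

lemma restrict_wire: "x \<in> carrier plane \<Longrightarrow> restrict (wire_section G W x) I = wire_section G I x"
    "x \<in> carrier plane \<Longrightarrow> restrict (wire_section G W x) J = wire_section G J x"
  by (rule restrict_wire_section[OF e eW]; use bounds in simp)+

abbreviation "\<Delta> \<equiv> mv_difference G A W I J"

text \<open>Subtraction is addition over F_2, which is why both blocks of the second column are the
  identity without a sign.\<close>

lemma \<Delta>_eq:
  assumes s: "s \<in> carrier (sections S A)" and x: "x \<in> carrier plane"
  shows "\<Delta> (s, x) = (P s \<oplus>\<^bsub>plane\<^esub> x, Q s \<oplus>\<^bsub>plane\<^esub> x)"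
proof -
  let ?V = "A \<inter> W"
  interpret p: bit_space plane by (rule bit_space_tens)
  interpret V: bit_space "sections S ?V" by (rule S.space[OF opens_W(6)])
  have sV: "restrict s ?V \<in> carrier (sections S ?V)"
    by (rule S.restrict_closed[OF opens_W(2,6) _ s]) blast
  have wV: "restrict (wire_section G W x) ?V \<in> carrier (sections S ?V)"
    by (rule S.restrict_closed[OF opens_W(3,6) _ wire_section_closed[OF e eW x]]) blast
  have "restrict (restrict s ?V \<oplus>\<^bsub>sections S ?V\<^esub> restrict (wire_section G W x) ?V) N =
      restrict s N \<oplus>\<^bsub>sections S N\<^esub> restrict (wire_section G W x) N"
    if N: "N \<in> opens S" "N \<subseteq> ?V" for N
    using additive_add[OF restrict_additive[OF opens_W(6) N] sV wV] N(2) by (simp add: Int_absorb1 inf.absorb2)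
  then have I: "restrict (restrict s ?V \<oplus>\<^bsub>sections S ?V\<^esub> restrict (wire_section G W x) ?V) I =
      wire_section G I (P s) \<oplus>\<^bsub>sections S I\<^esub> wire_section G I x"
    and J: "restrict (restrict s ?V \<oplus>\<^bsub>sections S ?V\<^esub> restrict (wire_section G W x) ?V) J =
      wire_section G J (Q s) \<oplus>\<^bsub>sections S J\<^esub> wire_section G J x"
    using opens_W subsets P_section[OF s] Q_section[OF s] restrict_wire[OF x] by simp_all
  have "wire_section G I (P s) \<oplus>\<^bsub>sections S I\<^esub> wire_section G I x = wire_section G I (P s \<oplus>\<^bsub>plane\<^esub> x)"
    "wire_section G J (Q s) \<oplus>\<^bsub>sections S J\<^esub> wire_section G J x = wire_section G J (Q s \<oplus>\<^bsub>plane\<^esub> x)"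
    using additive_add[OF wire_section_additive[OF e eI] P_section(1)[OF s] x]
      additive_add[OF wire_section_additive[OF e eJ] Q_section(1)[OF s] x] by simp_all
  then show ?thesis
    unfolding mv_difference_def
    using wire_value_section[OF e eI p.a_closed[OF P_section(1)[OF s] x]]
      wire_value_section[OF e eJ p.a_closed[OF Q_section(1)[OF s] x]]
    by (simp add: S.restr_eq V.minus_eq_add[OF sV wV] I J)
qed

abbreviation "src_sum \<equiv> dir_sum (sections S A) plane"
abbreviation "tgt_sum \<equiv> dir_sum plane plane"

lemma carrier_dir_sum: "carrier (dir_sum M N) = carrier M \<times> carrier N"
  by (simp add: dir_sum_def mk_module_def)

lemma \<Delta>_additive: "additive_map src_sum tgt_sum \<Delta>"
  unfolding additive_map_def carrier_dir_sum
proof (intro conjI ballI funcsetI)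
  interpret p: bit_space plane by (rule bit_space_tens)
  interpret A: bit_space "sections S A" by (rule S.space[OF opens_W(2)])
  fix u assume u: "u \<in> carrier (sections S A) \<times> carrier plane"
  then show "\<Delta> u \<in> carrier plane \<times> carrier plane"
    using P_section(1) Q_section(1) by (auto simp: \<Delta>_eq simp del: One_nat_def)
  fix w assume w: "w \<in> carrier (sections S A) \<times> carrier plane"
  obtain s x t y where st: "u = (s, x)" "w = (t, y)" "s \<in> carrier (sections S A)" "t \<in> carrier (sections S A)"
    "x \<in> carrier plane" "y \<in> carrier plane"
    using u w by blast
  have "u \<oplus>\<^bsub>src_sum\<^esub> w = (s \<oplus>\<^bsub>sections S A\<^esub> t, x \<oplus>\<^bsub>plane\<^esub> y)"
    by (simp add: st dir_sum_def mk_module_def)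
  then show "\<Delta> (u \<oplus>\<^bsub>src_sum\<^esub> w) = \<Delta> u \<oplus>\<^bsub>tgt_sum\<^esub> \<Delta> w"
    using st P_section[OF st(3)] Q_section[OF st(3)] P_section[OF st(4)] Q_section[OF st(4)]
      additive_add[OF P_additive st(3,4)] additive_add[OF Q_additive st(3,4)]
    by (simp add: \<Delta>_eq dir_sum_def mk_module_def p.a_ac del: One_nat_def)
qed

text \<open>A pair in the kernel is a section over A and a constant on W that agree on both
  components of the overlap, that is, a section over X.\<close>

lemma card_kernel: "card {u \<in> carrier src_sum. \<Delta> u = \<zero>\<^bsub>tgt_sum\<^esub>} = card (carrier (sections S X))"
proof -
  interpret p: bit_space plane by (rule bit_space_tens)
  let ?K = "{(s, x) \<in> carrier (sections S A) \<times> carrier plane. P s = x \<and> Q s = x}"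
  have ker: "{u \<in> carrier src_sum. \<Delta> u = \<zero>\<^bsub>tgt_sum\<^esub>} = ?K"
    unfolding carrier_dir_sum
    using P_section(1) Q_section(1) by (auto simp: \<Delta>_eq dir_sum_def mk_module_def p.add_eq_zero simp del: One_nat_def)
  have bij: "bij_betw (\<lambda>t. (restrict t A, wire_value G W (restrict t W))) (carrier (sections S X)) ?K"
    unfolding bij_betw_def
  proof
    have W: "restrict t W \<in> carrier (sections S W)" and A: "restrict t A \<in> carrier (sections S A)"
      if "t \<in> carrier (sections S X)" for t
      using that opens_W subsets by (auto intro!: S.restrict_closed[of X])
    note val = seg_value[OF e eW W]
    show "inj_on (\<lambda>t. (restrict t A, wire_value G W (restrict t W))) (carrier (sections S X))"
    proof (rule inj_onI)
      fix t u assume t: "t \<in> carrier (sections S X)" and u: "u \<in> carrier (sections S X)"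
        and "(restrict t A, wire_value G W (restrict t W)) = (restrict u A, wire_value G W (restrict u W))"
      then have eq: "restrict t A = restrict u A" "wire_value G W (restrict t W) = wire_value G W (restrict u W)"
        by blast+
      have eqW: "restrict t W = restrict u W"
        using val(2)[OF t, unfolded eq(2)] val(2)[OF u] by (rule trans[OF sym])
      show "t = u"
      proof (rule extensionalityI[OF S.extensional[OF opens_W(1) t] S.extensional[OF opens_W(1) u]])
        fix x assume "x \<in> X"
        then consider "x \<in> A" | "x \<in> W" using AW(2) by blast
        then show "t x = u x"
          using fun_cong[OF eq(1), of x] fun_cong[OF eqW, of x] by cases auto
      qed
    qed
    show "(\<lambda>t. (restrict t A, wire_value G W (restrict t W))) ` carrier (sections S X) = ?K"
    proof (intro equalityI subsetI)
      fix u assume "u \<in> (\<lambda>t. (restrict t A, wire_value G W (restrict t W))) ` carrier (sections S X)"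
      then obtain t where u: "u = (restrict t A, wire_value G W (restrict t W))" and t: "t \<in> carrier (sections S X)"
        by (rule imageE)
      let ?x = "wire_value G W (restrict t W)"
      have "restrict t I = wire_section G I ?x" "restrict t J = wire_section G J ?x"
        using restrict_wire[OF val(1)[OF t]] unfolding val(2)[OF t] using subsets by (simp_all add: inf.absorb2)
      then have "P (restrict t A) = ?x" "Q (restrict t A) = ?x"
        unfolding P_def Q_def using subsets wire_value_section[OF e eI val(1)[OF t]] wire_value_section[OF e eJ val(1)[OF t]]
        by (simp_all add: inf.absorb2)
      then show "u \<in> ?K"
        using u A[OF t] val(1)[OF t] by simp
    next
      fix u assume "u \<in> ?K"
      then obtain s x where u: "u = (s, x)" and s: "s \<in> carrier (sections S A)" and x: "x \<in> carrier plane"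
        and PQ: "P s = x" "Q s = x" by blast
      have agree: "s y = wire_section G W x y" if "y \<in> A \<inter> W" for y
      proof -
        have "restrict s I = restrict (wire_section G W x) I" "restrict s J = restrict (wire_section G W x) J"
          using P_section[OF s] Q_section[OF s] PQ restrict_wire[OF x] by simp_all
        moreover have "y \<in> I \<or> y \<in> J" using that AW by blast
        ultimately show ?thesis by (metis restrict_apply')
      qed
      define t where "t = (\<lambda>y\<in>X. if y \<in> A then s y else wire_section G W x y)"
      have tA: "restrict t A = s"
        by (rule extensionalityI[OF _ S.extensional[OF opens_W(2) s]]) (auto simp: t_def)
      have ws: "wire_section G W x \<in> carrier (sections S W)"
        by (rule wire_section_closed[OF e eW x])
      have tW: "restrict t W = wire_section G W x"
      proof (rule extensionalityI[OF _ S.extensional[OF opens_W(3) ws]])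
        show "restrict t W y = wire_section G W x y" if "y \<in> W" for y
          using that agree[of y] subsets(5) by (auto simp: t_def)
      qed simp
      have "t \<in> carrier (sections S X)"
      proof (rule S.glue[OF opens_W(1)])
        fix y assume "y \<in> X"
        then consider "y \<in> A" | "y \<in> W" using AW(2) by blast
        then show "\<exists>N\<in>opens S. y \<in> N \<and> N \<subseteq> X \<and> restrict t N \<in> carrier (sections S N)"
        proof cases
          case 1
          then show ?thesis using tA s opens_W(2) by (intro bexI[of _ A]) auto
        next
          case 2
          then show ?thesis using tW ws opens_W(3) subsets(5) by (intro bexI[of _ W]) auto
        qed
      qed (simp add: t_def)
      moreover have "u = (restrict t A, wire_value G W (restrict t W))"
        unfolding u tA tW wire_value_section[OF e eW x] ..
      ultimately show "u \<in> (\<lambda>t. (restrict t A, wire_value G W (restrict t W))) ` carrier (sections S X)"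
        by (intro image_eqI[where x = t])
    qed
  qed
  show ?thesis
    unfolding ker by (rule bij_betw_same_card[OF bij, symmetric])
qed

section \<open>Rank of the difference map and the dimension formulas\<close>

lemma bit_space_H0: "bit_space (sections S X)" "bit_space (sections S A)"
  using S.space opens_W by blast+

abbreviation "rk \<equiv> lin_rank src_sum tgt_sum \<Delta>"

lemma card_image_rk: "card (\<Delta> ` carrier src_sum) = 2 ^ rk"
proof -
  have sub: "bit_subspace tgt_sum (\<Delta> ` carrier src_sum)"
    by (rule bit_subspace_image[OF bit_space_dir_sum[OF bit_space_H0(2) bit_space_tens]
          bit_space_dir_sum[OF bit_space_tens bit_space_tens] \<Delta>_additive])
  interpret bit_subspace tgt_sum "\<Delta> ` carrier src_sum" by (rule sub)
  have "bit_space (tgt_sum\<lparr>carrier := \<Delta> ` carrier src_sum\<rparr>)"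
    by (rule bit_space_sub[OF sub zero_mem add_mem])
  then interpret im: bit_space "tgt_sum\<lparr>carrier := \<Delta> ` carrier src_sum\<rparr>" .
  have "finite (\<Delta> ` carrier src_sum)"
    unfolding carrier_dir_sum using H0_finite(2) finite_tens by blast
  then show ?thesis
    using im.card_eq_vdim unfolding lin_rank_def by simp
qed

text \<open>The image contains the diagonal, as the image of the pairs (0, x), and lies in the sum
  of two planes; these have orders 4 and 16. It equals the diagonal exactly when P and Q
  agree.\<close>

lemma rank_bounds: "2 \<le> rk" "rk \<le> 4" and rank_2_iff: "rk = 2 \<longleftrightarrow> (\<forall>s\<in>carrier (sections S A). P s = Q s)"
proof -
  interpret p: bit_space plane by (rule bit_space_tens)
  interpret A: bit_space "sections S A" by (rule bit_space_H0)
  let ?im = "\<Delta> ` carrier src_sum" and ?D = "(\<lambda>x. (x, x)) ` carrier plane"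
  have P0: "P \<zero>\<^bsub>sections S A\<^esub> = \<zero>\<^bsub>plane\<^esub>" "Q \<zero>\<^bsub>sections S A\<^esub> = \<zero>\<^bsub>plane\<^esub>"
    using additive_zero[OF bit_space_H0(2) bit_space_tens] P_additive Q_additive by blast+
  have im_sub: "?im \<subseteq> carrier plane \<times> carrier plane"
    using additive_closed[OF \<Delta>_additive] unfolding carrier_dir_sum by blast
  have fin: "finite (carrier plane \<times> carrier plane)"
    using finite_tens by blast
  then have finim: "finite ?im"
    using im_sub finite_subset by blast
  have D_sub: "?D \<subseteq> ?im"
  proof
    fix y assume "y \<in> ?D"
    then obtain x where x: "y = (x, x)" "x \<in> carrier plane" by blast
    then have "y = \<Delta> (\<zero>\<^bsub>sections S A\<^esub>, x)"
      by (simp add: \<Delta>_eq P0 del: One_nat_def)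
    then show "y \<in> ?im"
      unfolding carrier_dir_sum using x(2) A.zero_closed by blast
  qed
  have cD: "card ?D = 4"
    using card_image[of "\<lambda>x. (x, x)" "carrier plane"] card_plane by (simp add: inj_on_def)
  have "(2::nat) ^ 2 \<le> 2 ^ rk"
    using card_mono[OF finim D_sub] cD card_image_rk by simp
  then show "2 \<le> rk"
    by (rule power_le_imp_le_exp[rotated]) simp
  have "card ?im \<le> 16"
    using card_mono[OF fin im_sub] card_plane by (simp add: card_cartesian_product)
  then have "(2::nat) ^ rk \<le> 2 ^ 4"
    using card_image_rk by simp
  then show "rk \<le> 4"
    by (rule power_le_imp_le_exp[rotated]) simp
  show "rk = 2 \<longleftrightarrow> (\<forall>s\<in>carrier (sections S A). P s = Q s)"
  proof
    assume "rk = 2"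
    then have "card ?im = card ?D"
      using cD card_image_rk by simp
    then have eq: "?D = ?im"
      using card_subset_eq[OF finim D_sub] by simp
    show "\<forall>s\<in>carrier (sections S A). P s = Q s"
    proof
      fix s assume s: "s \<in> carrier (sections S A)"
      have "\<Delta> (s, \<zero>\<^bsub>plane\<^esub>) \<in> ?im"
        unfolding carrier_dir_sum using s p.zero_closed by blast
      then have "(P s, Q s) \<in> ?D"
        unfolding eq using s P_section(1)[OF s] Q_section(1)[OF s] by (simp add: \<Delta>_eq del: One_nat_def)
      then show "P s = Q s" by auto
    qed
  next
    assume PQ: "\<forall>s\<in>carrier (sections S A). P s = Q s"
    have "?im \<subseteq> ?D"
    proof
      fix y assume "y \<in> ?im"
      then obtain s x where "y = \<Delta> (s, x)" "s \<in> carrier (sections S A)" "x \<in> carrier plane"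
        unfolding carrier_dir_sum by blast
      then show "y \<in> ?D"
        using PQ Q_section(1)[of s] by (auto simp: \<Delta>_eq simp del: One_nat_def)
    qed
    then have "?im = ?D" using D_sub by blast
    then have "(2::nat) ^ rk = 2 ^ 2"
      using cD card_image_rk by simp
    then show "rk = 2"
      by (rule power_inject_exp[THEN iffD1, rotated]) simp
  qed
qed

text \<open>Exponents of 2 are compared: rank-nullity with \<open>card_kernel\<close> in the first
  formula, \<open>H1_card\<close> in the second. The constant 2 comes from the plane over W in the
  former and from the extra interval of A in the latter.\<close>

lemma dims:
  "vdim (sections S A) + 2 = rk + vdim (sections S X)"
  "vdim (H1 S) + vdim (sections S A) = 2 + vdim (H1 (restrict_sheaf S A)) + vdim (sections S X)"
proof -
  have finD: "finite (carrier src_sum)"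
    unfolding carrier_dir_sum using H0_finite(2) finite_tens by blast
  note cX = bit_space.card_eq_vdim[OF bit_space_H0(1) H0_finite(1)]
    and cA = bit_space.card_eq_vdim[OF bit_space_H0(2) H0_finite(2)]
    and hX = bit_space.card_eq_vdim[OF H1_bit_space(1) H1_finite(1)]
    and hA = bit_space.card_eq_vdim[OF H1_bit_space(2) H1_finite(2)]
  have "card (carrier src_sum) = card (\<Delta> ` carrier src_sum) * card {u \<in> carrier src_sum. \<Delta> u = \<zero>\<^bsub>tgt_sum\<^esub>}"
    by (rule card_image_kernel[OF bit_space_dir_sum[OF bit_space_H0(2) bit_space_tens]
          bit_space_dir_sum[OF bit_space_tens bit_space_tens] \<Delta>_additive finD])
  then have "2 ^ vdim (sections S A) * 4 = 2 ^ rk * (2::nat) ^ vdim (sections S X)"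
    unfolding card_image_rk card_kernel cX unfolding carrier_dir_sum card_cartesian_product card_plane cA .
  then have "(2::nat) ^ (vdim (sections S A) + 2) = 2 ^ (rk + vdim (sections S X))"
    by (simp add: power_add)
  then show "vdim (sections S A) + 2 = rk + vdim (sections S X)"
    by (rule power_inject_exp[THEN iffD1, rotated]) simp
  have "(2::nat) ^ (vdim (H1 S) + vdim (sections S A)) =
      2 ^ (2 + vdim (H1 (restrict_sheaf S A)) + vdim (sections S X))"
    using H1_card unfolding cX cA hX hA by (simp add: power_add)
  then show "vdim (H1 S) + vdim (sections S A) = 2 + vdim (H1 (restrict_sheaf S A)) + vdim (sections S X)"
    by (rule power_inject_exp[THEN iffD1, rotated]) simp
qed

lemma H0_eq: "H0 S = sections S X" "H0 (restrict_sheaf S A) = sections S A"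
proof -
  interpret RA: circuit_region G A by unfold_locales (rule open_A)
  have "\<Union>(opens S) = X"
    using opens_W(1) open_iff by (auto simp: opens_S)
  then show "H0 S = sections S X" by (simp add: H0_def)
  show "H0 (restrict_sheaf S A) = sections S A"
    unfolding H0_def RA.SR_space RA.sections_SR ..
qed

end

theorem mainTheorem2:
  fixes G :: "('v, 'e) circuit" and e :: 'e and a b c d :: real
  assumes "logic_circuit G" and "internal_edge G e"
    and "0 \<le> a" and "a < c" and "c \<le> d" and "d < b" and "b \<le> 1"
  defines "X \<equiv> graph_points G"
    and "W \<equiv> edge_seg e a b"
    and "K \<equiv> Edg e ` {c..d}"
  defines "A \<equiv> X - K"
    and "I \<equiv> edge_seg e d b" \<comment> \<open>the component of \<open>A \<inter> W\<close> towards the gate input\<close>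
    and "J \<equiv> edge_seg e a c" \<comment> \<open>the component of \<open>A \<inter> W\<close> towards the gate output\<close>
    and "S \<equiv> switching_sheaf G"
  defines "SA \<equiv> restrict_sheaf S A"
  defines "P \<equiv> \<lambda>s. wire_value G I (restr S A I s)"
    and "Q \<equiv> \<lambda>s. wire_value G J (restr S A J s)"
    and "\<Delta> \<equiv> mv_difference G A W I J"
  defines "r \<equiv> lin_rank (dir_sum (H0 SA) plane) (dir_sum plane plane) \<Delta>"
  shows "fin_dim (H0 S) \<and> fin_dim (H1 S) \<and> fin_dim (H0 SA) \<and> fin_dim (H1 SA) \<and>
    (\<forall>s\<in>carrier (H0 SA). \<forall>x\<in>carrier plane.
       \<Delta> (s, x) = (P s \<oplus>\<^bsub>plane\<^esub> x, Q s \<oplus>\<^bsub>plane\<^esub> x)) \<and>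
    r \<in> {2, 3, 4} \<and>
    (r = 2 \<longleftrightarrow> (\<forall>s\<in>carrier (H0 SA). P s = Q s)) \<and>
    int (vdim (H0 S)) = int (vdim (H0 SA)) - (if r = 2 then 0 else if r = 3 then 1 else 2) \<and>
    int (vdim (H1 S)) = int (vdim (H1 SA)) + (if r = 2 then 2 else if r = 3 then 1 else 0)"
proof -
  interpret cut: cut_circuit G e a b c d
    using assms(1-7) by unfold_locales (auto simp: internal_edge_def)
  have A: "A = cut.A" "S = cut.S" "W = cut.W" "I = cut.I" "J = cut.J"
    by (simp_all add: A_def X_def K_def S_def W_def I_def J_def)
  have H0: "H0 S = sections S cut.X" "H0 SA = sections S A"
    unfolding SA_def A by (rule cut.H0_eq)+
  have PQ: "P = cut.P" "Q = cut.Q"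
    unfolding P_def Q_def A cut.P_def[abs_def] cut.Q_def[abs_def] cut.S.restr_eq by (rule refl)+
  have D: "\<Delta> = cut.\<Delta>"
    unfolding \<Delta>_def A ..
  have r: "r = cut.rk"
    unfolding r_def D H0 unfolding A ..
  have fin: "fin_dim (H0 S)" "fin_dim (H1 S)" "fin_dim (H0 SA)" "fin_dim (H1 SA)"
    unfolding SA_def A
    using bit_space.fin_dimI[OF cut.bit_space_H0(1) cut.H0_finite(1)]
      bit_space.fin_dimI[OF cut.bit_space_H0(2) cut.H0_finite(2)]
      bit_space.fin_dimI[OF cut.H1_bit_space(1) cut.H1_finite(1)]
      bit_space.fin_dimI[OF cut.H1_bit_space(2) cut.H1_finite(2)]
    by (simp_all only: cut.H0_eq)
  have \<Delta>: "\<forall>s\<in>carrier (H0 SA). \<forall>x\<in>carrier plane. \<Delta> (s, x) = (P s \<oplus>\<^bsub>plane\<^esub> x, Q s \<oplus>\<^bsub>plane\<^esub> x)"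
    unfolding H0 D PQ unfolding A using cut.\<Delta>_eq by blast
  have bounds: "2 \<le> r" "r \<le> 4"
    unfolding r by (rule cut.rank_bounds)+
  have r2: "r = 2 \<longleftrightarrow> (\<forall>s\<in>carrier (H0 SA). P s = Q s)"
    unfolding r H0 PQ unfolding A by (rule cut.rank_2_iff)
  have dims: "vdim (H0 SA) + 2 = r + vdim (H0 S)"
    "vdim (H1 S) + vdim (H0 SA) = 2 + vdim (H1 SA) + vdim (H0 S)"
    unfolding r SA_def A cut.H0_eq by (rule cut.dims)+
  have cases: "r = 2 \<or> r = 3 \<or> r = 4"
    using bounds by auto
  \<comment> \<open>The two relations give dim H^0(X) = dim H^0(A) + 2 - r and dim H^1(X) = dim
    H^1(A) + 4 - r, evaluated at the three possible ranks.\<close>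
  then have "int (vdim (H0 S)) = int (vdim (H0 SA)) - (if r = 2 then 0 else if r = 3 then 1 else 2)"
    "int (vdim (H1 S)) = int (vdim (H1 SA)) + (if r = 2 then 2 else if r = 3 then 1 else 0)"
    using dims by auto
  with fin \<Delta> r2 cases show ?thesis
    by blast
qed

end
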